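(* Let $E$ be a vector bundle of rank $m$ over a manifold $M$, $\nabla$ a linear connection on $E$, and $W$ an $m$-dimensional vector space. If $h\colon M\to E$ is a section of $E$, then for every vector field $X$ on $M$ $$\nabla_Xh=\mathrm{ev}_E\circ\mathcal L^{\nabla}_X(\mathrm{ev}_E^{-1}\circ h),$$ where $\mathcal L^\nabla_X$ is the covariant Darboux-Lie derivative of sections of $L(W,E)\times_{\mathrm{GL}(W)}W$ with respect to the principal connection on $L(W,E)$ induced by $\nabla$.
   Context: All manifolds and maps are smooth; $\Phi^t_X$ denotes the (local) flow of a vector field $X$. $L(W,E)$ is the bundle of $W$-frames in $E$: the set of maps $f\colon W\to E$ that are linear isomorphisms $W\to E_x$ for some $x\in M$; it is a principal $\mathrm{GL}(W)$-bundle over $M$. The associated bundle $L(W,E)\times_{\mathrm{GL}(W)}W$ is the quotient of $L(W,E)\times W$ by $(f,w)g=(fg,g^{-1}w)$, with classes $[f,w]$, and $\mathrm{ev}_E\colon L(W,E)\times_{\mathrm{GL}(W)}W\to E$, $[f,w]\mapsto f(w)$, is the canonical isomorphism. For a vector field $X$ on $M$, $X^\nabla$ denotes its horizontal lift to $E$. The induced principal connection on $L(W,E)$ is the one for which the horizontal lift $X^H$ of $X$ has flow $\Phi^t_{X^H}(f)=\Phi^t_{X^\nabla}\circ f$. Let $X^H_W$ be the vector field on $L(W,E)\times_{\mathrm{GL}(W)}W$ with flow $[f,w]\mapsto[\Phi^t_{X^H}f,w]$. Covariant Darboux-Lie derivative. For a section $s$ of $L(W,E)\times_{\mathrm{GL}(W)}W$,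 the vector $T_xs(X_x)-(X^H_W)_{s(x)}$ is a vertical tangent vector. Identify the vertical bundle of $L(W,E)\times_{\mathrm{GL}(W)}W$ with $L(W,E)\times_{\mathrm{GL}(W)}TW$ via $\nu\colon\left.\frac{d}{dt}\right|_{0}[f,\gamma(t)]\mapsto[f,\dot\gamma(0)]$ ($f$ a fixed frame, $\gamma$ a curve in $W$), and let $\mathrm{vpr}_W\colon TW\to W$, $\left.\frac{d}{dt}\right|_0(w_0+tw_1)\mapsto w_1$. Then $\mathcal L^\nabla_Xs(x)=(\mathrm{id}\times\mathrm{vpr}_W)\big(\nu(T_xs(X_x)-(X^H_W)_{s(x)})\big)$, where $(\mathrm{id}\times\mathrm{vpr}_W)[f,Y]=[f,\mathrm{vpr}_W(Y)]$. The covariant derivative $\nabla_Xh$ of a section $h$ of $E$ is $\nabla_Xh(x)=\mathrm{vpr}_E\big(T_xh(X_x)-(X^\nabla)_{h(x)}\big)$, where $\mathrm{vpr}_E$ sends the vertical vector $\left.\frac{d}{dt}\right|_0(u+tv)$ ($u,v\in E_x$) to $v$. *)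

theory Defs
  imports "HOL-Analysis.Analysis"
begin

section \<open>Finite-dimensional vector spaces and smooth functions\<close>

text \<open>
  Model spaces and the space \<open>W\<close> are types of class \<open>real_normed_vector\<close> that are required to be
  finite-dimensional, rather than types of class \<open>euclidean_space\<close>: the latter have positive
  dimension, whereas zero-dimensional manifolds and bundles of rank zero are admitted here.
  The norm plays no role beyond its topology, which is the same for all norms.
\<close>

definition has_dimension :: "'v::real_vector set \<Rightarrow> nat \<Rightarrow> bool" where
  "has_dimension V m \<longleftrightarrow> (\<exists>B. finite B \<and> independent B \<and> span B = V \<and> card B = m)"

fun Ck_on :: "nat \<Rightarrow> 'v::real_normed_vector set \<Rightarrow> ('v \<Rightarrow> 'u::real_normed_vector) \<Rightarrow> bool" where
  "Ck_on 0 S F \<longleftrightarrow> continuous_on S F"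
| "Ck_on (Suc k) S F \<longleftrightarrow>
     (\<forall>x\<in>S. F differentiable (at x)) \<and> (\<forall>v. Ck_on k S (\<lambda>x. frechet_derivative F (at x) v))"

text \<open>Used only for open \<open>S\<close> in a finite-dimensional space.\<close>

definition smooth_on :: "'v::real_normed_vector set \<Rightarrow> ('v \<Rightarrow> 'u::real_normed_vector) \<Rightarrow> bool" where
  "smooth_on S F \<longleftrightarrow> (\<forall>k. Ck_on k S F)"


section \<open>Manifolds\<close>

text \<open>
  A chart is a pair of a domain and a coordinate map; values outside the domain are irrelevant.
  The topology of a manifold is the one determined by its atlas.
\<close>

type_synonym ('p, 'a) chart = "'p set \<times> ('p \<Rightarrow> 'a)"

record ('p, 'a) manifold =
  points :: "'p set"
  atlas :: "('p, 'a) chart set"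

definition chart_inv :: "('p, 'a) chart \<Rightarrow> 'a \<Rightarrow> 'p" where
  "chart_inv c = inv_into (fst c) (snd c)"

definition mtop :: "('p, 'a::topological_space) manifold \<Rightarrow> 'p topology" where
  "mtop N = topology (\<lambda>U. U \<subseteq> points N \<and> (\<forall>c\<in>atlas N. open (snd c ` (U \<inter> fst c))))"

definition smooth_manifold :: "('p, 'a::real_normed_vector) manifold \<Rightarrow> bool" where
  "smooth_manifold N \<longleftrightarrow>
     (\<exists>n. has_dimension (UNIV :: 'a set) n) \<and>
     (\<Union>c\<in>atlas N. fst c) = points N \<and>
     (\<forall>c\<in>atlas N. inj_on (snd c) (fst c)) \<and>
     (\<forall>c\<in>atlas N. \<forall>d\<in>atlas N.
        open (snd c ` (fst c \<inter> fst d)) \<and>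
        smooth_on (snd c ` (fst c \<inter> fst d)) (snd d \<circ> chart_inv c)) \<and>
     Hausdorff_space (mtop N) \<and> second_countable (mtop N)"

lemma openin_mtop:
  assumes "smooth_manifold N"
  shows "openin (mtop N) U \<longleftrightarrow> U \<subseteq> points N \<and> (\<forall>c\<in>atlas N. open (snd c ` (U \<inter> fst c)))"
proof -
  have inj: "inj_on (snd c) (fst c)" if "c \<in> atlas N" for c
    using assms that by (simp add: smooth_manifold_def)
  have "istopology (\<lambda>U. U \<subseteq> points N \<and> (\<forall>c\<in>atlas N. open (snd c ` (U \<inter> fst c))))"
    unfolding istopology_def
  proof (intro conjI allI impI ballI)
    fix S T c
    assume S: "S \<subseteq> points N \<and> (\<forall>c\<in>atlas N. open (snd c ` (S \<inter> fst c)))"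
      and T: "T \<subseteq> points N \<and> (\<forall>c\<in>atlas N. open (snd c ` (T \<inter> fst c)))"
      and c: "c \<in> atlas N"
    have "snd c ` (S \<inter> T \<inter> fst c) = snd c ` (S \<inter> fst c) \<inter> snd c ` (T \<inter> fst c)"
      using inj[OF c] by (auto simp: inj_on_def)
    then show "open (snd c ` (S \<inter> T \<inter> fst c))"
      using S T c by (simp add: open_Int)
  next
    fix K c
    assume K: "\<forall>S\<in>K. S \<subseteq> points N \<and> (\<forall>c\<in>atlas N. open (snd c ` (S \<inter> fst c)))"
      and c: "c \<in> atlas N"
    have "snd c ` (\<Union>K \<inter> fst c) = (\<Union>S\<in>K. snd c ` (S \<inter> fst c))"
      by auto
    then show "open (snd c ` (\<Union>K \<inter> fst c))"
      using K c by auto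
  qed auto
  then show ?thesis
    unfolding mtop_def by (simp add: topology_inverse')
qed

definition smooth_map ::
  "('p, 'a::real_normed_vector) manifold \<Rightarrow> ('q, 'b::real_normed_vector) manifold \<Rightarrow> ('p \<Rightarrow> 'q) \<Rightarrow> bool"
where
  "smooth_map N N' F \<longleftrightarrow>
     F ` points N \<subseteq> points N' \<and>
     (\<forall>c\<in>atlas N. \<forall>d\<in>atlas N'.
        open (snd c ` {p \<in> fst c. F p \<in> fst d}) \<and>
        smooth_on (snd c ` {p \<in> fst c. F p \<in> fst d}) (snd d \<circ> F \<circ> chart_inv c))"


section \<open>Tangent vectors, vector fields and flows\<close>

text \<open>
  A tangent vector at \<open>p\<close> is the equivalence class of pairs (chart at \<open>p\<close>, coordinate vector) modulo
  the derivatives of the transition maps, written as the function assigning to each chart at \<open>p\<close>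
  its coordinate vector (and \<open>0\<close> to everything else). The vector space operations
  of a tangent space are thus the pointwise ones. The base point is not part of the tangent vector.
\<close>

type_synonym ('p, 'a) tangent = "('p, 'a) chart \<Rightarrow> 'a"

definition tangent_space ::
  "('p, 'a::real_normed_vector) manifold \<Rightarrow> 'p \<Rightarrow> ('p, 'a) tangent set" where
  "tangent_space N p = {v.
     (\<forall>c. \<not> (c \<in> atlas N \<and> p \<in> fst c) \<longrightarrow> v c = 0) \<and>
     (\<forall>c\<in>atlas N. \<forall>d\<in>atlas N. p \<in> fst c \<and> p \<in> fst d \<longrightarrow>
        v d = frechet_derivative (snd d \<circ> chart_inv c) (at (snd c p)) (v c))}"

definition tangent_map ::
  "('p, 'a::real_normed_vector) manifold \<Rightarrow> ('q, 'b::real_normed_vector) manifold \<Rightarrow> ('p \<Rightarrow> 'q) \<Rightarrow>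
   'p \<Rightarrow> ('p, 'a) tangent \<Rightarrow> ('q, 'b) tangent" where
  "tangent_map N N' F p v = (\<lambda>d.
     if d \<in> atlas N' \<and> F p \<in> fst d then
       let c = (SOME c. c \<in> atlas N \<and> p \<in> fst c)
       in frechet_derivative (snd d \<circ> F \<circ> chart_inv c) (at (snd c p)) (v c)
     else 0)"

definition has_velocity ::
  "('p, 'a::real_normed_vector) manifold \<Rightarrow> (real \<Rightarrow> 'p) \<Rightarrow> real \<Rightarrow> ('p, 'a) tangent \<Rightarrow> bool" where
  "has_velocity N \<gamma> t v \<longleftrightarrow>
     \<gamma> t \<in> points N \<and> v \<in> tangent_space N (\<gamma> t) \<and>
     (\<forall>c\<in>atlas N. \<gamma> t \<in> fst c \<longrightarrow>
        (\<forall>\<^sub>F s in nhds t. \<gamma> s \<in> fst c) \<and>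
        ((snd c \<circ> \<gamma>) has_vector_derivative v c) (at t))"

definition velocity ::
  "('p, 'a::real_normed_vector) manifold \<Rightarrow> (real \<Rightarrow> 'p) \<Rightarrow> real \<Rightarrow> ('p, 'a) tangent" where
  "velocity N \<gamma> t = (THE v. has_velocity N \<gamma> t v)"

definition vector_field ::
  "('p, 'a::real_normed_vector) manifold \<Rightarrow> ('p \<Rightarrow> ('p, 'a) tangent) \<Rightarrow> bool" where
  "vector_field N X \<longleftrightarrow>
     (\<forall>p\<in>points N. X p \<in> tangent_space N p) \<and>
     (\<forall>c\<in>atlas N. smooth_on (snd c ` fst c) (\<lambda>y. X (chart_inv c y) c))"

definition integral_curve ::
  "('p, 'a::real_normed_vector) manifold \<Rightarrow> ('p \<Rightarrow> ('p, 'a) tangent) \<Rightarrow> (real \<Rightarrow> 'p) \<Rightarrow> real set \<Rightarrow> bool"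
where
  "integral_curve N X \<gamma> J \<longleftrightarrow> (\<forall>t\<in>J. has_velocity N \<gamma> t (X (\<gamma> t)))"

text \<open>\<open>flows_to N X t p q\<close>: the local flow of \<open>X\<close> is defined at time \<open>t\<close> and point \<open>p\<close>,
  with value \<open>q\<close>.\<close>

definition flows_to ::
  "('p, 'a::real_normed_vector) manifold \<Rightarrow> ('p \<Rightarrow> ('p, 'a) tangent) \<Rightarrow> real \<Rightarrow> 'p \<Rightarrow> 'p \<Rightarrow> bool"
where
  "flows_to N X t p q \<longleftrightarrow>
     (\<exists>\<gamma> a b. 0 \<in> {a<..<b} \<and> t \<in> {a<..<b} \<and> integral_curve N X \<gamma> {a<..<b} \<and> \<gamma> 0 = p \<and> \<gamma> t = q)"

definition flow ::
  "('p, 'a::real_normed_vector) manifold \<Rightarrow> ('p \<Rightarrow> ('p, 'a) tangent) \<Rightarrow> real \<Rightarrow> 'p \<Rightarrow> 'p" where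
  "flow N X t p = (THE q. flows_to N X t p q)"


section \<open>Vector bundles\<close>

text \<open>
  A vector bundle is given by its total set, projection, fibrewise operations and a vector bundle
  atlas: a trivialization is a pair \<open>(V, \<psi>)\<close> where \<open>V\<close> is open in the base and \<open>\<psi>\<close> (defined over \<open>V\<close>)
  restricts to a linear isomorphism from each fibre onto the typical fibre.
  The induced charts of the total space are \<open>u \<mapsto> (\<phi> (\<pi> u), \<psi> u)\<close> for charts \<open>\<phi>\<close> of the base; that they
  form a smooth atlas expresses the smooth compatibility of the trivializations.
\<close>

record ('x, 'e, 'b) vbundle =
  total :: "'e set"
  proj :: "'e \<Rightarrow> 'x"
  vadd :: "'e \<Rightarrow> 'e \<Rightarrow> 'e"
  vscale :: "real \<Rightarrow> 'e \<Rightarrow> 'e"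
  trivs :: "('x set \<times> ('e \<Rightarrow> 'b)) set"

definition fibre :: "('x, 'e, 'b) vbundle \<Rightarrow> 'x \<Rightarrow> 'e set" where
  "fibre E x = {u \<in> total E. proj E u = x}"

definition total_space ::
  "('x, 'a::real_normed_vector) manifold \<Rightarrow> ('x, 'e, 'b::real_normed_vector) vbundle \<Rightarrow>
   ('e, 'a \<times> 'b) manifold" where
  "total_space M E =
     \<lparr>points = total E,
      atlas = {({u \<in> total E. proj E u \<in> U \<inter> V}, \<lambda>u. (\<phi> (proj E u), \<psi> u)) | U \<phi> V \<psi>.
                 (U, \<phi>) \<in> atlas M \<and> (V, \<psi>) \<in> trivs E}\<rparr>"

definition vector_bundle ::
  "('x, 'a::real_normed_vector) manifold \<Rightarrow> ('x, 'e, 'b::real_normed_vector) vbundle \<Rightarrow> nat \<Rightarrow> bool"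
where
  "vector_bundle M E m \<longleftrightarrow>
     has_dimension (UNIV :: 'b set) m \<and>
     proj E ` total E \<subseteq> points M \<and>
     (\<forall>x\<in>points M. \<forall>u\<in>fibre E x. \<forall>u'\<in>fibre E x. vadd E u u' \<in> fibre E x) \<and>
     (\<forall>x\<in>points M. \<forall>u\<in>fibre E x. \<forall>r. vscale E r u \<in> fibre E x) \<and>
     (\<Union>(V, \<psi>)\<in>trivs E. V) = points M \<and>
     (\<forall>(V, \<psi>)\<in>trivs E. openin (mtop M) V \<and>
        (\<forall>x\<in>V. bij_betw \<psi> (fibre E x) UNIV \<and>
           (\<forall>u\<in>fibre E x. \<forall>u'\<in>fibre E x. \<psi> (vadd E u u') = \<psi> u + \<psi> u') \<and>
           (\<forall>u\<in>fibre E x. \<forall>r. \<psi> (vscale E r u) = r *\<^sub>R \<psi> u))) \<and>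
     smooth_manifold (total_space M E)"

definition smooth_section ::
  "('x, 'a::real_normed_vector) manifold \<Rightarrow> ('x, 'e, 'b::real_normed_vector) vbundle \<Rightarrow> ('x \<Rightarrow> 'e) \<Rightarrow> bool"
where
  "smooth_section M E h \<longleftrightarrow>
     smooth_map M (total_space M E) h \<and> (\<forall>x\<in>points M. proj E (h x) = x)"


section \<open>Connections\<close>

text \<open>
  A connection on a fibred manifold \<open>pr : P \<rightarrow> M\<close> is given by its horizontal lift:
  \<open>H p v\<close> is the horizontal vector at \<open>p\<close> over the tangent vector \<open>v\<close> at \<open>pr p\<close>.
\<close>

type_synonym ('x, 'a, 'p, 'c) hlift = "'p \<Rightarrow> ('x, 'a) tangent \<Rightarrow> ('p, 'c) tangent"

definition lift_field ::
  "('p \<Rightarrow> 'x) \<Rightarrow> ('x, 'a, 'p, 'c) hlift \<Rightarrow> ('x \<Rightarrow> ('x, 'a) tangent) \<Rightarrow> 'p \<Rightarrow> ('p, 'c) tangent" where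
  "lift_field pr H X = (\<lambda>p. H p (X (pr p)))"

definition connection ::
  "('x, 'a::real_normed_vector) manifold \<Rightarrow> ('p, 'c::real_normed_vector) manifold \<Rightarrow> ('p \<Rightarrow> 'x) \<Rightarrow>
   ('x, 'a, 'p, 'c) hlift \<Rightarrow> bool" where
  "connection M P pr H \<longleftrightarrow>
     (\<forall>p\<in>points P. \<forall>v\<in>tangent_space M (pr p).
        H p v \<in> tangent_space P p \<and> tangent_map P M pr p (H p v) = v) \<and>
     (\<forall>p\<in>points P. \<forall>v\<in>tangent_space M (pr p). \<forall>v'\<in>tangent_space M (pr p). \<forall>r r'.
        H p (\<lambda>c. r *\<^sub>R v c + r' *\<^sub>R v' c) = (\<lambda>d. r *\<^sub>R H p v d + r' *\<^sub>R H p v' d)) \<and>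
     (\<forall>X. vector_field M X \<longrightarrow> vector_field P (lift_field pr H X))"

text \<open>
  Linearity of a connection on \<open>E\<close>: the horizontal lift is also linear for the vector bundle
  structure of \<open>TE\<close> over \<open>TM\<close>, whose operations are the tangent maps of the fibrewise operations of
  \<open>E\<close>; they are expressed on velocities of curves \<open>\<alpha>\<close>, \<open>\<beta>\<close> lying over the same curve in \<open>M\<close>.
\<close>

definition linear_connection ::
  "('x, 'a::real_normed_vector) manifold \<Rightarrow> ('x, 'e, 'b::real_normed_vector) vbundle \<Rightarrow>
   ('x, 'a, 'e, 'a \<times> 'b) hlift \<Rightarrow> bool" where
  "linear_connection M E nabla \<longleftrightarrow>
     connection M (total_space M E) (proj E) nabla \<and>
     (\<forall>\<alpha> \<beta> v r r'.
        (\<forall>t. \<alpha> t \<in> total E \<and> \<beta> t \<in> total E \<and> proj E (\<alpha> t) = proj E (\<beta> t)) \<and>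
        v \<in> tangent_space M (proj E (\<alpha> 0)) \<and>
        has_velocity (total_space M E) \<alpha> 0 (nabla (\<alpha> 0) v) \<and>
        has_velocity (total_space M E) \<beta> 0 (nabla (\<beta> 0) v) \<longrightarrow>
        has_velocity (total_space M E) (\<lambda>t. vadd E (vscale E r (\<alpha> t)) (vscale E r' (\<beta> t))) 0
          (nabla (vadd E (vscale E r (\<alpha> 0)) (vscale E r' (\<beta> 0))) v))"

text \<open>\<open>vpr_E M E u Y\<close> is the vector \<open>v\<close> in the fibre of \<open>u\<close> such that \<open>Y\<close> is the velocity of
  \<open>t \<mapsto> u + t v\<close> at \<open>t = 0\<close>.\<close>

definition vpr_E ::
  "('x, 'a::real_normed_vector) manifold \<Rightarrow> ('x, 'e, 'b::real_normed_vector) vbundle \<Rightarrow> 'e \<Rightarrow>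
   ('e, 'a \<times> 'b) tangent \<Rightarrow> 'e" where
  "vpr_E M E u Y =
     (THE v. v \<in> fibre E (proj E u) \<and>
        has_velocity (total_space M E) (\<lambda>t. vadd E u (vscale E t v)) 0 Y)"

definition cov_deriv ::
  "('x, 'a::real_normed_vector) manifold \<Rightarrow> ('x, 'e, 'b::real_normed_vector) vbundle \<Rightarrow>
   ('x, 'a, 'e, 'a \<times> 'b) hlift \<Rightarrow> ('x \<Rightarrow> ('x, 'a) tangent) \<Rightarrow> ('x \<Rightarrow> 'e) \<Rightarrow> 'x \<Rightarrow> 'e" where
  "cov_deriv M E nabla X h x =
     vpr_E M E (h x)
       (tangent_map M (total_space M E) h x (X x) - lift_field (proj E) nabla X (h x))"


section \<open>The frame bundle \<open>L(W,E)\<close>\<close>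

text \<open>The space \<open>W\<close> is the type \<open>'w\<close>.\<close>

definition GL :: "('w::real_vector \<Rightarrow> 'w) set" where
  "GL = {g. linear g \<and> bij g}"

definition is_frame :: "('x, 'e, 'b) vbundle \<Rightarrow> 'x \<Rightarrow> ('w::real_vector \<Rightarrow> 'e) \<Rightarrow> bool" where
  "is_frame E x f \<longleftrightarrow>
     bij_betw f UNIV (fibre E x) \<and>
     (\<forall>w w'. f (w + w') = vadd E (f w) (f w')) \<and> (\<forall>r w. f (r *\<^sub>R w) = vscale E r (f w))"

definition frames ::
  "('x, 'a) manifold \<Rightarrow> ('x, 'e, 'b) vbundle \<Rightarrow> ('w::real_vector \<Rightarrow> 'e) set" where
  "frames M E = {f. \<exists>x\<in>points M. is_frame E x f}"

definition frame_proj :: "('x, 'e, 'b) vbundle \<Rightarrow> ('w::zero \<Rightarrow> 'e) \<Rightarrow> 'x" where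
  "frame_proj E f = proj E (f 0)"

text \<open>A trivialization \<open>\<psi>\<close> of \<open>E\<close> and a linear isomorphism \<open>\<iota>\<close> from \<open>W\<close> to the typical fibre give the
  principal bundle trivialization \<open>f \<mapsto> (x, \<iota>\<^sup>-\<^sup>1 \<circ> \<psi> \<circ> f)\<close> of \<open>L(W,E)\<close> with values in \<open>GL(W)\<close>.\<close>

definition principal_trivs ::
  "('x, 'e, 'b::real_vector) vbundle \<Rightarrow>
   ('x set \<times> (('w::real_vector \<Rightarrow> 'e) \<Rightarrow> 'w \<Rightarrow> 'w)) set" where
  "principal_trivs E =
     {(V, \<lambda>f. inv \<iota> \<circ> \<psi> \<circ> f) | V \<psi> (\<iota> :: 'w \<Rightarrow> 'b). (V, \<psi>) \<in> trivs E \<and> linear \<iota> \<and> bij \<iota>}"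

definition frame_bundle ::
  "('x, 'a::real_normed_vector) manifold \<Rightarrow> ('x, 'e, 'b::real_normed_vector) vbundle \<Rightarrow>
   ('w::real_normed_vector \<Rightarrow> 'e, 'a \<times> ('w \<Rightarrow>\<^sub>L 'w)) manifold" where
  "frame_bundle M E =
     \<lparr>points = frames M E,
      atlas = {({f \<in> frames M E. frame_proj E f \<in> U \<inter> V},
                \<lambda>f. (\<phi> (frame_proj E f), Blinfun (\<tau> f))) | U \<phi> V \<tau>.
                 (U, \<phi>) \<in> atlas M \<and> (V, \<tau>) \<in> principal_trivs E}\<rparr>"

type_synonym ('x, 'a, 'e, 'w) frame_hlift = "('x, 'a, 'w \<Rightarrow> 'e, 'a \<times> ('w \<Rightarrow>\<^sub>L 'w)) hlift"

definition principal_connection ::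
  "('x, 'a::real_normed_vector) manifold \<Rightarrow> ('x, 'e, 'b::real_normed_vector) vbundle \<Rightarrow>
   ('x, 'a, 'e, 'w::real_normed_vector) frame_hlift \<Rightarrow> bool" where
  "principal_connection M E \<Gamma> \<longleftrightarrow>
     connection M (frame_bundle M E) (frame_proj E) \<Gamma> \<and>
     (\<forall>g\<in>GL. \<forall>f\<in>frames M E. \<forall>v\<in>tangent_space M (frame_proj E f).
        tangent_map (frame_bundle M E) (frame_bundle M E) (\<lambda>f. f \<circ> g) f (\<Gamma> f v) = \<Gamma> (f \<circ> g) v)"

text \<open>The horizontal lift to \<open>L(W,E)\<close> of each vector field \<open>X\<close> has the flow
  \<open>f \<mapsto> \<Phi>\<^sup>t \<circ> f\<close>, where \<open>\<Phi>\<^sup>t\<close> is the flow of the horizontal lift of \<open>X\<close> to \<open>E\<close>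
  (with the same domain of definition).\<close>

definition induced_connection ::
  "('x, 'a::real_normed_vector) manifold \<Rightarrow> ('x, 'e, 'b::real_normed_vector) vbundle \<Rightarrow>
   ('x, 'a, 'e, 'a \<times> 'b) hlift \<Rightarrow> ('x, 'a, 'e, 'w::real_normed_vector) frame_hlift \<Rightarrow> bool" where
  "induced_connection M E nabla \<Gamma> \<longleftrightarrow>
     principal_connection M E \<Gamma> \<and>
     (\<forall>X. vector_field M X \<longrightarrow>
        (\<forall>t. \<forall>f\<in>frames M E. \<forall>g\<in>frames M E.
           flows_to (frame_bundle M E) (lift_field (frame_proj E) \<Gamma> X) t f g \<longleftrightarrow>
           (\<forall>w. flows_to (total_space M E) (lift_field (proj E) nabla X) t (f w) (g w))))"


section \<open>Associated bundles of \<open>L(W,E)\<close>\<close>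

text \<open>For an action \<open>act\<close> of \<open>GL(W)\<close>, \<open>assoc_class act f y\<close> is the orbit \<open>[f,y]\<close> of the right action
  \<open>(f,y)g = (fg, g\<^sup>-\<^sup>1y)\<close>. It is used with the actions on \<open>W\<close> and on \<open>TW\<close>.\<close>

definition assoc_class ::
  "(('w::real_vector \<Rightarrow> 'w) \<Rightarrow> 'y \<Rightarrow> 'y) \<Rightarrow> ('w \<Rightarrow> 'e) \<Rightarrow> 'y \<Rightarrow> (('w \<Rightarrow> 'e) \<times> 'y) set" where
  "assoc_class act f y = {(f \<circ> g, act (inv g) y) | g. g \<in> GL}"

definition representative :: "(('w \<Rightarrow> 'e) \<times> 'y) set \<Rightarrow> ('w \<Rightarrow> 'e) \<times> 'y" where
  "representative z = (SOME fy. fy \<in> z)"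

definition actW :: "('w \<Rightarrow> 'w) \<Rightarrow> 'w \<Rightarrow> 'w" where
  "actW g w = g w"

text \<open>\<open>TW\<close> is \<open>W \<times> W\<close>, where \<open>(w\<^sub>0, w\<^sub>1)\<close> stands for the velocity of \<open>t \<mapsto> w\<^sub>0 + t w\<^sub>1\<close> at \<open>0\<close>;
  hence a linear \<open>g\<close> acts on both components.\<close>

definition actTW :: "('w \<Rightarrow> 'w) \<Rightarrow> 'w \<times> 'w \<Rightarrow> 'w \<times> 'w" where
  "actTW g Y = (g (fst Y), g (snd Y))"

definition vpr_W :: "'w \<times> 'w \<Rightarrow> 'w" where
  "vpr_W Y = snd Y"

type_synonym ('w, 'e) assoc_point = "(('w \<Rightarrow> 'e) \<times> 'w) set"

definition assoc_proj :: "('x, 'e, 'b) vbundle \<Rightarrow> ('w::zero, 'e) assoc_point \<Rightarrow> 'x" where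
  "assoc_proj E z = frame_proj E (fst (representative z))"

definition assoc_points ::
  "('x, 'a) manifold \<Rightarrow> ('x, 'e, 'b) vbundle \<Rightarrow> ('w::real_vector, 'e) assoc_point set" where
  "assoc_points M E = {assoc_class actW f w | f w. f \<in> frames M E}"

text \<open>A principal trivialization \<open>\<tau>\<close> yields the trivialization \<open>[f,w] \<mapsto> (x, \<tau>(f) w)\<close>.\<close>

definition assoc_bundle ::
  "('x, 'a::real_normed_vector) manifold \<Rightarrow> ('x, 'e, 'b::real_normed_vector) vbundle \<Rightarrow>
   (('w::real_normed_vector, 'e) assoc_point, 'a \<times> 'w) manifold" where
  "assoc_bundle M E =
     \<lparr>points = assoc_points M E,
      atlas = {({z \<in> assoc_points M E. assoc_proj E z \<in> U \<inter> V},
                \<lambda>z. (\<phi> (assoc_proj E z), case representative z of (f, w) \<Rightarrow> \<tau> f w)) | U \<phi> V \<tau>.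
                 (U, \<phi>) \<in> atlas M \<and> (V, \<tau>) \<in> principal_trivs E}\<rparr>"

definition ev :: "('w, 'e) assoc_point \<Rightarrow> 'e" where
  "ev z = (case representative z of (f, w) \<Rightarrow> f w)"

definition ev_inv ::
  "('x, 'a) manifold \<Rightarrow> ('x, 'e, 'b) vbundle \<Rightarrow> 'e \<Rightarrow> ('w::real_vector, 'e) assoc_point" where
  "ev_inv M E = inv_into (assoc_points M E) ev"


section \<open>The covariant Darboux-Lie derivative\<close>

text \<open>The vector field generating the flow \<open>[f,w] \<mapsto> [\<Phi>\<^sup>t f, w]\<close>, where \<open>\<Phi>\<^sup>t\<close> is the flow of the
  horizontal lift of \<open>X\<close> to \<open>L(W,E)\<close>.\<close>

definition assoc_lift ::
  "('x, 'a::real_normed_vector) manifold \<Rightarrow> ('x, 'e, 'b::real_normed_vector) vbundle \<Rightarrow>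
   ('x, 'a, 'e, 'w::real_normed_vector) frame_hlift \<Rightarrow> ('x \<Rightarrow> ('x, 'a) tangent) \<Rightarrow>
   ('w, 'e) assoc_point \<Rightarrow> (('w, 'e) assoc_point, 'a \<times> 'w) tangent" where
  "assoc_lift M E \<Gamma> X z =
     (case representative z of (f, w) \<Rightarrow>
        velocity (assoc_bundle M E)
          (\<lambda>t. assoc_class actW (flow (frame_bundle M E) (lift_field (frame_proj E) \<Gamma> X) t f) w) 0)"

text \<open>\<open>vert_id M E z Y\<close> is \<open>\<nu>(Y)\<close> for a vertical tangent vector \<open>Y\<close> at \<open>z\<close>.\<close>

definition vert_id ::
  "('x, 'a::real_normed_vector) manifold \<Rightarrow> ('x, 'e, 'b::real_normed_vector) vbundle \<Rightarrow>
   ('w::real_normed_vector, 'e) assoc_point \<Rightarrow> (('w, 'e) assoc_point, 'a \<times> 'w) tangent \<Rightarrow>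
   (('w \<Rightarrow> 'e) \<times> ('w \<times> 'w)) set" where
  "vert_id M E z Y =
     (THE C. \<exists>f \<gamma> \<gamma>'. f \<in> frames M E \<and> assoc_class actW f (\<gamma> 0) = z \<and>
        (\<gamma> has_vector_derivative \<gamma>') (at 0) \<and>
        has_velocity (assoc_bundle M E) (\<lambda>t. assoc_class actW f (\<gamma> t)) 0 Y \<and>
        C = assoc_class actTW f (\<gamma> 0, \<gamma>'))"

definition id_times_vpr_W ::
  "(('w::real_vector \<Rightarrow> 'e) \<times> ('w \<times> 'w)) set \<Rightarrow> ('w, 'e) assoc_point" where
  "id_times_vpr_W C = (case representative C of (f, Y) \<Rightarrow> assoc_class actW f (vpr_W Y))"

definition darboux_lie ::
  "('x, 'a::real_normed_vector) manifold \<Rightarrow> ('x, 'e, 'b::real_normed_vector) vbundle \<Rightarrow>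
   ('x, 'a, 'e, 'w::real_normed_vector) frame_hlift \<Rightarrow> ('x \<Rightarrow> ('x, 'a) tangent) \<Rightarrow>
   ('x \<Rightarrow> ('w, 'e) assoc_point) \<Rightarrow> 'x \<Rightarrow> ('w, 'e) assoc_point" where
  "darboux_lie M E \<Gamma> X s x =
     id_times_vpr_W (vert_id M E (s x)
       (tangent_map M (assoc_bundle M E) s x (X x) - assoc_lift M E \<Gamma> X (s x)))"

end

(*
  A trivialization of E and a linear isomorphism iota from W to the typical fibre give a chart of E
  and a chart of L(W,E) x_GL(W) W which correspond under ev up to the linear map id x iota^-1.
  Hence ev relates tangent maps of h and of s = ev^-1 o h, and it remains to see that ev relates X^H_W
  and X^nabla. Integral curves of X^nabla through f(w), for w in a basis of W, exist on a common
  interval; linearity of the connection extends them to all w, uniqueness makes the result linear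
  and injective in w, so it is a curve of frames, and it must be the flow of X^H through f.
  Thus t |-> [Phi^t f, w] is mapped by ev to the integral curve of X^nabla through f(w).
  Both vertical projections are then read off in one chart from curves t |-> f(w + t w').
*)
theory Submission
  imports Defs
begin

section \<open>Finite-dimensional normed spaces\<close>

text \<open>Flows, velocities and vertical projections are given by \<open>THE\<close>, orbit
  representatives by \<open>SOME\<close>. So every evaluation has a uniqueness half, and every value
  read from a representative has to be invariant under GL(W). Model spaces are merely
  finite-dimensional normed types. Continuity of linear maps, Lipschitz bounds and local solvability
  of differential equations are therefore built up from one estimate of coordinates by the norm. The
  frame flow defining X^H_W is governed by \<open>induced_connection\<close>, which refers it to the
  flows in E of the single vectors f(w). Hence differential equations are solved in E. Local
  existence there gives an interval that depends on w, whereas a frame flow needs one interval for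
  all w; this is what linearity of the connection must provide. Tangent vectors of the associated
  bundle are never differentiated on their own: they are compared with those of E through a linear
  change of coordinates, so that verticality and both projections are decided in E.\<close>

lemma coordinates_bounded:
  fixes B :: "'v::real_normed_vector set"
  assumes "finite B" "independent B"
  shows "\<exists>K\<ge>0. \<forall>c. \<forall>b\<in>B. \<bar>c b\<bar> \<le> K * norm (\<Sum>b\<in>B. c b *\<^sub>R b)"
  using assms
proof (induction B rule: finite_induct)
  case empty
  show ?case by (auto intro: exI[of _ 0])
next
  case (insert a B)
  then have indB: "independent B" and a: "a \<notin> span B"
    by (auto simp: independent_insert)
  obtain K where K: "K \<ge> 0" "\<And>c b. b \<in> B \<Longrightarrow> \<bar>c b\<bar> \<le> K * norm (\<Sum>b\<in>B. c b *\<^sub>R b)"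
    using insert.IH[OF indB] by blast
  \<comment> \<open>The distance from \<open>a\<close> to \<open>span B\<close> is positive.
    Otherwise some vectors of \<open>span B\<close> approach \<open>- a\<close>; by the induction
    hypothesis their coefficients are Cauchy, and the limits put \<open>a\<close> into
    \<open>span B\<close>.\<close>
  have "\<exists>d>0. \<forall>c. norm (a + (\<Sum>b\<in>B. c b *\<^sub>R b)) \<ge> d"
  proof (rule ccontr)
    assume "\<not> ?thesis"
    then have "\<exists>c. norm (a + (\<Sum>b\<in>B. c b *\<^sub>R b)) < inverse (real (Suc n))" for n
      by (meson inverse_positive_iff_positive not_le of_nat_0_less_iff zero_less_Suc)
    then obtain c where c: "\<And>n. norm (a + (\<Sum>b\<in>B. c n b *\<^sub>R b)) < inverse (real (Suc n))"
      by metis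
    have lim: "(\<lambda>n. a + (\<Sum>b\<in>B. c n b *\<^sub>R b)) \<longlonglongrightarrow> 0"
    proof (rule tendsto_norm_zero_cancel, rule tendsto_sandwich[OF _ _ tendsto_const LIMSEQ_inverse_real_of_nat])
      show "\<forall>\<^sub>F n in sequentially. norm (a + (\<Sum>b\<in>B. c n b *\<^sub>R b)) \<le> inverse (real (Suc n))"
        using less_imp_le[OF c] by (intro always_eventually allI)
    qed auto
    have "convergent (\<lambda>n. c n b)" if b: "b \<in> B" for b
    proof (rule Cauchy_convergent, rule metric_CauchyI)
      fix e :: real assume e: "e > 0"
      have "Cauchy (\<lambda>n. a + (\<Sum>b\<in>B. c n b *\<^sub>R b))"
        using lim by (rule LIMSEQ_imp_Cauchy)
      then obtain N where N: "\<And>m n. m \<ge> N \<Longrightarrow> n \<ge> N \<Longrightarrow>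
          dist (a + (\<Sum>b\<in>B. c m b *\<^sub>R b)) (a + (\<Sum>b\<in>B. c n b *\<^sub>R b)) < e / (K + 1)"
        using e K(1) unfolding Cauchy_def by (meson add_nonneg_pos divide_pos_pos zero_less_one)
      show "\<exists>N. \<forall>m\<ge>N. \<forall>n\<ge>N. dist (c m b) (c n b) < e"
      proof (intro exI allI impI)
        fix m n assume mn: "m \<ge> N" "n \<ge> N"
        have "(\<Sum>b\<in>B. (c m b - c n b) *\<^sub>R b) = (a + (\<Sum>b\<in>B. c m b *\<^sub>R b)) - (a + (\<Sum>b\<in>B. c n b *\<^sub>R b))"
          by (simp add: scaleR_diff_left sum_subtractf)
        then have "norm (\<Sum>b\<in>B. (c m b - c n b) *\<^sub>R b) < e / (K + 1)"
          using N[OF mn] by (simp add: dist_norm)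
        moreover have "\<bar>c m b - c n b\<bar> \<le> K * norm (\<Sum>b\<in>B. (c m b - c n b) *\<^sub>R b)"
          using K(2)[OF b, of "\<lambda>b. c m b - c n b"] .
        ultimately have "\<bar>c m b - c n b\<bar> \<le> K * (e / (K + 1))"
          using K(1) by (meson less_imp_le mult_left_mono order_trans)
        also have "\<dots> < e"
          using e K(1) by (simp add: field_simps)
        finally show "dist (c m b) (c n b) < e" by (simp add: dist_real_def)
      qed
    qed
    then have "(\<lambda>n. c n b) \<longlonglongrightarrow> lim (\<lambda>n. c n b)" if "b \<in> B" for b
      using that by (simp add: convergent_LIMSEQ_iff)
    then have "(\<lambda>n. a + (\<Sum>b\<in>B. c n b *\<^sub>R b)) \<longlonglongrightarrow> a + (\<Sum>b\<in>B. lim (\<lambda>n. c n b) *\<^sub>R b)"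
      by (intro tendsto_intros) auto
    with lim have "a + (\<Sum>b\<in>B. lim (\<lambda>n. c n b) *\<^sub>R b) = 0"
      using LIMSEQ_unique by blast
    then have "a = - (\<Sum>b\<in>B. lim (\<lambda>n. c n b) *\<^sub>R b)"
      by (simp add: add_eq_0_iff2)
    also have "\<dots> \<in> span B"
      by (intro span_neg span_sum span_scale span_base)
    finally show False using a by simp
  qed
  then obtain d where d: "d > 0" "\<And>c. norm (a + (\<Sum>b\<in>B. c b *\<^sub>R b)) \<ge> d" by blast
  have da: "\<bar>t\<bar> \<le> norm (t *\<^sub>R a + (\<Sum>b\<in>B. c b *\<^sub>R b)) / d" for t c
  proof (cases "t = 0")
    case False
    have "t *\<^sub>R a + (\<Sum>b\<in>B. c b *\<^sub>R b) = t *\<^sub>R (a + (\<Sum>b\<in>B. (c b / t) *\<^sub>R b))"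
      using False by (simp add: scaleR_add_right scaleR_sum_right)
    then have "norm (t *\<^sub>R a + (\<Sum>b\<in>B. c b *\<^sub>R b)) \<ge> \<bar>t\<bar> * d"
      using d(2)[of "\<lambda>b. c b / t"] by (simp add: mult_left_mono)
    then show ?thesis using d(1) by (simp add: pos_le_divide_eq)
  qed (use d(1) in simp)
  \<comment> \<open>\<open>1 / d\<close> serves the coefficient of \<open>a\<close>. The other term
    serves the coefficients on \<open>B\<close>, after \<open>c a *\<^sub>R a\<close> has been moved
    to the other side by the triangle inequality.\<close>
  define K' where "K' = max (1 / d) (K * (1 + norm a / d))"
  show ?case
  proof (intro exI[of _ K'] conjI allI ballI)
    show "K' \<ge> 0" using d(1) by (simp add: K'_def le_max_iff_disj)
    fix c b assume b: "b \<in> insert a B"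
    define s where "s = c a *\<^sub>R a + (\<Sum>b\<in>B. c b *\<^sub>R b)"
    have s: "(\<Sum>b\<in>insert a B. c b *\<^sub>R b) = s"
      using insert.hyps by (simp add: s_def)
    have ca: "\<bar>c a\<bar> \<le> norm s / d"
      using da[of "c a" c] by (simp add: s_def)
    show "\<bar>c b\<bar> \<le> K' * norm (\<Sum>b\<in>insert a B. c b *\<^sub>R b)"
    proof (cases "b = a")
      case True
      have "(1 / d) * norm s \<le> K' * norm s"
        unfolding K'_def by (intro mult_right_mono) auto
      then show ?thesis using ca True s by simp
    next
      case False
      then have bB: "b \<in> B" using b by simp
      have "norm (\<Sum>b\<in>B. c b *\<^sub>R b) = norm (s - c a *\<^sub>R a)" by (simp add: s_def)
      also have "\<dots> \<le> norm s + \<bar>c a\<bar> * norm a"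
        by (metis norm_scaleR norm_triangle_ineq4)
      also have "\<dots> \<le> norm s + norm s / d * norm a"
        using ca by (intro add_left_mono mult_right_mono) auto
      finally have "norm (\<Sum>b\<in>B. c b *\<^sub>R b) \<le> norm s * (1 + norm a / d)"
        by (simp add: algebra_simps)
      then have "\<bar>c b\<bar> \<le> K * (norm s * (1 + norm a / d))"
        using K(1) K(2)[OF bB, of c] by (meson mult_left_mono order_trans)
      also have "\<dots> = (K * (1 + norm a / d)) * norm s" by simp
      also have "\<dots> \<le> K' * norm s"
        unfolding K'_def by (intro mult_right_mono) auto
      finally show ?thesis using s by simp
    qed
  qed
qed

lemma finite_dimension_linear_bounded:
  fixes T :: "'v::real_normed_vector \<Rightarrow> 'u::real_normed_vector"
  assumes "has_dimension (UNIV :: 'v set) n" "linear T"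
  shows "bounded_linear T"
proof -
  obtain B :: "'v set" where B: "finite B" "independent B" "span B = UNIV"
    using assms(1) by (auto simp: has_dimension_def)
  obtain K where K: "K \<ge> 0" "\<And>c b. b \<in> B \<Longrightarrow> \<bar>c b\<bar> \<le> K * norm (\<Sum>b\<in>B. c b *\<^sub>R b)"
    using coordinates_bounded[OF B(1,2)] by blast
  have "norm (T x) \<le> norm x * (\<Sum>b\<in>B. K * norm (T b))" for x
  proof -
    define c where "c = representation B x"
    have x: "x = (\<Sum>b\<in>B. c b *\<^sub>R b)"
      unfolding c_def using B by (intro sum_representation_eq[symmetric]) auto
    have "T x = (\<Sum>b\<in>B. c b *\<^sub>R T b)"
      using assms(2) by (subst x) (simp add: linear_sum linear_scale)
    then have "norm (T x) \<le> (\<Sum>b\<in>B. \<bar>c b\<bar> * norm (T b))"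
      using norm_sum[of "\<lambda>b. c b *\<^sub>R T b" B] by simp
    also have "\<dots> \<le> (\<Sum>b\<in>B. (K * norm x) * norm (T b))"
      using K(2)[of _ c] x by (intro sum_mono mult_right_mono) auto
    also have "\<dots> = norm x * (\<Sum>b\<in>B. K * norm (T b))"
      by (simp add: sum_distrib_left mult_ac)
    finally show ?thesis .
  qed
  then show ?thesis
    using assms(2) by (auto simp: bounded_linear_def bounded_linear_axioms_def)
qed

section \<open>Linear isomorphisms and dimension\<close>

lemma linear_inv_bij:
  fixes T :: "'v::real_vector \<Rightarrow> 'u::real_vector"
  assumes "linear T" "bij T"
  shows "linear (inv T)"
proof -
  obtain g where g: "linear g" "g \<circ> T = id"
    using linear_injective_left_inverse[OF assms(1) bij_is_inj[OF assms(2)]] by blast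
  have "inv T = g"
    using g(2) assms(2) by (metis bij_is_surj inv_unique_comp surj_iff comp_assoc comp_id id_comp)
  then show ?thesis using g(1) by simp
qed

text \<open>Backward uniqueness of integral curves will yield injectivity only; counting supplies
  the rest. A vector outside the span of the image of a basis would give n + 1 independent vectors
  in a space spanned by n.\<close>

lemma dimension_eq_linear_inj_imp_bij:
  fixes T :: "'v::real_vector \<Rightarrow> 'u::real_vector"
  assumes "has_dimension (UNIV :: 'v set) n" "has_dimension (UNIV :: 'u set) n" "linear T" "inj T"
  shows "bij T"
proof -
  obtain B :: "'v set" where B: "finite B" "independent B" "span B = UNIV" "card B = n"
    using assms(1) by (auto simp: has_dimension_def)
  obtain C :: "'u set" where C: "finite C" "independent C" "span C = UNIV" "card C = n"
    using assms(2) by (auto simp: has_dimension_def)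
  have ind: "independent (T ` B)"
    by (rule linear_independent_injective_image[OF assms(3) B(2)]) (use assms in \<open>auto intro: inj_on_subset\<close>)
  have card: "card (T ` B) = n"
    using B(4) assms by (simp add: card_image inj_on_subset)
  have sp: "u \<in> span (T ` B)" for u
  proof (rule ccontr)
    assume u: "u \<notin> span (T ` B)"
    then have "independent (insert u (T ` B))"
      using ind by (simp add: independent_insert)
    then have "card (insert u (T ` B)) \<le> card C"
      using independent_span_bound[of C "insert u (T ` B)"] C by simp
    moreover have "u \<notin> T ` B" using u span_base[of u "T ` B"] by blast
    ultimately show False using card B(1) C(4) by simp
  qed
  have "surj T"
    using linear_span_image[OF assms(3), of B] B(3) sp by auto
  then show ?thesis using assms(4) by (simp add: bij_def)
qed

lemma dimension_eq_linear_bij_exists: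
  assumes "has_dimension (UNIV :: 'v::real_vector set) n" "has_dimension (UNIV :: 'u::real_vector set) n"
  shows "\<exists>T :: 'v \<Rightarrow> 'u. linear T \<and> bij T"
proof -
  obtain B :: "'v set" where B: "finite B" "independent B" "span B = UNIV" "card B = n"
    using assms(1) by (auto simp: has_dimension_def)
  obtain C :: "'u set" where C: "finite C" "independent C" "span C = UNIV" "card C = n"
    using assms(2) by (auto simp: has_dimension_def)
  obtain g where g: "bij_betw g B C"
    using finite_same_card_bij[OF B(1) C(1)] B(4) C(4) by auto
  obtain T :: "'v \<Rightarrow> 'u" where T: "linear T" "\<And>b. b \<in> B \<Longrightarrow> T b = g b"
    using linear_independent_extend[OF B(2)] by blast
  have "T ` B = C" using g T(2) by (auto simp: bij_betw_def)
  have injB: "inj_on T B" using g T(2) by (auto simp: bij_betw_def inj_on_def)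
  have "independent (T ` B)" using C(2) by (simp add: \<open>T ` B = C\<close>)
  then have "inj_on T (span B)"
    using linear_inj_on_span_independent_image[OF T(1) _ injB] by blast
  then have "bij T"
    using linear_span_image[OF T(1), of B] B(3) C(3) \<open>T ` B = C\<close> by (simp add: bij_def)
  then show ?thesis using T(1) by blast
qed

text \<open>The dual of a finite-dimensional normed space has class \<open>banach\<close>; this carries results
  about Banach spaces over to finite-dimensional types that are not instances of that class.\<close>

lemma has_dimension_dual:
  assumes "has_dimension (UNIV :: 'v::real_normed_vector set) n"
  shows "has_dimension (UNIV :: ('v \<Rightarrow>\<^sub>L real) set) n"
proof -
  obtain B :: "'v set" where B: "finite B" "independent B" "span B = UNIV" "card B = n"
    using assms by (auto simp: has_dimension_def)
  \<comment> \<open>Dual basis: prescribe the values on \<open>B\<close> and extend linearly;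
    continuity comes from finite dimension.\<close>
  have "\<exists>l :: 'v \<Rightarrow>\<^sub>L real. \<forall>b\<in>B. blinfun_apply l b = (if b = a then 1 else 0)" for a
  proof -
    obtain g :: "'v \<Rightarrow> real" where "linear g" "\<And>b. b \<in> B \<Longrightarrow> g b = (if b = a then 1 else 0)"
      using linear_independent_extend[OF B(2), of "\<lambda>b. if b = a then 1 else (0::real)"] by blast
    moreover from this have "bounded_linear g"
      using finite_dimension_linear_bounded[OF assms] by blast
    ultimately show ?thesis
      by (intro exI[of _ "Blinfun g"]) (simp add: bounded_linear_Blinfun_apply)
  qed
  then obtain l :: "'v \<Rightarrow> 'v \<Rightarrow>\<^sub>L real"
    where l: "\<And>a b. b \<in> B \<Longrightarrow> blinfun_apply (l a) b = (if b = a then 1 else 0)" by metis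
  have sum_l: "blinfun_apply (\<Sum>a\<in>B. c a *\<^sub>R l a) b = c b" if "b \<in> B" for b c
    using that B(1) by (simp add: blinfun.sum_left blinfun.scaleR_left l if_distrib cong: if_cong)
  have inj: "inj_on l B"
  proof
    fix a b assume "a \<in> B" "b \<in> B" "l a = l b"
    then show "a = b" using l[of a a] l[of a b] by (auto split: if_splits)
  qed
  have "independent (l ` B)"
  proof (rule independent_if_scalars_zero)
    fix d u assume "(\<Sum>x\<in>l ` B. d x *\<^sub>R x) = 0" and u: "u \<in> l ` B"
    then have "(\<Sum>a\<in>B. d (l a) *\<^sub>R l a) = 0" using inj by (simp add: sum.reindex)
    then show "d u = 0" using u sum_l[of _ "\<lambda>a. d (l a)"] by force
  qed (use B(1) in simp)
  moreover have "k \<in> span (l ` B)" for k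
  proof -
    have "k = (\<Sum>a\<in>B. k a *\<^sub>R l a)"
    proof (rule blinfun_eqI)
      fix x
      show "blinfun_apply k x = blinfun_apply (\<Sum>a\<in>B. k a *\<^sub>R l a) x"
      proof (rule linear_eq_on_span[of _ _ B])
        show "linear (blinfun_apply k)" "linear (blinfun_apply (\<Sum>a\<in>B. k a *\<^sub>R l a))"
          by (intro bounded_linear.linear blinfun.bounded_linear_right)+
        show "blinfun_apply k b = blinfun_apply (\<Sum>a\<in>B. k a *\<^sub>R l a) b" if "b \<in> B" for b
          using sum_l[OF that] by simp
      qed (simp add: B(3))
    qed
    moreover have "(\<Sum>a\<in>B. k a *\<^sub>R l a) \<in> span (l ` B)"
      by (intro span_sum span_scale span_base imageI)
    ultimately show ?thesis by metis
  qed
  moreover have "card (l ` B) = n" using B(4) inj by (simp add: card_image)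
  ultimately show ?thesis using B(1) unfolding has_dimension_def by (metis UNIV_eq_I finite_imageI)
qed

section \<open>Ordinary differential equations\<close>

text \<open>Mean value inequality anchored at a zero of \<open>g\<close>. The absolute value admits
  times on either side of \<open>t0\<close>, so estimates for differential equations run forward and
  backward at once.\<close>

lemma norm_le_of_vector_derivative_bound:
  fixes g :: "real \<Rightarrow> 'v::real_normed_vector"
  assumes "\<And>t. t \<in> J \<Longrightarrow> (g has_vector_derivative g' t) (at t within J)"
    and "\<And>t. t \<in> J \<Longrightarrow> norm (g' t) \<le> C"
    and "convex J" "t0 \<in> J" "g t0 = 0" "t \<in> J"
  shows "norm (g t) \<le> C * \<bar>t - t0\<bar>"
proof -
  have "onorm (\<lambda>s. s *\<^sub>R g' t) \<le> C" if "t \<in> J" for t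
    using assms(2)[OF that] by (intro onorm_le) (simp add: mult.commute[of C] mult_left_mono)
  then have "norm (g t - g t0) \<le> C * norm (t - t0)"
    using assms by (intro differentiable_bound[OF \<open>convex J\<close>, where f' = "\<lambda>t s. s *\<^sub>R g' t"])
      (auto simp: has_vector_derivative_def)
  then show ?thesis using assms(5) by simp
qed

text \<open>Banach's fixed point theorem for the Picard map, on the bounded continuous functions
  from R into the closed ball; completeness of that space comes from the class
  \<open>banach\<close>.\<close>

lemma picard_lindelof:
  fixes f :: "'v::banach \<Rightarrow> 'v"
  assumes r: "r > 0" and K: "K \<ge> 0"
    and lip: "\<And>y z. y \<in> cball y0 r \<Longrightarrow> z \<in> cball y0 r \<Longrightarrow> norm (f y - f z) \<le> K * norm (y - z)"
  shows "\<exists>e>0. \<exists>y. y 0 = y0 \<and>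
    (\<forall>t\<in>{-e<..<e}. y t \<in> cball y0 r \<and> (y has_vector_derivative f (y t)) (at t))"
proof -
  define C where "C = norm (f y0) + K * r"
  have C: "C \<ge> 0" using r K by (simp add: C_def)
  have fC: "norm (f y) \<le> C" if "y \<in> cball y0 r" for y
  proof -
    have "norm (f y) \<le> norm (f y0) + norm (f y - f y0)" by (metis norm_triangle_sub)
    also have "norm (f y - f y0) \<le> K * norm (y - y0)"
      using that r by (intro lip) auto
    also have "\<dots> \<le> K * r"
      using that K by (intro mult_left_mono) (auto simp: dist_norm norm_minus_commute)
    finally show ?thesis by (simp add: C_def)
  qed
  have contf: "continuous_on (cball y0 r) f"
    by (rule lipschitz_on_continuous_on[of K])
      (auto simp: lipschitz_on_def dist_norm K lip simp del: mem_cball)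
  \<comment> \<open>The first bound keeps curves of speed at most \<open>C\<close> inside the ball,
    the second makes the Picard map contract by 1/2. The summands 1 keep the denominators positive
    when \<open>C\<close> or \<open>K\<close> is 0.\<close>
  define e where "e = min (r / (C + 1)) (1 / (2 * (K + 1)))"
  have e: "e > 0" using r C K by (simp add: e_def)
  have eC: "C * e \<le> r"
  proof -
    have "C * e \<le> C * (r / (C + 1))" using C by (intro mult_left_mono) (auto simp: e_def)
    also have "\<dots> \<le> r" using C r by (simp add: field_simps)
    finally show ?thesis .
  qed
  have eK: "K * e \<le> 1/2"
  proof -
    have "K * e \<le> K * (1 / (2 * (K + 1)))" using K by (intro mult_left_mono) (auto simp: e_def)
    also have "\<dots> \<le> 1/2" using K by (simp add: field_simps)
    finally show ?thesis .
  qed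
  define P where "P = PiC (UNIV :: real set) (\<lambda>_. cball y0 r)"
  have P: "apply_bcontfun y t \<in> cball y0 r" if "y \<in> P" for y t
    using that by (auto simp: P_def mem_PiC_iff Pi_def)
  \<comment> \<open>The integrals start at \<open>-e\<close> so that the fundamental theorem of
    calculus covers negative times as well; subtracting the value at 0 restores the initial
    condition.\<close>
  define \<Phi> where "\<Phi> y t = y0 + (integral {-e..t} (f \<circ> y) - integral {-e..0} (f \<circ> y))" for y t
  have \<Phi>0: "\<Phi> y 0 = y0" for y by (simp add: \<Phi>_def)
  have \<Phi>': "(\<Phi> (apply_bcontfun y) has_vector_derivative f (y t)) (at t within {-e..e})"
    if "y \<in> P" "t \<in> {-e..e}" for y t
  proof -
    have "continuous_on {-e..e} (f \<circ> apply_bcontfun y)"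
      using P[OF that(1)]
      by (intro continuous_on_compose continuous_on_subset[OF contf]) auto
    then have "((\<lambda>t. integral {-e..t} (f \<circ> apply_bcontfun y)) has_vector_derivative (f \<circ> apply_bcontfun y) t)
        (at t within {-e..e})"
      using that(2) by (rule integral_has_vector_derivative)
    then show ?thesis
      unfolding \<Phi>_def by (auto intro!: derivative_eq_intros)
  qed
  have ball: "\<Phi> (apply_bcontfun y) t \<in> cball y0 r" if "y \<in> P" "t \<in> {-e..e}" for y t
  proof -
    have "norm (\<Phi> (apply_bcontfun y) t - y0) \<le> C * \<bar>t - 0\<bar>"
    proof (rule norm_le_of_vector_derivative_bound[where J = "{-e..e}"])
      show "((\<lambda>t. \<Phi> (apply_bcontfun y) t - y0) has_vector_derivative f (y t)) (at t within {-e..e})"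
        if "t \<in> {-e..e}" for t
        using \<Phi>'[OF \<open>y \<in> P\<close> that] by (auto intro!: derivative_eq_intros)
    qed (use fC P[OF that(1)] e that \<Phi>0 in auto)
    also have "\<dots> \<le> C * e" using C that(2) by (intro mult_left_mono) auto
    finally show ?thesis using eC by (simp add: dist_norm norm_minus_commute)
  qed
  \<comment> \<open>Clamping the time to [-e,e] turns an iterate into a bounded continuous function
    on all of R.\<close>
  define cl where "cl t = max (-e) (min e t)" for t :: real
  have cl: "cl t \<in> {-e..e}" for t using e by (auto simp: cl_def)
  define G where "G y = Bcontfun (\<lambda>t. \<Phi> (apply_bcontfun y) (cl t))" for y
  have G: "apply_bcontfun (G y) t = \<Phi> (apply_bcontfun y) (cl t)" if "y \<in> P" for y t
  proof -
    have "continuous_on {-e..e} (\<Phi> (apply_bcontfun y))"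
      unfolding continuous_on_eq_continuous_within
      using \<Phi>'[OF that] unfolding has_vector_derivative_def by (blast intro: has_derivative_continuous)
    then have "continuous_on UNIV (\<lambda>t. \<Phi> (apply_bcontfun y) (cl t))"
      by (rule continuous_on_compose2) (auto intro!: continuous_intros simp: cl_def e less_imp_le)
    moreover have "norm (\<Phi> (apply_bcontfun y) (cl t)) \<le> norm y0 + r" for t
      using ball[OF that cl, of t] by (metis dist_commute dist_norm mem_cball norm_triangle_sub add_left_mono order_trans)
    ultimately show ?thesis
      unfolding G_def by (subst Bcontfun_inverse) (auto intro: bcontfun_normI)
  qed
  have "\<exists>!y\<in>P. G y = y"
  proof (rule Banach_fix[of P "1/2"])
    show "complete P"
      unfolding P_def by (simp add: complete_eq_closed closed_PiC)
    show "P \<noteq> {}"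
    proof -
      have "const_bcontfun y0 \<in> P" using r by (simp add: P_def mem_PiC_iff)
      then show ?thesis by blast
    qed
    show "G ` P \<subseteq> P"
      using ball cl G by (auto simp: P_def mem_PiC_iff Pi_def simp del: mem_cball)
    fix y z assume yz: "y \<in> P" "z \<in> P"
    show "dist (G y) (G z) \<le> 1/2 * dist y z"
    proof (rule dist_bound)
      fix t
      have "norm (\<Phi> (apply_bcontfun y) (cl t) - \<Phi> (apply_bcontfun z) (cl t)) \<le> (K * dist y z) * \<bar>cl t - 0\<bar>"
      proof (rule norm_le_of_vector_derivative_bound[where J = "{-e..e}"])
        show "((\<lambda>t. \<Phi> (apply_bcontfun y) t - \<Phi> (apply_bcontfun z) t) has_vector_derivative (f (y t) - f (z t)))
            (at t within {-e..e})" if "t \<in> {-e..e}" for t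
          using \<Phi>'[OF yz(1) that] \<Phi>'[OF yz(2) that] by (auto intro!: derivative_eq_intros)
        show "norm (f (y t) - f (z t)) \<le> K * dist y z" for t
        proof -
          have "norm (f (y t) - f (z t)) \<le> K * dist (y t) (z t)"
            using lip[OF P[OF yz(1)] P[OF yz(2)]] by (simp add: dist_norm)
          also have "\<dots> \<le> K * dist y z"
            using K by (intro mult_left_mono dist_bounded)
          finally show ?thesis .
        qed
      qed (use cl e in \<open>auto simp: \<Phi>0\<close>)
      also have "\<dots> \<le> (K * dist y z) * e"
        using K cl[of t] by (intro mult_left_mono) auto
      also have "\<dots> \<le> 1/2 * dist y z"
        using mult_right_mono[OF eK, of "dist y z"] by (simp add: mult_ac)
      finally show "dist (apply_bcontfun (G y) t) (apply_bcontfun (G z) t) \<le> 1/2 * dist y z"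
        using yz by (simp add: G dist_norm)
    qed
  qed auto
  then obtain y where y: "y \<in> P" "G y = y" by blast
  \<comment> \<open>On [-e,e] the clamp is the identity, so there the fixed point satisfies the
    integral equation.\<close>
  have yt: "apply_bcontfun y t = \<Phi> (apply_bcontfun y) t" if "t \<in> {-e..e}" for t
    using G[OF y(1), of t] y(2) that by (simp add: cl_def)
  show ?thesis
  proof (intro exI[of _ e] conjI exI[of _ "\<Phi> (apply_bcontfun y)"] ballI)
    fix t assume t: "t \<in> {-e<..<e}"
    show "\<Phi> (apply_bcontfun y) t \<in> cball y0 r" using ball[OF y(1)] t by simp
    have "(\<Phi> (apply_bcontfun y) has_vector_derivative f (y t)) (at t within {-e..e})"
      using \<Phi>'[OF y(1)] t by simp
    moreover have "at t within {-e..e} = at t" using t by (auto intro: at_within_Icc_at)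
    moreover have "y t = \<Phi> (apply_bcontfun y) t" using t by (intro yt) auto
    ultimately show "(\<Phi> (apply_bcontfun y) has_vector_derivative f (\<Phi> (apply_bcontfun y) t)) (at t)"
      by metis
  next
    show "0 < e" by (rule e)
    show "\<Phi> (apply_bcontfun y) 0 = y0" by (rule \<Phi>0)
  qed
qed

text \<open>\<open>Ck_on\<close> gives continuity of the derivative in each fixed direction.
  Finitely many basis directions then bound its operator norm near \<open>y0\<close>, and the mean
  value inequality applies on a ball, which is convex.\<close>

lemma Ck_on_imp_locally_lipschitz:
  fixes f :: "'v::real_normed_vector \<Rightarrow> 'u::real_normed_vector"
  assumes dim: "has_dimension (UNIV :: 'v set) n"
    and "open S" "Ck_on (Suc 0) S f" "y0 \<in> S"
  shows "\<exists>r>0. \<exists>K\<ge>0. cball y0 r \<subseteq> S \<and>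
    (\<forall>y\<in>cball y0 r. \<forall>z\<in>cball y0 r. norm (f y - f z) \<le> K * norm (y - z))"
proof -
  obtain B :: "'v set" where B: "finite B" "independent B" "span B = UNIV"
    using dim by (auto simp: has_dimension_def)
  obtain L where L: "L \<ge> 0" "\<And>c b. b \<in> B \<Longrightarrow> \<bar>c b\<bar> \<le> L * norm (\<Sum>b\<in>B. c b *\<^sub>R b)"
    using coordinates_bounded[OF B(1,2)] by blast
  let ?D = "\<lambda>x. frechet_derivative f (at x)"
  have der: "(f has_derivative ?D x) (at x)" if "x \<in> S" for x
    using assms(3) that by (simp add: frechet_derivative_works)
  have "\<forall>\<^sub>F x in nhds y0. norm (?D x b) < norm (?D y0 b) + 1" for b
  proof -
    have "continuous (at y0) (\<lambda>x. ?D x b)"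
      using assms by (auto simp: continuous_on_eq_continuous_at)
    then have "((\<lambda>x. norm (?D x b)) \<longlongrightarrow> norm (?D y0 b)) (nhds y0)"

      using tendsto_at_iff_tendsto_nhds[of "\<lambda>x. ?D x b" y0] by (intro tendsto_norm) (simp add: isCont_def)
    then show ?thesis by (rule order_tendstoD(2)) simp
  qed
  then have "\<forall>\<^sub>F x in nhds y0. \<forall>b\<in>B. norm (?D x b) < norm (?D y0 b) + 1"
    using B(1) by (simp add: eventually_ball_finite)
  moreover have "\<forall>\<^sub>F x in nhds y0. x \<in> S"
    using assms by (simp add: eventually_nhds_in_open)
  ultimately have "\<forall>\<^sub>F x in nhds y0. x \<in> S \<and> (\<forall>b\<in>B. norm (?D x b) < norm (?D y0 b) + 1)"
    by eventually_elim simp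
  then obtain d where d: "d > 0"
    "\<And>x. dist x y0 < d \<Longrightarrow> x \<in> S \<and> (\<forall>b\<in>B. norm (?D x b) < norm (?D y0 b) + 1)"
    unfolding eventually_nhds_metric by blast
  \<comment> \<open>\<open>L\<close> bounds coordinates by the norm, and the second factor bounds
    the derivative in direction \<open>b\<close> near \<open>y0\<close>; together they bound the
    operator norm.\<close>
  define K where "K = (\<Sum>b\<in>B. L * (norm (?D y0 b) + 1))"
  have K: "K \<ge> 0" using L(1) by (auto simp: K_def intro!: sum_nonneg mult_nonneg_nonneg)
  have sub: "cball y0 (d/2) \<subseteq> S"
    using d by (auto simp: dist_commute)
  show ?thesis
  proof (rule exI[of _ "d/2"], intro conjI exI[of _ K] ballI)
    fix y z assume yz: "y \<in> cball y0 (d/2)" "z \<in> cball y0 (d/2)"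
    show "norm (f y - f z) \<le> K * norm (y - z)"
    proof (rule differentiable_bound[OF convex_cball _ _ yz, where f' = ?D])
      fix x assume x: "x \<in> cball y0 (d/2)"
      then show "(f has_derivative ?D x) (at x within cball y0 (d/2))"
        using der sub by (blast intro: has_derivative_at_withinI)
      have lin: "linear (?D x)"
        using der x sub by (blast intro: has_derivative_linear)
      show "onorm (?D x) \<le> K"
      proof (rule onorm_bound[OF K])
        fix v
        define c where "c = representation B v"
        have v: "v = (\<Sum>b\<in>B. c b *\<^sub>R b)"
          unfolding c_def using B by (intro sum_representation_eq[symmetric]) auto
        have "?D x v = (\<Sum>b\<in>B. c b *\<^sub>R ?D x b)"
          by (subst v) (simp add: linear_sum[OF lin] linear_scale[OF lin])
        then have "norm (?D x v) \<le> (\<Sum>b\<in>B. \<bar>c b\<bar> * norm (?D x b))"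
          using norm_sum[of "\<lambda>b. c b *\<^sub>R ?D x b" B] by simp
        also have "\<dots> \<le> (\<Sum>b\<in>B. (L * norm v) * (norm (?D y0 b) + 1))"
        proof (intro sum_mono mult_mono)
          fix b assume b: "b \<in> B"
          show "\<bar>c b\<bar> \<le> L * norm v" using L(2)[OF b, of c] v by simp
          show "norm (?D x b) \<le> norm (?D y0 b) + 1"
            using d(2)[of x] d(1) x b by (simp add: dist_commute less_imp_le)
        qed (use L(1) in auto)
        also have "\<dots> = K * norm v"
          by (simp add: K_def sum_distrib_left sum_distrib_right mult_ac)
        finally show "norm (?D x v) \<le> K * norm v" .
      qed
    qed
  qed (use d K sub in auto)
qed

text \<open>\<open>picard_lindelof\<close> wants a type of class \<open>banach\<close>. The equation
  is conjugated by a linear isomorphism with the dual space, solved there and carried back.\<close>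

lemma ode_local_existence:
  fixes f :: "'v::real_normed_vector \<Rightarrow> 'v"
  assumes dim: "has_dimension (UNIV :: 'v set) n"
    and "open S" "Ck_on (Suc 0) S f" "y0 \<in> S"
  shows "\<exists>e>0. \<exists>y. y 0 = y0 \<and>
    (\<forall>t\<in>{-e<..<e}. y t \<in> S \<and> (y has_vector_derivative f (y t)) (at t))"
proof -
  obtain r K where r: "r > 0" and K: "K \<ge> 0" and sub: "cball y0 r \<subseteq> S"
    and lip: "\<And>y z. y \<in> cball y0 r \<Longrightarrow> z \<in> cball y0 r \<Longrightarrow> norm (f y - f z) \<le> K * norm (y - z)"
    using Ck_on_imp_locally_lipschitz[OF assms] by blast
  obtain T :: "'v \<Rightarrow> 'v \<Rightarrow>\<^sub>L real" where T: "linear T" "bij T"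
    using dimension_eq_linear_bij_exists[OF dim has_dimension_dual[OF dim]] by blast
  have bT: "bounded_linear T" and bT': "bounded_linear (inv T)"
    using T dim linear_inv_bij has_dimension_dual finite_dimension_linear_bounded by blast+
  obtain A where A: "A > 0" "\<And>x. norm (T x) \<le> norm x * A"
    using bounded_linear.pos_bounded[OF bT] by blast
  obtain A' where A': "A' > 0" "\<And>x. norm (inv T x) \<le> norm x * A'"
    using bounded_linear.pos_bounded[OF bT'] by blast
  have inv: "inv T (T x) = x" "T (inv T z) = z" for x z
    using T(2) by (auto simp: bij_is_inj bij_is_surj surj_f_inv_f)
  have inv_diff: "inv T x - inv T z = inv T (x - z)" for x z
    by (simp add: linear_diff[OF linear_inv_bij[OF T]])
  \<comment> \<open>\<open>A'\<close> bounds \<open>inv T\<close>, whence the radius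
    \<open>r / A'\<close>: \<open>inv T\<close> maps this ball into the one on which
    \<open>f\<close> is Lipschitz.\<close>
  have inball: "inv T z \<in> cball y0 r" if "z \<in> cball (T y0) (r / A')" for z
  proof -
    have "norm (inv T z - y0) \<le> norm (z - T y0) * A'"
      using A'(2)[of "z - T y0"] by (metis inv(1) inv_diff)
    also have "\<dots> \<le> (r / A') * A'"
      using that A' by (intro mult_right_mono) (auto simp: dist_norm norm_minus_commute)
    finally show ?thesis using A' by (simp add: dist_norm norm_minus_commute)
  qed
  have "\<exists>e>0. \<exists>y. y 0 = T y0 \<and>
    (\<forall>t\<in>{-e<..<e}. y t \<in> cball (T y0) (r / A') \<and> (y has_vector_derivative (T \<circ> f \<circ> inv T) (y t)) (at t))"
  proof (rule picard_lindelof)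
    show "r / A' > 0" "A * (K * A') \<ge> 0" using r A A' K by auto
    fix y z assume yz: "y \<in> cball (T y0) (r / A')" "z \<in> cball (T y0) (r / A')"
    have "norm ((T \<circ> f \<circ> inv T) y - (T \<circ> f \<circ> inv T) z) = norm (T (f (inv T y) - f (inv T z)))"
      by (simp add: linear_diff[OF T(1)])
    also have "\<dots> \<le> norm (f (inv T y) - f (inv T z)) * A" by (rule A(2))
    also have "\<dots> \<le> (K * norm (inv T y - inv T z)) * A"
      using A lip[OF inball[OF yz(1)] inball[OF yz(2)]] by (intro mult_right_mono) auto
    also have "\<dots> \<le> (K * (norm (y - z) * A')) * A"
      unfolding inv_diff using A A'(2) K by (intro mult_right_mono mult_left_mono) auto
    finally show "norm ((T \<circ> f \<circ> inv T) y - (T \<circ> f \<circ> inv T) z) \<le> A * (K * A') * norm (y - z)"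
      by (simp add: mult_ac)
  qed
  then obtain e y where e: "e > 0" and y0: "y 0 = T y0"
    and y: "\<And>t. t \<in> {-e<..<e} \<Longrightarrow> y t \<in> cball (T y0) (r / A') \<and>
      (y has_vector_derivative T (f (inv T (y t)))) (at t)" by auto
  show ?thesis
  proof (intro exI[of _ e] conjI exI[of _ "inv T \<circ> y"] ballI)
    fix t assume t: "t \<in> {-e<..<e}"
    then show "(inv T \<circ> y) t \<in> S" using y inball sub by auto
    show "((inv T \<circ> y) has_vector_derivative f ((inv T \<circ> y) t)) (at t)"
      using bounded_linear.has_vector_derivative[OF bT', of y "T (f (inv T (y t)))" "at t"] y[OF t]
      by (simp add: inv comp_def)
  qed (use e y0 inv in auto)
qed

text \<open>On an interval of half-width \<open>e\<close> with K e \<le> 1/2 the distance of the two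
  solutions attains a maximum. The mean value estimate bounds this maximum by half of itself, so it
  is 0.\<close>

lemma ode_local_uniqueness:
  fixes f :: "'v::real_normed_vector \<Rightarrow> 'v"
  assumes dim: "has_dimension (UNIV :: 'v set) n"
    and "open S" "Ck_on (Suc 0) S f" "y t0 \<in> S"
    and y: "\<forall>\<^sub>F t in nhds t0. (y has_vector_derivative f (y t)) (at t)"
    and z: "\<forall>\<^sub>F t in nhds t0. (z has_vector_derivative f (z t)) (at t)"
    and eq: "y t0 = z t0"
  shows "\<forall>\<^sub>F t in nhds t0. y t = z t"
proof -
  obtain r K where r: "r > 0" and K: "K \<ge> 0" and sub: "cball (y t0) r \<subseteq> S"
    and lip: "\<And>u v. u \<in> cball (y t0) r \<Longrightarrow> v \<in> cball (y t0) r \<Longrightarrow> norm (f u - f v) \<le> K * norm (u - v)"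
    using Ck_on_imp_locally_lipschitz[OF dim assms(2-4)] by (metis (no_types, lifting))
  have near: "\<forall>\<^sub>F t in nhds t0. w t \<in> cball (y t0) r"
    if "\<forall>\<^sub>F t in nhds t0. (w has_vector_derivative f (w t)) (at t)" "w t0 = y t0" for w
  proof -
    have "isCont w t0"
      using eventually_nhds_x_imp_x[OF that(1)] by (rule has_vector_derivative_continuous)
    then have "(w \<longlongrightarrow> y t0) (nhds t0)"
      using that(2) tendsto_at_iff_tendsto_nhds[of w t0] by (simp add: isCont_def)
    from tendstoD[OF this r] show ?thesis
      by eventually_elim (simp add: dist_commute)
  qed
  have "\<forall>\<^sub>F t in nhds t0. (y has_vector_derivative f (y t)) (at t) \<and>
      (z has_vector_derivative f (z t)) (at t) \<and> y t \<in> cball (y t0) r \<and> z t \<in> cball (y t0) r"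
    using y z near[OF y refl] near[OF z eq[symmetric]] by eventually_elim simp
  then obtain d where d: "d > 0" and D: "\<And>t. dist t t0 < d \<Longrightarrow>
      (y has_vector_derivative f (y t)) (at t) \<and>
      (z has_vector_derivative f (z t)) (at t) \<and> y t \<in> cball (y t0) r \<and> z t \<in> cball (y t0) r"
    unfolding eventually_nhds_metric by blast
  define e where "e = min (d / 2) (1 / (2 * (K + 1)))"
  have e: "e > 0" "e < d" using d K by (auto simp: e_def min_less_iff_disj)
  have eK: "K * e \<le> 1/2"
  proof -
    have "K * e \<le> K * (1 / (2 * (K + 1)))" using K by (intro mult_left_mono) (auto simp: e_def)
    also have "\<dots> \<le> 1/2" using K by (simp add: field_simps)
    finally show ?thesis .
  qed
  define J where "J = {t0 - e..t0 + e}"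
  have J: "dist t t0 < d" if "t \<in> J" for t
    using that e by (auto simp: J_def dist_real_def)
  have "continuous_on J (\<lambda>t. norm (y t - z t))"
    using D J by (intro continuous_intros)
      (auto intro!: continuous_at_imp_continuous_on has_vector_derivative_continuous)
  then obtain t1 where t1: "t1 \<in> J" "\<And>t. t \<in> J \<Longrightarrow> norm (y t - z t) \<le> norm (y t1 - z t1)"
    using continuous_attains_sup[of J "\<lambda>t. norm (y t - z t)"] e by (auto simp: J_def)
  have "norm (y t1 - z t1) \<le> (K * norm (y t1 - z t1)) * \<bar>t1 - t0\<bar>"
  proof (rule norm_le_of_vector_derivative_bound[where J = J])
    show "((\<lambda>t. y t - z t) has_vector_derivative f (y t) - f (z t)) (at t within J)" if "t \<in> J" for t
      using D[OF J[OF that]]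
      by (intro has_vector_derivative_diff) (auto intro: has_vector_derivative_at_within)
    show "norm (f (y t) - f (z t)) \<le> K * norm (y t1 - z t1)" if "t \<in> J" for t
      using lip[of "y t" "z t"] D[OF J[OF that]] t1(2)[OF that] K
      by (meson mult_left_mono order_trans)
  qed (use t1 e eq in \<open>auto simp: J_def\<close>)
  also have "\<dots> \<le> (K * norm (y t1 - z t1)) * e"
    using t1(1) K by (intro mult_left_mono) (auto simp: J_def)
  also have "\<dots> \<le> 1/2 * norm (y t1 - z t1)"
    using mult_right_mono[OF eK, of "norm (y t1 - z t1)"] by (simp add: mult_ac)
  finally have "norm (y t1 - z t1) = 0" using norm_ge_zero[of "y t1 - z t1"] by linarith
  then have "y t = z t" if "dist t t0 < e" for t
    using t1(2)[of t] that by (simp add: J_def dist_real_def abs_less_iff)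
  then show ?thesis using e unfolding eventually_nhds_metric by blast
qed

section \<open>Velocities and integral curves\<close>

text \<open>The topological axioms of a manifold play no role for tangent vectors; leaving them out makes
  the lemmas applicable to the associated bundle without having to establish them there.\<close>

definition differentiable_atlas :: "('p, 'a::real_normed_vector) manifold \<Rightarrow> bool" where
  "differentiable_atlas N \<longleftrightarrow>
     (\<Union>c\<in>atlas N. fst c) = points N \<and>
     (\<forall>c\<in>atlas N. inj_on (snd c) (fst c)) \<and>
     (\<forall>c\<in>atlas N. \<forall>d\<in>atlas N.
        open (snd c ` (fst c \<inter> fst d)) \<and>
        (\<forall>y\<in>snd c ` (fst c \<inter> fst d). (snd d \<circ> chart_inv c) differentiable (at y)))"

section \<open>Curves, tangent vectors and change of chart\<close>

lemma has_vector_derivative_transform_nhds: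
  assumes "(f has_vector_derivative f') (at t)" "\<forall>\<^sub>F s in nhds t. f s = g s"
  shows "(g has_vector_derivative f') (at t)"
proof -
  have "(f has_vector_derivative f') (at t) = (g has_vector_derivative f') (at t)"
    using assms(2) eventually_nhds_x_imp_x[OF assms(2)] by (intro has_vector_derivative_cong_ev) simp_all
  with assms(1) show ?thesis by blast
qed

lemma smooth_on_differentiable:
  assumes "smooth_on S F" "x \<in> S"
  shows "F differentiable (at x)"
  using assms(1)[unfolded smooth_on_def, rule_format, of "Suc 0"] assms(2) by simp

lemma smooth_manifold_differentiable_atlas:
  "smooth_manifold N \<Longrightarrow> differentiable_atlas N"
  unfolding smooth_manifold_def differentiable_atlas_def
  using smooth_on_differentiable by blast

lemma chart_inv_apply:
  assumes "inj_on (snd c) (fst c)" "p \<in> fst c"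
  shows "chart_inv c (snd c p) = p"
  using assms by (simp add: chart_inv_def)

lemma has_velocityD:
  assumes "has_velocity N \<gamma> t v"
  shows "\<gamma> t \<in> points N" "v \<in> tangent_space N (\<gamma> t)"
    and "\<And>c. c \<in> atlas N \<Longrightarrow> \<gamma> t \<in> fst c \<Longrightarrow> \<forall>\<^sub>F s in nhds t. \<gamma> s \<in> fst c"
    and "\<And>c. c \<in> atlas N \<Longrightarrow> \<gamma> t \<in> fst c \<Longrightarrow> ((snd c \<circ> \<gamma>) has_vector_derivative v c) (at t)"
  using assms by (auto simp: has_velocity_def)

lemma tangent_space_transition:
  assumes "v \<in> tangent_space N p" "c \<in> atlas N" "d \<in> atlas N" "p \<in> fst c" "p \<in> fst d"
  shows "v d = frechet_derivative (snd d \<circ> chart_inv c) (at (snd c p)) (v c)"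
  using assms unfolding tangent_space_def by blast

lemma tangent_space_outside:
  assumes "v \<in> tangent_space N p" "\<not> (c \<in> atlas N \<and> p \<in> fst c)"
  shows "v c = 0"
  using assms unfolding tangent_space_def by blast

context
  fixes N :: "('p, 'a::real_normed_vector) manifold"
  assumes N: "differentiable_atlas N"
begin

lemma chart_inj: "c \<in> atlas N \<Longrightarrow> inj_on (snd c) (fst c)"
  using N by (simp add: differentiable_atlas_def)

lemma chart_at: "p \<in> points N \<Longrightarrow> \<exists>c\<in>atlas N. p \<in> fst c"
  using N by (auto simp: differentiable_atlas_def)

lemma chart_domain_subset: "c \<in> atlas N \<Longrightarrow> p \<in> fst c \<Longrightarrow> p \<in> points N"
  using N by (auto simp: differentiable_atlas_def)

lemma open_chart_overlap: "c \<in> atlas N \<Longrightarrow> d \<in> atlas N \<Longrightarrow> open (snd c ` (fst c \<inter> fst d))"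
  using N by (simp add: differentiable_atlas_def)

lemma open_chart_image: "c \<in> atlas N \<Longrightarrow> open (snd c ` fst c)"
  using open_chart_overlap[of c c] by simp

lemma transition_has_derivative:
  assumes "c \<in> atlas N" "d \<in> atlas N" "p \<in> fst c" "p \<in> fst d"
  shows "((snd d \<circ> chart_inv c) has_derivative
    frechet_derivative (snd d \<circ> chart_inv c) (at (snd c p))) (at (snd c p))"
  using N assms by (auto simp: differentiable_atlas_def frechet_derivative_works[symmetric])

text \<open>Overlaps of charts have open images, so a curve continuous in the chart \<open>c\<close>
  stays in any other chart at its base point for nearby times; the chain rule gives the derivative
  there.\<close>

lemma curve_change_chart:
  assumes c: "c \<in> atlas N" and d: "d \<in> atlas N" "\<gamma> t \<in> fst d"
    and ev: "\<forall>\<^sub>F s in nhds t. \<gamma> s \<in> fst c"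
    and der: "((snd c \<circ> \<gamma>) has_vector_derivative w) (at t)"
  shows "\<forall>\<^sub>F s in nhds t. \<gamma> s \<in> fst d"
    and "((snd d \<circ> \<gamma>) has_vector_derivative
      frechet_derivative (snd d \<circ> chart_inv c) (at (snd c (\<gamma> t))) w) (at t)"
proof -
  have tc: "\<gamma> t \<in> fst c" using ev by (rule eventually_nhds_x_imp_x)
  have "isCont (snd c \<circ> \<gamma>) t" using der by (rule has_vector_derivative_continuous)
  then have "((snd c \<circ> \<gamma>) \<longlongrightarrow> (snd c \<circ> \<gamma>) t) (nhds t)"
    using tendsto_at_iff_tendsto_nhds[of "snd c \<circ> \<gamma>" t] unfolding isCont_def by blast
  then have "\<forall>\<^sub>F s in nhds t. (snd c \<circ> \<gamma>) s \<in> snd c ` (fst c \<inter> fst d)"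
    by (rule topological_tendstoD) (use open_chart_overlap[OF c d(1)] tc d(2) in auto)
  with ev show evd: "\<forall>\<^sub>F s in nhds t. \<gamma> s \<in> fst d"
  proof eventually_elim
    case (elim s)
    then show ?case using chart_inj[OF c] by (auto simp: inj_on_def)
  qed
  let ?D = "frechet_derivative (snd d \<circ> chart_inv c) (at (snd c (\<gamma> t)))"
  have D: "((snd d \<circ> chart_inv c) has_derivative ?D) (at ((snd c \<circ> \<gamma>) t))"
    using transition_has_derivative[OF c d(1) tc d(2)] by simp
  have "((snd d \<circ> chart_inv c) \<circ> (snd c \<circ> \<gamma>) has_derivative ?D \<circ> (\<lambda>h. h *\<^sub>R w)) (at t)"
    using der D unfolding has_vector_derivative_def by (rule diff_chain_at)
  moreover have "?D \<circ> (\<lambda>h. h *\<^sub>R w) = (\<lambda>h. h *\<^sub>R ?D w)"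
    using linear_scale[OF has_derivative_linear[OF D]] by auto
  ultimately have "(((snd d \<circ> chart_inv c) \<circ> (snd c \<circ> \<gamma>)) has_vector_derivative ?D w) (at t)"
    by (simp add: has_vector_derivative_def)
  moreover have "\<forall>\<^sub>F s in nhds t. ((snd d \<circ> chart_inv c) \<circ> (snd c \<circ> \<gamma>)) s = (snd d \<circ> \<gamma>) s"
    using ev by eventually_elim (simp add: chart_inv_apply chart_inj c)
  ultimately show "((snd d \<circ> \<gamma>) has_vector_derivative ?D w) (at t)"
    by (rule has_vector_derivative_transform_nhds)
qed

text \<open>One chart decides, because the components of a tangent vector and the derivatives of a
  curve change by the same transition derivative.\<close>

lemma has_velocity_chartI:
  assumes c: "c \<in> atlas N"
    and ev: "\<forall>\<^sub>F s in nhds t. \<gamma> s \<in> fst c"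
    and der: "((snd c \<circ> \<gamma>) has_vector_derivative v c) (at t)"
    and v: "v \<in> tangent_space N (\<gamma> t)"
  shows "has_velocity N \<gamma> t v"
proof -
  have tc: "\<gamma> t \<in> fst c" using ev by (rule eventually_nhds_x_imp_x)
  show ?thesis
    unfolding has_velocity_def
  proof (intro conjI ballI impI)
    fix d assume d: "d \<in> atlas N" "\<gamma> t \<in> fst d"
    show "\<forall>\<^sub>F s in nhds t. \<gamma> s \<in> fst d"
      by (rule curve_change_chart(1)[OF c d ev der])
    show "((snd d \<circ> \<gamma>) has_vector_derivative v d) (at t)"
      using curve_change_chart(2)[OF c d ev der] tangent_space_transition[OF v c d(1) tc d(2)] by simp
  qed (use v chart_domain_subset[OF c tc] in auto)
qed

lemma has_velocity_exists:
  assumes c: "c \<in> atlas N"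
    and ev: "\<forall>\<^sub>F s in nhds t. \<gamma> s \<in> fst c"
    and der: "((snd c \<circ> \<gamma>) has_vector_derivative w) (at t)"
  shows "\<exists>v. has_velocity N \<gamma> t v \<and> v c = w"
proof -
  \<comment> \<open>The default 0 is the convention by which \<open>tangent_space\<close> makes a
    tangent vector unique as a function on all charts.\<close>
  define v where "v d = (if d \<in> atlas N \<and> \<gamma> t \<in> fst d then vector_derivative (snd d \<circ> \<gamma>) (at t) else 0)" for d
  have tc: "\<gamma> t \<in> fst c" using ev by (rule eventually_nhds_x_imp_x)
  have vd: "\<forall>\<^sub>F s in nhds t. \<gamma> s \<in> fst d" "((snd d \<circ> \<gamma>) has_vector_derivative v d) (at t)"
    if "d \<in> atlas N" "\<gamma> t \<in> fst d" for d
    using curve_change_chart[OF c that ev der] that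
    by (auto simp: v_def vector_derivative_at)
  have "v \<in> tangent_space N (\<gamma> t)"
    unfolding tangent_space_def
  proof (intro CollectI conjI allI impI ballI)
    fix d d' assume d: "d \<in> atlas N" "d' \<in> atlas N" "\<gamma> t \<in> fst d \<and> \<gamma> t \<in> fst d'"
    have *: "\<gamma> t \<in> fst d" "\<gamma> t \<in> fst d'" using d(3) by auto
    show "v d' = frechet_derivative (snd d' \<circ> chart_inv d) (at (snd d (\<gamma> t))) (v d)"
      by (rule vector_derivative_unique_at[OF vd(2)[OF d(2) *(2)]
            curve_change_chart(2)[OF d(1,2) *(2) vd[OF d(1) *(1)]]])
  qed (auto simp: v_def)
  moreover have "v c = w" by (rule vector_derivative_unique_at[OF vd(2)[OF c tc] der])
  ultimately show ?thesis using has_velocity_chartI[OF c ev, of v] vd(2)[OF c tc] by blast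
qed

lemma tangent_space_diff:
  assumes "v \<in> tangent_space N p" "v' \<in> tangent_space N p"
  shows "v - v' \<in> tangent_space N p"
  unfolding tangent_space_def
proof (intro CollectI conjI allI impI ballI)
  fix c d assume cd: "c \<in> atlas N" "d \<in> atlas N" "p \<in> fst c \<and> p \<in> fst d"
  then have p: "p \<in> fst c" "p \<in> fst d" by auto
  show "(v - v') d = frechet_derivative (snd d \<circ> chart_inv c) (at (snd c p)) ((v - v') c)"
    using linear_diff[OF has_derivative_linear[OF transition_has_derivative[OF cd(1,2) p]]]
      tangent_space_transition[OF assms(1) cd(1,2) p] tangent_space_transition[OF assms(2) cd(1,2) p]
    by simp
next
  fix c assume "\<not> (c \<in> atlas N \<and> p \<in> fst c)"
  then show "(v - v') c = 0"
    using tangent_space_outside[OF assms(1)] tangent_space_outside[OF assms(2)] by simp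
qed

lemma has_velocity_unique:
  assumes "has_velocity N \<gamma> t v" "has_velocity N \<gamma> t v'"
  shows "v = v'"
proof
  fix c
  show "v c = v' c"
  proof (cases "c \<in> atlas N \<and> \<gamma> t \<in> fst c")
    case True
    then have "((snd c \<circ> \<gamma>) has_vector_derivative v c) (at t)" "((snd c \<circ> \<gamma>) has_vector_derivative v' c) (at t)"
      using assms by (auto simp: has_velocity_def)
    then show ?thesis by (rule vector_derivative_unique_at)
  next
    case False
    have "v \<in> tangent_space N (\<gamma> t)" "v' \<in> tangent_space N (\<gamma> t)"
      using assms by (auto simp: has_velocity_def)
    then show ?thesis using False by (metis tangent_space_outside)
  qed
qed

lemma velocity_eqI: "has_velocity N \<gamma> t v \<Longrightarrow> velocity N \<gamma> t = v"
  unfolding velocity_def by (rule the_equality) (auto intro: has_velocity_unique)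

end

section \<open>Locality and time shift of velocities\<close>

lemma has_velocity_cong_ev:
  assumes "has_velocity N \<gamma> t v" and ev: "\<forall>\<^sub>F s in nhds t. \<gamma> s = \<gamma>' s"
  shows "has_velocity N \<gamma>' t v"
proof -
  have eq: "\<gamma> t = \<gamma>' t" using ev by (rule eventually_nhds_x_imp_x)
  have "\<forall>\<^sub>F s in nhds t. \<gamma>' s \<in> S" if "\<forall>\<^sub>F s in nhds t. \<gamma> s \<in> S" for S
    using that ev by eventually_elim simp
  moreover have "((f \<circ> \<gamma>') has_vector_derivative w) (at t)"
    if "((f \<circ> \<gamma>) has_vector_derivative w) (at t)" for f w
  proof -
    have "\<forall>\<^sub>F s in nhds t. (f \<circ> \<gamma>) s = (f \<circ> \<gamma>') s"
      using ev by eventually_elim simp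
    with that show ?thesis by (rule has_vector_derivative_transform_nhds)
  qed
  ultimately show ?thesis using has_velocityD[OF assms(1)] unfolding has_velocity_def eq by blast
qed

lemma eventually_nhds_shift:
  fixes t :: real
  assumes "\<forall>\<^sub>F s in nhds t. P s" "t = t0 + r"
  shows "\<forall>\<^sub>F s in nhds t0. P (s + r)"
proof -
  have "filterlim (\<lambda>s. s + r) (nhds t) (nhds t0)"
    unfolding assms(2) by (intro tendsto_intros filterlim_ident)
  then show ?thesis using assms(1) by (rule eventually_compose_filterlim[rotated])
qed

lemma has_velocity_shift:
  assumes "has_velocity N \<gamma> t v" "t = t0 + r"
  shows "has_velocity N (\<lambda>s. \<gamma> (s + r)) t0 v"
  unfolding has_velocity_def
proof (intro conjI ballI impI)
  fix c assume c: "c \<in> atlas N" "\<gamma> (t0 + r) \<in> fst c"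
  then have *: "\<forall>\<^sub>F s in nhds t. \<gamma> s \<in> fst c" "((snd c \<circ> \<gamma>) has_vector_derivative v c) (at t)"
    using assms by (auto simp: has_velocity_def)
  show "\<forall>\<^sub>F s in nhds t0. \<gamma> (s + r) \<in> fst c"
    using eventually_nhds_shift[OF *(1) assms(2)] .
  have "((\<lambda>s. s + r) has_vector_derivative 1) (at t0)"
    by (auto intro!: derivative_eq_intros)
  then have "((snd c \<circ> \<gamma>) \<circ> (\<lambda>s. s + r) has_vector_derivative 1 *\<^sub>R v c) (at t0)"
    using *(2) assms(2) by (intro vector_diff_chain_at) auto
  then show "((snd c \<circ> (\<lambda>s. \<gamma> (s + r))) has_vector_derivative v c) (at t0)"
    by (simp add: comp_def)
qed (use assms in \<open>auto simp: has_velocity_def\<close>)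

section \<open>Integral curves and local flows on a manifold\<close>

lemma integral_curve_subset:
  "integral_curve N X \<gamma> J \<Longrightarrow> J' \<subseteq> J \<Longrightarrow> integral_curve N X \<gamma> J'"
  by (auto simp: integral_curve_def)

lemma integral_curve_exists:
  fixes N :: "('p, 'a::real_normed_vector) manifold"
  assumes N: "smooth_manifold N" and X: "vector_field N X" and p: "p \<in> points N"
  shows "\<exists>e>0. \<exists>\<gamma>. \<gamma> 0 = p \<and> integral_curve N X \<gamma> {-e<..<e}"
proof -
  note A = smooth_manifold_differentiable_atlas[OF N]
  obtain n where dim: "has_dimension (UNIV :: 'a set) n"
    using N by (auto simp: smooth_manifold_def)
  obtain c where c: "c \<in> atlas N" "p \<in> fst c" using chart_at[OF A p] by blast
  define f where "f y = X (chart_inv c y) c" for y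
  have "Ck_on (Suc 0) (snd c ` fst c) f"
    using X c unfolding vector_field_def smooth_on_def f_def by blast
  then obtain e y where e: "e > 0" and y0: "y 0 = snd c p"
    and y: "\<And>t. t \<in> {-e<..<e} \<Longrightarrow> y t \<in> snd c ` fst c \<and> (y has_vector_derivative f (y t)) (at t)"
    using ode_local_existence[OF dim open_chart_image[OF A c(1)]] c by (metis imageI)
  define \<gamma> where "\<gamma> t = chart_inv c (y t)" for t
  have \<gamma>: "\<gamma> t \<in> fst c" "snd c (\<gamma> t) = y t" if "t \<in> {-e<..<e}" for t
    using y[OF that] by (auto simp: \<gamma>_def chart_inv_apply chart_inj[OF A c(1)])
  have "has_velocity N \<gamma> t (X (\<gamma> t))" if t: "t \<in> {-e<..<e}" for t
  proof (rule has_velocity_chartI[OF A c(1)])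
    have ev: "\<forall>\<^sub>F s in nhds t. s \<in> {-e<..<e}"
      using t by (intro eventually_nhds_in_open) auto
    then show "\<forall>\<^sub>F s in nhds t. \<gamma> s \<in> fst c"
      by eventually_elim (rule \<gamma>)
    have "\<forall>\<^sub>F s in nhds t. y s = (snd c \<circ> \<gamma>) s"
      using ev by eventually_elim (simp add: \<gamma>)
    moreover have "(y has_vector_derivative X (\<gamma> t) c) (at t)"
      using y[OF t] by (simp add: f_def \<gamma>_def)
    ultimately show "((snd c \<circ> \<gamma>) has_vector_derivative X (\<gamma> t) c) (at t)"
      by (rule has_vector_derivative_transform_nhds[rotated])
    show "X (\<gamma> t) \<in> tangent_space N (\<gamma> t)"
      using X \<gamma>(1)[OF t] chart_domain_subset[OF A c(1)] by (simp add: vector_field_def)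
  qed
  moreover have "\<gamma> 0 = p" by (simp add: \<gamma>_def y0 chart_inv_apply chart_inj[OF A c(1)] c)
  ultimately have "\<gamma> 0 = p \<and> integral_curve N X \<gamma> {-e<..<e}" by (simp add: integral_curve_def)
  with e show ?thesis by blast
qed

text \<open>Continuity at \<open>t\<close> for the topology \<open>mtop\<close>; it lets disjoint
  open sets keep two curves apart.\<close>

lemma has_velocity_eventually_in_open:
  assumes N: "smooth_manifold N" and "has_velocity N \<gamma> t v" "openin (mtop N) U" "\<gamma> t \<in> U"
  shows "\<forall>\<^sub>F s in nhds t. \<gamma> s \<in> U"
proof -
  note A = smooth_manifold_differentiable_atlas[OF N]
  obtain c where c: "c \<in> atlas N" "\<gamma> t \<in> fst c"
    using chart_at[OF A has_velocityD(1)[OF assms(2)]] by blast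
  have ev: "\<forall>\<^sub>F s in nhds t. \<gamma> s \<in> fst c" and der: "((snd c \<circ> \<gamma>) has_vector_derivative v c) (at t)"
    using assms(2) c by (auto simp: has_velocity_def)
  have "open (snd c ` (U \<inter> fst c))" using assms(3) c by (simp add: openin_mtop[OF N])
  moreover have "((snd c \<circ> \<gamma>) \<longlongrightarrow> (snd c \<circ> \<gamma>) t) (nhds t)"
    using has_vector_derivative_continuous[OF der] tendsto_at_iff_tendsto_nhds[of "snd c \<circ> \<gamma>" t]
    unfolding isCont_def by blast
  ultimately have "\<forall>\<^sub>F s in nhds t. (snd c \<circ> \<gamma>) s \<in> snd c ` (U \<inter> fst c)"
    using topological_tendstoD assms(4) c by fastforce
  with ev show ?thesis
  proof eventually_elim
    case (elim s)
    then show ?case using chart_inj[OF A c(1)] by (auto simp: inj_on_def)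
  qed
qed

lemma open_if_eventually_nhds:
  assumes "\<And>x. x \<in> S \<Longrightarrow> \<forall>\<^sub>F y in nhds x. y \<in> S"
  shows "open S"
proof (subst open_subopen, intro ballI)
  fix x assume "x \<in> S"
  from assms[OF this] obtain T where "open T" "x \<in> T" "\<forall>y\<in>T. y \<in> S"
    unfolding eventually_nhds by blast
  then show "\<exists>T. open T \<and> x \<in> T \<and> T \<subseteq> S" by blast
qed

text \<open>Connectedness of the interval. The times of agreement form an open set by local
  uniqueness in a chart, and the times of disagreement form an open set because the manifold is
  Hausdorff.\<close>

lemma integral_curve_unique:
  fixes N :: "('p, 'a::real_normed_vector) manifold"
  assumes N: "smooth_manifold N" and X: "vector_field N X"
    and \<gamma>: "integral_curve N X \<gamma>1 {a<..<b}" "integral_curve N X \<gamma>2 {a<..<b}"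
    and t0: "t0 \<in> {a<..<b}" "\<gamma>1 t0 = \<gamma>2 t0"
    and t: "t \<in> {a<..<b}"
  shows "\<gamma>1 t = \<gamma>2 t"
proof -
  note A = smooth_manifold_differentiable_atlas[OF N]
  obtain n where dim: "has_dimension (UNIV :: 'a set) n"
    using N by (auto simp: smooth_manifold_def)
  have v: "has_velocity N \<gamma>1 s (X (\<gamma>1 s))" "has_velocity N \<gamma>2 s (X (\<gamma>2 s))" if "s \<in> {a<..<b}" for s
    using \<gamma> that by (auto simp: integral_curve_def)
  have evJ: "\<forall>\<^sub>F r in nhds s. r \<in> {a<..<b}" if "s \<in> {a<..<b}" for s
    using that by (intro eventually_nhds_in_open) auto
  have agree: "\<forall>\<^sub>F r in nhds s. r \<in> {a<..<b} \<and> \<gamma>1 r = \<gamma>2 r" if s: "s \<in> {a<..<b}" "\<gamma>1 s = \<gamma>2 s" for s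
  proof -
    obtain c where c: "c \<in> atlas N" "\<gamma>1 s \<in> fst c"
      using chart_at[OF A has_velocityD(1)[OF v(1)[OF s(1)]]] by blast
    define f where "f y = X (chart_inv c y) c" for y
    have f: "Ck_on (Suc 0) (snd c ` fst c) f"
      using X c unfolding vector_field_def smooth_on_def f_def by blast
    have ev: "\<forall>\<^sub>F r in nhds s. \<gamma>1 r \<in> fst c" "\<forall>\<^sub>F r in nhds s. \<gamma>2 r \<in> fst c"
      using v[OF s(1)] c s(2) by (auto simp: has_velocity_def)
    have sol: "\<forall>\<^sub>F r in nhds s. ((snd c \<circ> \<gamma>) has_vector_derivative f ((snd c \<circ> \<gamma>) r)) (at r)"
      if "\<forall>\<^sub>F r in nhds s. \<gamma> r \<in> fst c" "integral_curve N X \<gamma> {a<..<b}" for \<gamma>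
      using that(1) evJ[OF s(1)]
    proof eventually_elim
      case (elim r)
      then show ?case
        using that(2) c(1) by (simp add: f_def chart_inv_apply chart_inj[OF A] integral_curve_def has_velocity_def)
    qed
    have "\<forall>\<^sub>F r in nhds s. (snd c \<circ> \<gamma>1) r = (snd c \<circ> \<gamma>2) r"
    proof (rule ode_local_uniqueness[OF dim open_chart_image[OF A c(1)] f])
      show "\<forall>\<^sub>F r in nhds s. ((snd c \<circ> \<gamma>1) has_vector_derivative f ((snd c \<circ> \<gamma>1) r)) (at r)"
        by (rule sol[OF ev(1) \<gamma>(1)])
      show "\<forall>\<^sub>F r in nhds s. ((snd c \<circ> \<gamma>2) has_vector_derivative f ((snd c \<circ> \<gamma>2) r)) (at r)"
        by (rule sol[OF ev(2) \<gamma>(2)])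
    qed (use c s(2) in auto)
    with ev evJ[OF s(1)] show ?thesis
    proof eventually_elim
      case (elim r)
      then show ?case using chart_inj[OF A c(1)] by (auto simp: inj_on_def)
    qed
  qed
  have disagree: "\<forall>\<^sub>F r in nhds s. r \<in> {a<..<b} \<and> \<gamma>1 r \<noteq> \<gamma>2 r" if s: "s \<in> {a<..<b}" "\<gamma>1 s \<noteq> \<gamma>2 s" for s
  proof -
    \<comment> \<open>Separation is formulated for points of \<open>topspace (mtop N)\<close>, so
      the values of the curves have to be placed there.\<close>
    have "openin (mtop N) (points N)"
      unfolding openin_mtop[OF N]
    proof (intro conjI ballI)
      fix c assume c: "c \<in> atlas N"
      then have "points N \<inter> fst c = fst c" using chart_domain_subset[OF A c] by blast
      then show "open (snd c ` (points N \<inter> fst c))" using open_chart_image[OF A c] by simp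
    qed simp
    then have "points N \<subseteq> topspace (mtop N)" by (rule openin_subset)
    then have "\<gamma>1 s \<in> topspace (mtop N)" "\<gamma>2 s \<in> topspace (mtop N)"
      using v[OF s(1)] by (auto simp: has_velocity_def)
    moreover have "Hausdorff_space (mtop N)" using N by (simp add: smooth_manifold_def)
    ultimately obtain U V where UV: "openin (mtop N) U" "openin (mtop N) V" "\<gamma>1 s \<in> U" "\<gamma>2 s \<in> V" "disjnt U V"
      using s(2) unfolding Hausdorff_space_def by meson
    have "\<forall>\<^sub>F r in nhds s. \<gamma>1 r \<in> U" "\<forall>\<^sub>F r in nhds s. \<gamma>2 r \<in> V"
      using has_velocity_eventually_in_open[OF N] v[OF s(1)] UV by blast+
    with evJ[OF s(1)] show ?thesis
      by eventually_elim (use UV(5) in \<open>auto simp: disjnt_def\<close>)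
  qed
  let ?S = "{s \<in> {a<..<b}. \<gamma>1 s = \<gamma>2 s}" and ?T = "{s \<in> {a<..<b}. \<gamma>1 s \<noteq> \<gamma>2 s}"
  have "open ?S"
    by (rule open_if_eventually_nhds) (use agree in simp)
  moreover have "open ?T"
    by (rule open_if_eventually_nhds) (use disagree in simp)
  ultimately have "?S \<inter> {a<..<b} = {} \<or> ?T \<inter> {a<..<b} = {}"
    by (intro connectedD[of "{a<..<b}"]) auto
  then show ?thesis using t0 t by auto
qed

text \<open>The two intervals of definition may differ, but both contain 0 and \<open>t\<close>,
  hence so does their intersection.\<close>

lemma flows_to_unique:
  assumes N: "smooth_manifold N" and X: "vector_field N X"
    and q: "flows_to N X t p q" "flows_to N X t p q'"
  shows "q = q'"
proof -
  obtain \<gamma> a b where 1: "0 \<in> {a<..<b}" "t \<in> {a<..<b}" "integral_curve N X \<gamma> {a<..<b}" "\<gamma> 0 = p" "\<gamma> t = q"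
    using q(1) by (auto simp: flows_to_def)
  obtain \<gamma>' a' b' where 2: "0 \<in> {a'<..<b'}" "t \<in> {a'<..<b'}" "integral_curve N X \<gamma>' {a'<..<b'}" "\<gamma>' 0 = p" "\<gamma>' t = q'"
    using q(2) by (auto simp: flows_to_def)
  have "\<gamma> t = \<gamma>' t"
    by (rule integral_curve_unique[OF N X, of \<gamma> "max a a'" "min b b'" \<gamma>' 0])
      (use 1 2 in \<open>auto intro: integral_curve_subset\<close>)
  then show ?thesis using 1 2 by simp
qed

section \<open>Manifolds with linearly related charts\<close>

text \<open>Here \<open>e\<close> stands for \<open>ev\<close>, with \<open>A\<close> the associated
  bundle and \<open>N\<close> the total space of E. The model spaces differ, so charts agree only up
  to \<open>T\<close>, which runs from the model of \<open>N\<close> to the model of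
  \<open>A\<close>.\<close>

definition related_charts ::
  "('p \<Rightarrow> 'q) \<Rightarrow> ('p, 'c::real_normed_vector) manifold \<Rightarrow> ('q, 'd::real_normed_vector) manifold \<Rightarrow>
   ('p, 'c) chart \<Rightarrow> ('q, 'd) chart \<Rightarrow> ('d \<Rightarrow> 'c) \<Rightarrow> bool" where
  "related_charts e A N a b T \<longleftrightarrow>
     a \<in> atlas A \<and> b \<in> atlas N \<and> bounded_linear T \<and> bij T \<and> bounded_linear (inv T) \<and>
     fst a = {z \<in> points A. e z \<in> fst b} \<and> (\<forall>z\<in>fst a. snd a z = T (snd b (e z)))"

text \<open>Coordinate form of "the tangent map of \<open>e\<close> at \<open>z\<close> takes
  \<open>Y\<close> to \<open>v\<close>". It passes to differences directly, and the clause with 0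
  makes \<open>Y\<close> determined by \<open>v\<close> once every chart of \<open>A\<close> is
  related to some chart of \<open>N\<close>.\<close>

definition related_vectors ::
  "('p \<Rightarrow> 'q) \<Rightarrow> ('p, 'c::real_normed_vector) manifold \<Rightarrow> ('q, 'd::real_normed_vector) manifold \<Rightarrow>
   'p \<Rightarrow> ('p, 'c) tangent \<Rightarrow> ('q, 'd) tangent \<Rightarrow> bool" where
  "related_vectors e A N z Y v \<longleftrightarrow>
     (\<forall>a. \<not> (a \<in> atlas A \<and> z \<in> fst a) \<longrightarrow> Y a = 0) \<and>
     (\<forall>a b T. related_charts e A N a b T \<and> z \<in> fst a \<longrightarrow> Y a = T (v b))"

lemma related_vectorsD:
  assumes "related_vectors e A N z Y v"
  shows "\<not> (a \<in> atlas A \<and> z \<in> fst a) \<Longrightarrow> Y a = 0"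
    and "related_charts e A N a b T \<Longrightarrow> z \<in> fst a \<Longrightarrow> Y a = T (v b)"
  using assms unfolding related_vectors_def by blast+

lemma related_vectors_diff:
  assumes "related_vectors e A N z Y v" "related_vectors e A N z Y' v'"
  shows "related_vectors e A N z (Y - Y') (v - v')"
  unfolding related_vectors_def
proof (intro conjI allI impI)
  fix a b T assume *: "related_charts e A N a b T \<and> z \<in> fst a"
  then have "linear T" by (auto simp: related_charts_def bounded_linear.linear)
  then show "(Y - Y') a = T ((v - v') b)"
    using related_vectorsD(2)[OF assms(1), of a b T] related_vectorsD(2)[OF assms(2), of a b T] *
    by (simp add: linear_diff)
qed (use related_vectorsD(1)[OF assms(1)] related_vectorsD(1)[OF assms(2)] in simp)

lemma bij_inv_apply:
  assumes "bij T"
  shows "inv T (T x) = x" "T (inv T y) = y"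
  using assms by (auto simp: bij_is_inj bij_is_surj surj_f_inv_f)

section \<open>Transport of velocities and tangent maps along related charts\<close>

context
  fixes e :: "'p \<Rightarrow> 'q"
    and A :: "('p, 'c::real_normed_vector) manifold"
    and N :: "('q, 'd::real_normed_vector) manifold"
  assumes N: "differentiable_atlas N"
    and e: "inj_on e (points A)" "e ` points A = points N"
    and related: "\<forall>a\<in>atlas A. \<exists>b T. related_charts e A N a b T"
    and cover: "points A \<subseteq> (\<Union>a\<in>atlas A. fst a)"
begin

lemma related_overlap_image:
  assumes a: "related_charts e A N a b T" and a': "related_charts e A N a' b' T'"
  shows "snd a ` (fst a \<inter> fst a') = inv T -` (snd b ` (fst b \<inter> fst b'))"
proof -
  have T: "bij T" "inv T (T x) = x" "T (inv T y) = y" for x y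
    using a by (auto simp: related_charts_def bij_is_inj bij_is_surj surj_f_inv_f)
  show ?thesis
  proof (intro equalityI subsetI)
    fix y assume "y \<in> snd a ` (fst a \<inter> fst a')"
    then show "y \<in> inv T -` (snd b ` (fst b \<inter> fst b'))"
      using a a' T by (auto simp: related_charts_def)
  next
    fix y assume "y \<in> inv T -` (snd b ` (fst b \<inter> fst b'))"
    then obtain q where q: "inv T y = snd b q" "q \<in> fst b" "q \<in> fst b'" by auto
    then have "q \<in> points N" using chart_domain_subset[OF N, of b q] a by (simp add: related_charts_def)
    then obtain z where z: "z \<in> points A" "q = e z" using e(2) by auto
    then have "z \<in> fst a \<inter> fst a'" using a a' q by (simp add: related_charts_def)
    moreover have "y = snd a z"
      using calculation a q z T(3)[of y] by (simp add: related_charts_def)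
    ultimately show "y \<in> snd a ` (fst a \<inter> fst a')" by blast
  qed
qed

lemma related_chart_inj:
  assumes "related_charts e A N a b T"
  shows "inj_on (snd a) (fst a)"
proof (rule inj_onI)
  fix z z' assume z: "z \<in> fst a" "z' \<in> fst a" "snd a z = snd a z'"
  then have "T (snd b (e z)) = T (snd b (e z'))"
    using assms by (simp add: related_charts_def)
  then have "snd b (e z) = snd b (e z')"
    using assms by (metis related_charts_def bij_inv_apply(1))
  then have "e z = e z'"
    using z assms chart_inj[OF N, of b] by (auto simp: related_charts_def inj_on_def)
  then show "z = z'" using z e(1) assms by (auto simp: related_charts_def inj_on_def)
qed

lemma related_chart_inv:
  assumes a: "related_charts e A N a b T" and y: "y \<in> snd a ` fst a"
  shows "e (chart_inv a y) = chart_inv b (inv T y)" "chart_inv a y \<in> fst a"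
proof -
  obtain z where z: "z \<in> fst a" "y = snd a z" using y by auto
  have *: "chart_inv a y = z" using chart_inv_apply[OF related_chart_inj[OF a]] z by simp
  have "inv T y = snd b (e z)"
    using a z by (simp add: related_charts_def bij_inv_apply)
  moreover have "e z \<in> fst b" "b \<in> atlas N" using a z by (auto simp: related_charts_def)
  ultimately show "e (chart_inv a y) = chart_inv b (inv T y)"
    using * chart_inv_apply[OF chart_inj[OF N]] by simp
  show "chart_inv a y \<in> fst a" using * z by simp
qed

text \<open>Transition maps of \<open>A\<close> are those of \<open>N\<close> with
  \<open>inv T\<close> before and \<open>T'\<close> after, so openness of overlaps and
  differentiability are inherited.\<close>

lemma related_differentiable_atlas: "differentiable_atlas A"
  unfolding differentiable_atlas_def
proof (intro conjI ballI)
  have "fst a \<subseteq> points A" if "a \<in> atlas A" for a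
    using bspec[OF related that] unfolding related_charts_def by blast
  then show "(\<Union>a\<in>atlas A. fst a) = points A" using cover by blast
  fix a assume "a \<in> atlas A"
  then obtain b T where a: "related_charts e A N a b T" using related by blast
  then show "inj_on (snd a) (fst a)" by (rule related_chart_inj)
  fix a' assume "a' \<in> atlas A"
  then obtain b' T' where a': "related_charts e A N a' b' T'" using related by blast
  have b: "b \<in> atlas N" "b' \<in> atlas N" and lin: "bounded_linear T'" "bounded_linear (inv T)"
    using a a' by (auto simp: related_charts_def)
  show op: "open (snd a ` (fst a \<inter> fst a'))"
    unfolding related_overlap_image[OF a a']
    by (rule open_vimage) (use open_chart_overlap[OF N b] lin in \<open>auto intro: linear_continuous_on\<close>)
  fix y assume y: "y \<in> snd a ` (fst a \<inter> fst a')"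
  then have "inv T y \<in> snd b ` (fst b \<inter> fst b')"
    using related_overlap_image[OF a a'] by auto
  then have "(snd b' \<circ> chart_inv b) differentiable (at (inv T y))"
    using N b unfolding differentiable_atlas_def by blast
  then obtain D where D: "((snd b' \<circ> chart_inv b) has_derivative D) (at (inv T y))"
    by (auto simp: differentiable_def)
  have "((\<lambda>y. T' ((snd b' \<circ> chart_inv b) (inv T y))) has_derivative (\<lambda>v. T' (D (inv T v)))) (at y)"
    by (rule bounded_linear.has_derivative[OF lin(1)
          has_derivative_compose[OF bounded_linear_imp_has_derivative[OF lin(2)] D]])
  then have "((snd a' \<circ> chart_inv a) has_derivative (\<lambda>v. T' (D (inv T v)))) (at y)"
  proof (rule has_derivative_transform_within_open[OF _ op y])
    fix y assume "y \<in> snd a ` (fst a \<inter> fst a')"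
    then have y: "y \<in> snd a ` fst a" and y': "inv T y \<in> snd b ` (fst b \<inter> fst b')"
      using related_overlap_image[OF a a'] by auto
    note * = related_chart_inv[OF a y]
    have "chart_inv b (inv T y) \<in> fst b'"
      using y' chart_inv_apply[OF chart_inj[OF N b(1)]] by auto
    then have "chart_inv a y \<in> fst a'"
      using * a a' by (simp add: related_charts_def)
    then show "T' ((snd b' \<circ> chart_inv b) (inv T y)) = (snd a' \<circ> chart_inv a) y"
      using * a' by (simp add: related_charts_def)
  qed
  then show "(snd a' \<circ> chart_inv a) differentiable (at y)" by (auto simp: differentiable_def)
qed

lemma related_velocity_chart:
  assumes v: "has_velocity N (\<lambda>s. e (\<zeta> s)) t v" and pts: "\<And>s. \<zeta> s \<in> points A"
    and a: "related_charts e A N a b T" and t: "\<zeta> t \<in> fst a"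
  shows "\<forall>\<^sub>F s in nhds t. \<zeta> s \<in> fst a" "((snd a \<circ> \<zeta>) has_vector_derivative T (v b)) (at t)"
proof -
  have b: "b \<in> atlas N" "e (\<zeta> t) \<in> fst b" and T: "bounded_linear T"
    using a t by (auto simp: related_charts_def)
  have ev: "\<forall>\<^sub>F s in nhds t. e (\<zeta> s) \<in> fst b"
    and der: "((snd b \<circ> (\<lambda>s. e (\<zeta> s))) has_vector_derivative v b) (at t)"
    using has_velocityD(3,4)[OF v b] by auto
  from ev show ev': "\<forall>\<^sub>F s in nhds t. \<zeta> s \<in> fst a"
    by eventually_elim (use a pts in \<open>simp add: related_charts_def\<close>)
  have "((\<lambda>s. T ((snd b \<circ> (\<lambda>s. e (\<zeta> s))) s)) has_vector_derivative T (v b)) (at t)"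
    by (rule bounded_linear.has_vector_derivative[OF T der])
  then show "((snd a \<circ> \<zeta>) has_vector_derivative T (v b)) (at t)"
  proof (rule has_vector_derivative_transform_nhds)
    from ev' show "\<forall>\<^sub>F s in nhds t. T ((snd b \<circ> (\<lambda>s. e (\<zeta> s))) s) = (snd a \<circ> \<zeta>) s"
      by eventually_elim (use a in \<open>simp add: related_charts_def\<close>)
  qed
qed

text \<open>A tangent vector is fixed by its coordinates in the charts at its base point and by 0
  elsewhere; relatedness to \<open>v\<close> prescribes both.\<close>

lemma related_velocity:
  assumes v: "has_velocity N (\<lambda>s. e (\<zeta> s)) t v" and pts: "\<And>s. \<zeta> s \<in> points A"
    and Y: "related_vectors e A N (\<zeta> t) Y v"
  shows "has_velocity A \<zeta> t Y"
proof -
  obtain a where "a \<in> atlas A" and t: "\<zeta> t \<in> fst a" using cover pts[of t] by blast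
  then obtain b T where a: "related_charts e A N a b T" using related by blast
  obtain Y' where Y': "has_velocity A \<zeta> t Y'"
    using has_velocity_exists[OF related_differentiable_atlas _ related_velocity_chart[OF v pts a t]]
      \<open>a \<in> atlas A\<close> by blast
  have "Y' a = Y a" for a
  proof (cases "a \<in> atlas A \<and> \<zeta> t \<in> fst a")
    case True
    then obtain b T where a: "related_charts e A N a b T" using related by blast
    have "Y' a = T (v b)"
      using related_velocity_chart(2)[OF v pts a] has_velocityD(4)[OF Y'] True
        vector_derivative_unique_at by metis
    then show ?thesis using Y a True unfolding related_vectors_def by metis
  next
    case False
    then show ?thesis
      using Y has_velocityD(2)[OF Y'] tangent_space_outside unfolding related_vectors_def by metis
  qed
  then show ?thesis using Y' by (metis ext)
qed

text \<open>Serves curves in \<open>A\<close> whose velocity is not known beforehand, as in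
  \<open>assoc_lift\<close>, where it is given by \<open>velocity\<close>.\<close>

lemma related_velocity_exists:
  assumes v: "has_velocity N (\<lambda>s. e (\<zeta> s)) t v" and pts: "\<And>s. \<zeta> s \<in> points A"
  shows "\<exists>Y. has_velocity A \<zeta> t Y \<and> related_vectors e A N (\<zeta> t) Y v"
proof -
  obtain a where "a \<in> atlas A" and t: "\<zeta> t \<in> fst a" using cover pts[of t] by blast
  then obtain b T where a: "related_charts e A N a b T" using related by blast
  obtain Y where Y: "has_velocity A \<zeta> t Y"
    using has_velocity_exists[OF related_differentiable_atlas _ related_velocity_chart[OF v pts a t]]
      \<open>a \<in> atlas A\<close> by blast
  have "Y a = T (v b)" if a: "related_charts e A N a b T" "\<zeta> t \<in> fst a" for a b T
  proof -
    have "a \<in> atlas A" using a by (simp add: related_charts_def)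
    then show ?thesis
      using related_velocity_chart(2)[OF v pts a] has_velocityD(4)[OF Y] a(2)
        vector_derivative_unique_at by metis
  qed
  then have "related_vectors e A N (\<zeta> t) Y v"
    using has_velocityD(2)[OF Y] tangent_space_outside unfolding related_vectors_def by metis
  then show ?thesis using Y by blast
qed

text \<open>One related pair of charts is consulted; that \<open>v\<close> is a tangent vector
  carries the result to the remaining charts of \<open>N\<close>.\<close>

lemma related_velocity_rev:
  assumes Y: "has_velocity A \<zeta> t Y" and v: "v \<in> tangent_space N (e (\<zeta> t))"
    and rel: "related_vectors e A N (\<zeta> t) Y v"
  shows "has_velocity N (\<lambda>s. e (\<zeta> s)) t v"
proof -
  obtain a where a': "a \<in> atlas A" and t: "\<zeta> t \<in> fst a"
    using cover has_velocityD(1)[OF Y] by blast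
  then obtain b T where a: "related_charts e A N a b T" using related by blast
  have ev: "\<forall>\<^sub>F s in nhds t. \<zeta> s \<in> fst a"
    and der: "((snd a \<circ> \<zeta>) has_vector_derivative Y a) (at t)"
    using has_velocityD(3,4)[OF Y a' t] by auto
  have b: "b \<in> atlas N" and T: "bounded_linear (inv T)" "bij T"
    using a by (auto simp: related_charts_def)
  have Ya: "inv T (Y a) = v b"
    using related_vectorsD(2)[OF rel a t] bij_inv_apply(1)[OF T(2)] by simp
  show ?thesis
  proof (rule has_velocity_chartI[where \<gamma> = "\<lambda>s. e (\<zeta> s)", OF N b _ _ v])
    from ev show "\<forall>\<^sub>F s in nhds t. e (\<zeta> s) \<in> fst b"
      by eventually_elim (use a in \<open>simp add: related_charts_def\<close>)
    have "((\<lambda>s. inv T ((snd a \<circ> \<zeta>) s)) has_vector_derivative v b) (at t)"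
      using bounded_linear.has_vector_derivative[OF T(1) der] Ya by simp
    then show "((snd b \<circ> (\<lambda>s. e (\<zeta> s))) has_vector_derivative v b) (at t)"
    proof (rule has_vector_derivative_transform_nhds)
      from ev show "\<forall>\<^sub>F s in nhds t. inv T ((snd a \<circ> \<zeta>) s) = (snd b \<circ> (\<lambda>s. e (\<zeta> s))) s"
        by eventually_elim (use a bij_inv_apply(1)[OF T(2)] in \<open>simp add: related_charts_def\<close>)
    qed
  qed
qed

text \<open>The chart of \<open>M\<close> chosen inside \<open>tangent_map\<close> depends on
  \<open>M\<close> and \<open>x\<close> alone, so both tangent maps use the same one. In it the
  expressions of \<open>s\<close> and \<open>h\<close> differ by the linear map \<open>T\<close> on
  an open set, and so do their derivatives.\<close>

lemma related_tangent_map: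
  assumes M: "smooth_manifold M" and h: "smooth_map M N h"
    and s: "\<And>x. x \<in> points M \<Longrightarrow> s x \<in> points A \<and> e (s x) = h x"
    and x: "x \<in> points M"
  shows "related_vectors e A N (s x) (tangent_map M A s x v) (tangent_map M N h x v)"
  unfolding related_vectors_def
proof (intro conjI allI impI)
  note MA = smooth_manifold_differentiable_atlas[OF M]
  fix a b T assume "related_charts e A N a b T \<and> s x \<in> fst a"
  then have a: "related_charts e A N a b T" "s x \<in> fst a" by auto
  then have b: "a \<in> atlas A" "b \<in> atlas N" "h x \<in> fst b" and T: "bounded_linear T"
    using s[OF x] by (auto simp: related_charts_def)
  define c where "c = (SOME c. c \<in> atlas M \<and> x \<in> fst c)"
  have c: "c \<in> atlas M \<and> x \<in> fst c"
    unfolding c_def by (rule someI_ex) (use chart_at[OF MA x] in blast)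
  let ?W = "snd c ` {p \<in> fst c. h p \<in> fst b}"
  have W: "open ?W" "snd c x \<in> ?W" and "smooth_on ?W (snd b \<circ> h \<circ> chart_inv c)"
    using h b c by (auto simp: smooth_map_def)
  then have diff: "(snd b \<circ> h \<circ> chart_inv c) differentiable (at (snd c x))"
    using smooth_on_differentiable by blast
  then obtain D where D: "((snd b \<circ> h \<circ> chart_inv c) has_derivative D) (at (snd c x))"
    by (auto simp: differentiable_def)
  have "((\<lambda>y. T ((snd b \<circ> h \<circ> chart_inv c) y)) has_derivative (\<lambda>v. T (D v))) (at (snd c x))"
    by (rule bounded_linear.has_derivative[OF T D])
  then have "((snd a \<circ> s \<circ> chart_inv c) has_derivative (\<lambda>v. T (D v))) (at (snd c x))"
  proof (rule has_derivative_transform_within_open[OF _ W])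
    fix y assume "y \<in> ?W"
    then obtain p where p: "p \<in> fst c" "h p \<in> fst b" "y = snd c p" by auto
    then have cp: "chart_inv c y = p" using chart_inv_apply[OF chart_inj[OF MA]] c by blast
    have "p \<in> points M" using chart_domain_subset[OF MA] c p by blast
    from s[OF this] show "T ((snd b \<circ> h \<circ> chart_inv c) y) = (snd a \<circ> s \<circ> chart_inv c) y"
      using cp p a(1) by (simp add: related_charts_def)
  qed
  then have "frechet_derivative (snd a \<circ> s \<circ> chart_inv c) (at (snd c x)) = (\<lambda>v. T (D v))"
    by (rule frechet_derivative_at[symmetric])
  moreover have "frechet_derivative (snd b \<circ> h \<circ> chart_inv c) (at (snd c x)) = D"
    using D by (rule frechet_derivative_at[symmetric])
  ultimately show "tangent_map M A s x v a = T (tangent_map M N h x v b)"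
    using a(2) b by (simp add: tangent_map_def c_def[symmetric] Let_def)
qed (auto simp: tangent_map_def)

end

section \<open>Frames and associated bundles\<close>

lemma GL_linear_bij: "g \<in> GL \<Longrightarrow> linear g" "g \<in> GL \<Longrightarrow> bij g"
  by (auto simp: GL_def)

lemma GL_id: "id \<in> GL" "(\<lambda>x. x) \<in> GL"
  by (auto simp: GL_def linear_id linear_ident bij_id[unfolded id_def])

lemma GL_comp: "g \<in> GL \<Longrightarrow> k \<in> GL \<Longrightarrow> g \<circ> k \<in> GL"
  by (auto simp: GL_def linear_compose bij_comp)

lemma GL_inv: "g \<in> GL \<Longrightarrow> inv g \<in> GL"
  by (auto simp: GL_def linear_inv_bij bij_imp_bij_inv)

text \<open>Independence of the representative, for an abstract action because both W and TW are
  needed. The two inclusions reparametrize the orbit by left translation in the group.\<close>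

lemma assoc_class_comp:
  assumes act: "\<And>g k y. act (g \<circ> k) y = act g (act k y)" and g: "g \<in> GL"
  shows "assoc_class act (f \<circ> g) (act (inv g) y) = assoc_class act f y"
  unfolding assoc_class_def
proof (intro equalityI subsetI)
  fix p assume "p \<in> {(f \<circ> g \<circ> k, act (inv k) (act (inv g) y)) |k. k \<in> GL}"
  then obtain k where k: "k \<in> GL" "p = (f \<circ> g \<circ> k, act (inv k) (act (inv g) y))" by blast
  then have "p = (f \<circ> (g \<circ> k), act (inv (g \<circ> k)) y)"
    using g by (simp add: act[symmetric] o_inv_distrib GL_linear_bij comp_assoc)
  then show "p \<in> {(f \<circ> g, act (inv g) y) |g. g \<in> GL}"
    using GL_comp[OF g k(1)] by blast
next
  fix p assume "p \<in> {(f \<circ> g, act (inv g) y) |g. g \<in> GL}"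
  then obtain k where k: "k \<in> GL" "p = (f \<circ> k, act (inv k) y)" by blast
  \<comment> \<open>Translation by \<open>g\<close> is onto GL(W): the point of the orbit belonging
    to \<open>k\<close> is reached through \<open>inv g \<circ> k\<close>.\<close>
  have 1: "g \<circ> (inv g \<circ> k) = k"
    using GL_linear_bij(2)[OF g] by (simp add: fun_eq_iff bij_inv_apply)
  have "inv k = inv (inv g \<circ> k) \<circ> inv g"
    using 1 g k GL_linear_bij by (metis GL_comp GL_inv o_inv_distrib)
  then have "p = (f \<circ> g \<circ> (inv g \<circ> k), act (inv (inv g \<circ> k)) (act (inv g) y))"
    using k 1 by (simp add: act[symmetric] comp_assoc)
  then show "p \<in> {(f \<circ> g \<circ> k, act (inv k) (act (inv g) y)) |k. k \<in> GL}"
    using GL_comp[OF GL_inv[OF g] k(1)] by blast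
qed

lemma actW_comp: "actW (g \<circ> k) w = actW g (actW k w)"
  by (simp add: actW_def)

lemma actTW_comp: "actTW (g \<circ> k) Y = actTW g (actTW k Y)"
  by (simp add: actTW_def)

text \<open>The chosen representative is known only up to some \<open>g\<close>. This suffices
  because evaluation of a frame and its base point do not change under \<open>g\<close>.\<close>

lemma representative_assoc_class:
  "\<exists>g\<in>GL. representative (assoc_class act f y) = (f \<circ> g, act (inv g) y)"
proof -
  have "assoc_class act f y \<noteq> {}" using GL_id by (auto simp: assoc_class_def)
  then have "representative (assoc_class act f y) \<in> assoc_class act f y"
    by (simp add: representative_def some_in_eq)
  then show ?thesis by (auto simp: assoc_class_def)
qed

lemma ev_assoc_class: "ev (assoc_class actW f w) = f w"
proof -
  obtain g where "g \<in> GL" "representative (assoc_class actW f w) = (f \<circ> g, actW (inv g) w)"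
    using representative_assoc_class[of actW f w] by auto
  then show ?thesis by (simp add: ev_def actW_def GL_linear_bij bij_inv_apply)
qed

lemma ev_id_times_vpr_W: "ev (id_times_vpr_W (assoc_class actTW f Y)) = f (snd Y)"
proof -
  obtain g where "g \<in> GL" "representative (assoc_class actTW f Y) = (f \<circ> g, actTW (inv g) Y)"
    using representative_assoc_class[of actTW f Y] by auto
  then show ?thesis
    by (simp add: id_times_vpr_W_def ev_assoc_class vpr_W_def actTW_def GL_linear_bij bij_inv_apply)
qed

lemma is_frame_change:
  assumes f: "is_frame E x f" and f': "is_frame E x f'"
  shows "\<exists>g\<in>GL. f' = f \<circ> g"
proof -
  define g where "g = inv_into UNIV f \<circ> f'"
  have bf: "bij_betw f UNIV (fibre E x)" "bij_betw f' UNIV (fibre E x)"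
    using f f' by (auto simp: is_frame_def)
  have inj: "f w = f w' \<Longrightarrow> w = w'" for w w' using bf by (auto simp: bij_betw_def inj_on_def)
  have fg: "f (g w) = f' w" for w
    using bf by (auto simp: g_def bij_betw_def intro!: f_inv_into_f)
  \<comment> \<open>Since \<open>f\<close> is injective and compatible with the operations,
    linearity of \<open>g\<close> may be tested after applying \<open>f\<close>.\<close>
  have "linear g"
    by (rule linearI; rule inj) (use f f' in \<open>simp_all add: is_frame_def fg\<close>)
  moreover have "bij g"
    unfolding g_def using bf by (meson bij_betw_inv_into bij_betw_trans)
  ultimately show ?thesis using fg by (intro bexI[of _ g]) (auto simp: GL_def)
qed

lemma is_frame_comp:
  assumes "is_frame E x f" "g \<in> GL"
  shows "is_frame E x (f \<circ> g)"
  using assms bij_betw_trans[of g UNIV UNIV f "fibre E x"]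
  by (auto simp: is_frame_def GL_def linear_add linear_scale)

lemma is_frame_proj:
  assumes "is_frame E x f"
  shows "f w \<in> fibre E x" "f w \<in> total E" "proj E (f w) = x" "frame_proj E f = x"
  using assms by (auto simp: is_frame_def bij_betw_def fibre_def frame_proj_def)

lemma framesD:
  assumes "f \<in> frames M E"
  shows "is_frame E (proj E (f w)) f" "proj E (f w) \<in> points M"
  proof -
  obtain x where x: "x \<in> points M" "is_frame E x f" using assms by (auto simp: frames_def)
  then have "proj E (f w) = x" by (simp add: is_frame_proj(3))
  then show "is_frame E (proj E (f w)) f" "proj E (f w) \<in> points M" using x by auto
qed

text \<open>A chart of \<open>total_space\<close> with its two ingredients kept as pairs, so that
  they can be named separately by \<open>c\<close> and \<open>d\<close>.\<close>

definition bundle_chart ::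
  "('x, 'e, 'b) vbundle \<Rightarrow> ('x, 'a) chart \<Rightarrow> 'x set \<times> ('e \<Rightarrow> 'b) \<Rightarrow> ('e, 'a \<times> 'b) chart" where
  "bundle_chart E c d = ({u \<in> total E. proj E u \<in> fst c \<inter> fst d}, \<lambda>u. (snd c (proj E u), snd d u))"

section \<open>Trivializations, fibres and charts of a vector bundle\<close>

locale smooth_vector_bundle =
  fixes M :: "('x, 'a::real_normed_vector) manifold"
    and E :: "('x, 'e, 'b::real_normed_vector) vbundle"
    and m :: nat
  assumes M: "smooth_manifold M" and E: "vector_bundle M E m"
begin

lemma total_manifold: "smooth_manifold (total_space M E)"
  using E by (simp add: vector_bundle_def)

lemmas total_atlas = smooth_manifold_differentiable_atlas[OF total_manifold]

lemma total_points: "points (total_space M E) = total E"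
  by (simp add: total_space_def)

lemma proj_points: "u \<in> total E \<Longrightarrow> proj E u \<in> points M"
  using E by (auto simp: vector_bundle_def)

lemma fibre_proj: "u \<in> total E \<Longrightarrow> u \<in> fibre E (proj E u)"
  by (simp add: fibre_def)

lemma fibre_closed:
  assumes "x \<in> points M" "u \<in> fibre E x"
  shows "u' \<in> fibre E x \<Longrightarrow> vadd E u u' \<in> fibre E x" "vscale E r u \<in> fibre E x"
  using E assms by (auto simp: vector_bundle_def)

lemma triv_at: "x \<in> points M \<Longrightarrow> \<exists>d\<in>trivs E. x \<in> fst d"
proof -
  assume "x \<in> points M"
  moreover have "(\<Union>(V, \<psi>)\<in>trivs E. V) = points M" using E by (simp add: vector_bundle_def)
  ultimately show "\<exists>d\<in>trivs E. x \<in> fst d" by force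
qed

lemma triv_fibre:
  assumes "d \<in> trivs E" "x \<in> fst d"
  shows "x \<in> points M" "bij_betw (snd d) (fibre E x) UNIV"
    "u \<in> fibre E x \<Longrightarrow> u' \<in> fibre E x \<Longrightarrow> snd d (vadd E u u') = snd d u + snd d u'"
    "u \<in> fibre E x \<Longrightarrow> snd d (vscale E r u) = r *\<^sub>R snd d u"
proof -
  have *: "\<forall>(V, \<psi>)\<in>trivs E. openin (mtop M) V \<and>
        (\<forall>x\<in>V. bij_betw \<psi> (fibre E x) UNIV \<and>
           (\<forall>u\<in>fibre E x. \<forall>u'\<in>fibre E x. \<psi> (vadd E u u') = \<psi> u + \<psi> u') \<and>
           (\<forall>u\<in>fibre E x. \<forall>r. \<psi> (vscale E r u) = r *\<^sub>R \<psi> u))"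
    "(\<Union>(V, \<psi>)\<in>trivs E. V) = points M"
    using E by (simp_all add: vector_bundle_def)
  show "x \<in> points M" using *(2) assms by force
  show "bij_betw (snd d) (fibre E x) UNIV"
    "u \<in> fibre E x \<Longrightarrow> u' \<in> fibre E x \<Longrightarrow> snd d (vadd E u u') = snd d u + snd d u'"
    "u \<in> fibre E x \<Longrightarrow> snd d (vscale E r u) = r *\<^sub>R snd d u"
    using *(1) assms by (auto simp: case_prod_beta)
qed

text \<open>The fibres come with operations but without stated vector space laws. Such laws are
  obtained by comparing images under a trivialization, and this is the cancellation step.\<close>

lemma triv_inj:
  assumes "d \<in> trivs E" "x \<in> fst d" "u \<in> fibre E x" "u' \<in> fibre E x" "snd d u = snd d u'"
  shows "u = u'"
  using triv_fibre(2)[OF assms(1,2)] assms by (auto simp: bij_betw_def inj_on_def)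

lemma atlas_total: "atlas (total_space M E) = {bundle_chart E c d | c d. c \<in> atlas M \<and> d \<in> trivs E}"
  by (force simp: total_space_def bundle_chart_def)

lemma is_frame_exists:
  assumes "x \<in> points M" "has_dimension (UNIV :: 'w::real_vector set) m"
  shows "\<exists>f :: 'w \<Rightarrow> 'e. is_frame E x f"
proof -
  obtain d where d: "d \<in> trivs E" "x \<in> fst d" using triv_at[OF assms(1)] by blast
  have "has_dimension (UNIV :: 'b set) m" using E by (simp add: vector_bundle_def)
  then obtain \<iota> :: "'w \<Rightarrow> 'b" where \<iota>: "linear \<iota>" "bij \<iota>"
    using dimension_eq_linear_bij_exists[OF assms(2)] by blast
  note bd = triv_fibre(2)[OF d]
  define f where "f = inv_into (fibre E x) (snd d) \<circ> \<iota>"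
  have f: "snd d (f w) = \<iota> w" "f w \<in> fibre E x" for w
    using bd by (auto simp: f_def bij_betw_def intro: f_inv_into_f inv_into_into)
  have "is_frame E x f"
    unfolding is_frame_def
  proof (intro conjI allI)
    show "bij_betw f UNIV (fibre E x)"
      unfolding f_def using bij_betw_trans[OF \<iota>(2) bij_betw_inv_into[OF bd]] .
    fix w w' r
    show "f (w + w') = vadd E (f w) (f w')"
      by (rule triv_inj[OF d]) (use assms f \<iota> triv_fibre[OF d] fibre_closed in \<open>auto simp: linear_add\<close>)
    show "f (r *\<^sub>R w) = vscale E r (f w)"
      by (rule triv_inj[OF d]) (use assms f \<iota> triv_fibre[OF d] fibre_closed in \<open>auto simp: linear_scale\<close>)
  qed
  then show ?thesis by blast
qed

section \<open>The bijection \<open>ev\<close> and the charts of the associated bundle\<close>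

lemma assoc_point_ev:
  assumes "z \<in> assoc_points M E"
  shows "ev z \<in> total E" "assoc_proj E z = proj E (ev z)"
proof -
  obtain f w where f: "f \<in> frames M E" and z: "z = assoc_class actW f w"
    using assms by (auto simp: assoc_points_def)
  obtain g where g: "g \<in> GL" "representative z = (f \<circ> g, actW (inv g) w)"
    using representative_assoc_class[of actW f w] z by auto
  have fr: "is_frame E (proj E (f w)) f" using framesD(1)[OF f] .
  then show "ev z \<in> total E" using is_frame_proj(2) by (simp add: z ev_assoc_class)
  show "assoc_proj E z = proj E (ev z)"
    using is_frame_proj(4)[OF is_frame_comp[OF fr g(1)]]
    by (simp add: assoc_proj_def g(2)) (simp add: z ev_assoc_class)
qed

lemma assoc_class_points: "f \<in> frames M E \<Longrightarrow> assoc_class actW f w \<in> assoc_points M E"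
  by (auto simp: assoc_points_def)

text \<open>The common value fixes the fibre, so the two frames differ by some \<open>g\<close>;
  injectivity of \<open>f\<close> then determines \<open>w'\<close>.\<close>

lemma assoc_class_eq:
  assumes f: "f \<in> frames M E" "f' \<in> frames M E" and eq: "f w = f' w'"
  shows "\<exists>g\<in>GL. f' = f \<circ> g \<and> w' = inv g w"
proof -
  obtain g where g: "g \<in> GL" "f' = f \<circ> g"
    using is_frame_change[OF framesD(1)[OF f(1), of w]] framesD(1)[OF f(2), of w'] eq by auto
  have "inj f" using framesD(1)[OF f(1)] by (auto simp: is_frame_def bij_betw_def)
  then have "w = g w'" using eq g by (simp add: inj_eq)
  then show ?thesis using g GL_linear_bij bij_inv_apply by (metis)
qed

lemma ev_inj_on: "inj_on ev (assoc_points M E :: ('w::real_vector, 'e) assoc_point set)"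
proof (rule inj_onI)
  fix z z' :: "('w, 'e) assoc_point"
  assume "z \<in> assoc_points M E" "z' \<in> assoc_points M E" and eq: "ev z = ev z'"
  then obtain f w f' w' where f: "f \<in> frames M E" "f' \<in> frames M E"
    and z: "z = assoc_class actW f w" "z' = assoc_class actW f' w'"
    by (auto simp: assoc_points_def)
  then have "f w = f' w'" using eq by (simp add: ev_assoc_class)
  then obtain g where "g \<in> GL" "f' = f \<circ> g" "w' = inv g w" using assoc_class_eq[OF f] by blast
  then show "z = z'"
    using assoc_class_comp[of actW g f w, OF actW_comp] z by (simp add: actW_def)
qed

lemma ev_image:
  assumes "has_dimension (UNIV :: 'w::real_vector set) m"
  shows "ev ` (assoc_points M E :: ('w, 'e) assoc_point set) = total E"
proof (intro equalityI subsetI)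
  fix u assume u: "u \<in> total E"
  obtain f :: "'w \<Rightarrow> 'e" where f: "is_frame E (proj E u) f"
    using is_frame_exists[OF proj_points[OF u] assms] by blast
  then have "f \<in> frames M E" using proj_points[OF u] by (auto simp: frames_def)
  moreover have "u \<in> range f"
    using f fibre_proj[OF u] by (simp add: is_frame_def bij_betw_def)
  then obtain w where "f w = u" by blast
  ultimately show "u \<in> ev ` (assoc_points M E :: ('w, 'e) assoc_point set)"
    by (metis assoc_class_points ev_assoc_class imageI)
qed (use assoc_point_ev in auto)

lemma ev_ev_inv:
  assumes "has_dimension (UNIV :: 'w::real_vector set) m" "u \<in> total E"
  shows "(ev_inv M E u :: ('w, 'e) assoc_point) \<in> assoc_points M E"
    "ev (ev_inv M E u :: ('w, 'e) assoc_point) = u"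
  using assms ev_image[OF assms(1)] unfolding ev_inv_def
  by (auto intro: inv_into_into f_inv_into_f)

lemma assoc_related_charts:
  fixes a :: "(('w::real_normed_vector, 'e) assoc_point, 'a \<times> 'w) chart"
  assumes dim: "has_dimension (UNIV :: 'w set) m" and a: "a \<in> atlas (assoc_bundle M E)"
  shows "\<exists>c d T. c \<in> atlas M \<and> d \<in> trivs E \<and>
    related_charts ev (assoc_bundle M E) (total_space M E) a (bundle_chart E c d) T"
proof -
  obtain c d and \<iota> :: "'w \<Rightarrow> 'b" where c: "c \<in> atlas M" and d: "d \<in> trivs E"
    and \<iota>: "linear \<iota>" "bij \<iota>"
    and a_eq: "a = ({z \<in> assoc_points M E. assoc_proj E z \<in> fst c \<inter> fst d},
      \<lambda>z. (snd c (assoc_proj E z), case representative z of (f, w) \<Rightarrow> (inv \<iota> \<circ> snd d \<circ> f) w))"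
    using a by (fastforce simp: assoc_bundle_def principal_trivs_def)
  \<comment> \<open>In the chart \<open>a\<close> the fibre coordinate is \<open>inv \<iota>\<close>
    applied to the trivialization of \<open>ev z\<close>. Naming the inverse \<open>S\<close>
    explicitly reduces boundedness in both directions to that of \<open>\<iota>\<close> and
    \<open>inv \<iota>\<close>.\<close>
  define T where "T p = (fst p, inv \<iota> (snd p))" for p :: "'a \<times> 'b"
  define S where "S p = (fst p, \<iota> (snd p))" for p :: "'a \<times> 'w"
  have TS: "T (S p) = p" "S (T q) = q" for p q
    by (auto simp: T_def S_def bij_inv_apply[OF \<iota>(2)])
  then have bijT: "bij T" by (metis bijI')
  have invT: "inv T = S" using TS by (metis bijT bij_inv_apply(1) ext)
  have "has_dimension (UNIV :: 'b set) m" using E by (simp add: vector_bundle_def)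
  then have bl: "bounded_linear \<iota>" "bounded_linear (inv \<iota>)"
    using finite_dimension_linear_bounded dim \<iota> linear_inv_bij by blast+
  have "bounded_linear T" "bounded_linear S"
    unfolding T_def S_def
    by (intro bounded_linear_Pair bounded_linear_fst bounded_linear_compose[OF bl(2)]
        bounded_linear_compose[OF bl(1)] bounded_linear_snd)+
  moreover have chart_eq: "snd a z = T (snd (bundle_chart E c d) (ev z))" if "z \<in> assoc_points M E" for z
    using assoc_point_ev(2)[OF that]
    by (auto simp: a_eq T_def bundle_chart_def ev_def split: prod.splits)
  ultimately have "related_charts ev (assoc_bundle M E) (total_space M E) a (bundle_chart E c d) T"
    unfolding related_charts_def invT
  proof (intro conjI)
    show "bundle_chart E c d \<in> atlas (total_space M E)" unfolding atlas_total using c d by blast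
    show "fst a = {z \<in> points (assoc_bundle M E). ev z \<in> fst (bundle_chart E c d)}"
      by (auto simp: a_eq bundle_chart_def assoc_bundle_def assoc_point_ev)
    have "fst a \<subseteq> assoc_points M E" by (auto simp: a_eq)
    then show "\<forall>z\<in>fst a. snd a z = T (snd (bundle_chart E c d) (ev z))" using chart_eq by blast
  qed (use a bijT in auto)
  then show ?thesis using c d by blast
qed

lemma assoc_cover:
  assumes dim: "has_dimension (UNIV :: 'w::real_normed_vector set) m"
  shows "points (assoc_bundle M E :: (('w, 'e) assoc_point, 'a \<times> 'w) manifold) \<subseteq>
    (\<Union>a\<in>atlas (assoc_bundle M E :: (('w, 'e) assoc_point, 'a \<times> 'w) manifold). fst a)"
proof
  fix z :: "('w, 'e) assoc_point" assume "z \<in> points (assoc_bundle M E)"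
  then have z: "z \<in> assoc_points M E" by (simp add: assoc_bundle_def)
  then have x: "assoc_proj E z \<in> points M" using assoc_point_ev[OF z] proj_points[of "ev z"] by simp
  obtain c where c: "c \<in> atlas M" "assoc_proj E z \<in> fst c"
    using chart_at[OF smooth_manifold_differentiable_atlas[OF M] x] by blast
  obtain d where d: "d \<in> trivs E" "assoc_proj E z \<in> fst d" using triv_at[OF x] by blast
  have "has_dimension (UNIV :: 'b set) m" using E by (simp add: vector_bundle_def)
  then obtain \<iota> :: "'w \<Rightarrow> 'b" where \<iota>: "linear \<iota>" "bij \<iota>"
    using dimension_eq_linear_bij_exists[OF dim] by blast
  define \<tau> :: "('w \<Rightarrow> 'e) \<Rightarrow> 'w \<Rightarrow> 'w" where "\<tau> f = inv \<iota> \<circ> snd d \<circ> f" for f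
  have "(fst d, \<tau>) \<in> principal_trivs E"
    unfolding principal_trivs_def using d(1) \<iota> by (auto simp: \<tau>_def[abs_def] intro!: exI[of _ \<iota>] exI[of _ "snd d"])
  moreover have "(fst c, snd c) \<in> atlas M" using c by simp
  ultimately have "({z \<in> assoc_points M E. assoc_proj E z \<in> fst c \<inter> fst d},
      \<lambda>z. (snd c (assoc_proj E z), case representative z of (f, w) \<Rightarrow> \<tau> f w)) \<in> atlas (assoc_bundle M E)"
    unfolding assoc_bundle_def manifold.simps by blast
  then show "z \<in> (\<Union>a\<in>atlas (assoc_bundle M E :: (('w, 'e) assoc_point, 'a \<times> 'w) manifold). fst a)"
    using z c d by (intro UN_I) auto
qed

lemma assoc_representative:
  assumes z: "z \<in> assoc_points M E" and fw: "representative z = (f, w)"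
  shows "f \<in> frames M E" "ev z = f w" "z = assoc_class actW f w"
proof -
  obtain f' w' where f': "f' \<in> frames M E" and z': "z = assoc_class actW f' w'"
    using z by (auto simp: assoc_points_def)
  obtain g where g: "g \<in> GL" "representative z = (f' \<circ> g, actW (inv g) w')"
    using representative_assoc_class[of actW f' w'] z' by auto
  then have f: "f = f' \<circ> g" "w = actW (inv g) w'" using fw by auto
  show "f \<in> frames M E"
    using is_frame_comp[OF framesD(1)[OF f'] g(1)] framesD(2)[OF f'] f by (auto simp: frames_def)
  show "ev z = f w" using fw by (simp add: ev_def)
  show "z = assoc_class actW f w"
    using assoc_class_comp[of actW g f' w', OF actW_comp g(1)] f z' by simp
qed

context
  assumes dim: "has_dimension (UNIV :: 'w::real_normed_vector set) m"
begin

lemma assoc_manifold_related: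
  shows "inj_on ev (points (assoc_bundle M E :: (('w, 'e) assoc_point, 'a \<times> 'w) manifold))"
    and "ev ` points (assoc_bundle M E :: (('w, 'e) assoc_point, 'a \<times> 'w) manifold) = points (total_space M E)"
    and "\<forall>a\<in>atlas (assoc_bundle M E :: (('w, 'e) assoc_point, 'a \<times> 'w) manifold).
      \<exists>b T. related_charts ev (assoc_bundle M E) (total_space M E) a b T"
proof -
  have pts: "points (assoc_bundle M E :: (('w, 'e) assoc_point, 'a \<times> 'w) manifold) = assoc_points M E"
    by (simp add: assoc_bundle_def)
  show "inj_on ev (points (assoc_bundle M E :: (('w, 'e) assoc_point, 'a \<times> 'w) manifold))"
    unfolding pts by (rule ev_inj_on)
  show "ev ` points (assoc_bundle M E :: (('w, 'e) assoc_point, 'a \<times> 'w) manifold) = points (total_space M E)"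
    unfolding pts total_points by (rule ev_image[OF dim])
  show "\<forall>a\<in>atlas (assoc_bundle M E :: (('w, 'e) assoc_point, 'a \<times> 'w) manifold).
      \<exists>b T. related_charts ev (assoc_bundle M E) (total_space M E) a b T"
    using assoc_related_charts[OF dim] by blast
qed

lemmas assoc_differentiable_atlas = related_differentiable_atlas[OF total_atlas assoc_manifold_related assoc_cover[OF dim]]
  and assoc_velocity = related_velocity[OF total_atlas assoc_manifold_related assoc_cover[OF dim]]
  and assoc_velocity_exists = related_velocity_exists[OF total_atlas assoc_manifold_related assoc_cover[OF dim]]
  and assoc_velocity_rev = related_velocity_rev[OF total_atlas assoc_manifold_related assoc_cover[OF dim]]
  and assoc_tangent_map_related = related_tangent_map[OF total_atlas assoc_manifold_related assoc_cover[OF dim]]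

end

end

section \<open>Base and fibre components of tangent vectors of E\<close>

context smooth_vector_bundle
begin

lemmas base_atlas = smooth_manifold_differentiable_atlas[OF M]

lemma bundle_chart_atlas: "c \<in> atlas M \<Longrightarrow> d \<in> trivs E \<Longrightarrow> bundle_chart E c d \<in> atlas (total_space M E)"
  unfolding atlas_total by blast

lemma bundle_chart_at:
  assumes "x \<in> points M"
  shows "\<exists>c\<in>atlas M. \<exists>d\<in>trivs E. x \<in> fst c \<and> x \<in> fst d"
  using chart_at[OF base_atlas assms] triv_at[OF assms] by blast

text \<open>The first component of a bundle chart is a base chart after the projection. The
  transition derivative brings the chart chosen inside \<open>tangent_map\<close> to the given
  one.\<close>

lemma fst_tangent_total:
  assumes u: "u \<in> total E" and v: "v \<in> tangent_space (total_space M E) u"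
    and c: "c \<in> atlas M" "proj E u \<in> fst c" and d: "d \<in> trivs E" "proj E u \<in> fst d"
  shows "fst (v (bundle_chart E c d)) = tangent_map (total_space M E) M (proj E) u v c"
proof -
  note N = total_atlas
  let ?b = "bundle_chart E c d"
  define k where "k = (SOME k. k \<in> atlas (total_space M E) \<and> u \<in> fst k)"
  have k: "k \<in> atlas (total_space M E) \<and> u \<in> fst k"
    unfolding k_def by (rule someI_ex) (use chart_at[OF N, of u] u in \<open>auto simp: total_points\<close>)
  have b: "?b \<in> atlas (total_space M E)" "u \<in> fst ?b"
    using bundle_chart_atlas c d u by (auto simp: bundle_chart_def)
  let ?D = "frechet_derivative (snd ?b \<circ> chart_inv k) (at (snd k u))"
  have "((snd ?b \<circ> chart_inv k) has_derivative ?D) (at (snd k u))"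
    using transition_has_derivative[OF N] k b by blast
  then have "((\<lambda>y. fst ((snd ?b \<circ> chart_inv k) y)) has_derivative (\<lambda>h. fst (?D h))) (at (snd k u))"
    by (rule has_derivative_fst)
  moreover have "(\<lambda>y. fst ((snd ?b \<circ> chart_inv k) y)) = snd c \<circ> proj E \<circ> chart_inv k"
    by (auto simp: bundle_chart_def)
  ultimately have "frechet_derivative (snd c \<circ> proj E \<circ> chart_inv k) (at (snd k u)) = (\<lambda>h. fst (?D h))"
    using frechet_derivative_at by metis
  moreover have "v ?b = ?D (v k)"
    using tangent_space_transition[OF v _ b(1) _ b(2)] k by blast
  ultimately show ?thesis
    using c by (simp add: tangent_map_def k_def[symmetric] Let_def)
qed

lemma vscale_one: "u \<in> total E \<Longrightarrow> vscale E 1 u = u"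
proof -
  assume u: "u \<in> total E"
  note x = proj_points[OF u] and f = fibre_proj[OF u]
  obtain d where d: "d \<in> trivs E" "proj E u \<in> fst d" using triv_at[OF x] by blast
  show ?thesis
    by (rule triv_inj[OF d]) (use f fibre_closed[OF x f] triv_fibre[OF d] in auto)
qed

text \<open>Linearity of a connection is phrased for combinations r u + r' u'. This law with r' = 0
  isolates scalar multiples; \<open>vscale_one\<close> with r = r' = 1 isolates sums.\<close>

lemma vadd_vscale_zero:
  assumes u: "u \<in> total E" and u': "u' \<in> total E" "proj E u' = proj E u"
  shows "vadd E (vscale E r u) (vscale E 0 u') = vscale E r u"
proof -
  note x = proj_points[OF u] and f = fibre_proj[OF u]
  have f': "u' \<in> fibre E (proj E u)" using u' by (simp add: fibre_def)
  obtain d where d: "d \<in> trivs E" "proj E u \<in> fst d" using triv_at[OF x] by blast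
  show ?thesis
    by (rule triv_inj[OF d])
      (use f f' fibre_closed[OF x] triv_fibre[OF d] in auto)
qed

lemma smooth_map_tangent:
  assumes N: "differentiable_atlas N" and h: "smooth_map M N h" and x: "x \<in> points M"
  shows "tangent_map M N h x v \<in> tangent_space N (h x)"
  unfolding tangent_space_def
proof (intro CollectI conjI allI impI ballI)
  fix d d' assume d: "d \<in> atlas N" and d': "d' \<in> atlas N" and hx: "h x \<in> fst d \<and> h x \<in> fst d'"
  define c where "c = (SOME c. c \<in> atlas M \<and> x \<in> fst c)"
  have c: "c \<in> atlas M \<and> x \<in> fst c"
    unfolding c_def by (rule someI_ex) (use chart_at[OF base_atlas x] in blast)
  have cx: "chart_inv c (snd c x) = x" using chart_inv_apply[OF chart_inj[OF base_atlas]] c by blast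
  let ?W = "snd c ` {p \<in> fst c. h p \<in> fst d}"
  have W: "open ?W" "snd c x \<in> ?W" and "smooth_on ?W (snd d \<circ> h \<circ> chart_inv c)"
    using h d hx c unfolding smooth_map_def by blast+
  then have "(snd d \<circ> h \<circ> chart_inv c) differentiable (at (snd c x))"
    using smooth_on_differentiable by blast
  then obtain D where D: "((snd d \<circ> h \<circ> chart_inv c) has_derivative D) (at (snd c x))"
    by (auto simp: differentiable_def)
  let ?D' = "frechet_derivative (snd d' \<circ> chart_inv d) (at (snd d (h x)))"
  have "((snd d' \<circ> chart_inv d) has_derivative ?D') (at ((snd d \<circ> h \<circ> chart_inv c) (snd c x)))"
    using transition_has_derivative[OF N d d'] hx by (simp add: cx)
  from diff_chain_at[OF D this]
  have "((snd d' \<circ> h \<circ> chart_inv c) has_derivative ?D' \<circ> D) (at (snd c x))"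
  proof (rule has_derivative_transform_within_open[OF _ W])
    fix y assume "y \<in> ?W"
    then obtain p where p: "p \<in> fst c" "h p \<in> fst d" "y = snd c p" by auto
    then have "chart_inv c y = p" using chart_inv_apply[OF chart_inj[OF base_atlas]] c by blast
    then show "((snd d' \<circ> chart_inv d) \<circ> (snd d \<circ> h \<circ> chart_inv c)) y = (snd d' \<circ> h \<circ> chart_inv c) y"
      using p chart_inv_apply[OF chart_inj[OF N d]] by simp
  qed
  then have "frechet_derivative (snd d' \<circ> h \<circ> chart_inv c) (at (snd c x)) = ?D' \<circ> D"
    by (rule frechet_derivative_at[symmetric])
  moreover have "frechet_derivative (snd d \<circ> h \<circ> chart_inv c) (at (snd c x)) = D"
    using D by (rule frechet_derivative_at[symmetric])
  ultimately show "tangent_map M N h x v d' = ?D' (tangent_map M N h x v d)"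
    using hx d d' by (simp add: tangent_map_def c_def[symmetric] Let_def)
qed (auto simp: tangent_map_def)

text \<open>The projection after \<open>h\<close> is the identity, hence so is the base component of
  the tangent map. This makes the difference in \<open>cov_deriv\<close> vertical.\<close>

lemma fst_tangent_section:
  assumes h: "smooth_section M E h" and x: "x \<in> points M" and v: "v \<in> tangent_space M x"
    and c: "c \<in> atlas M" "x \<in> fst c" and d: "d \<in> trivs E" "x \<in> fst d"
  shows "fst (tangent_map M (total_space M E) h x v (bundle_chart E c d)) = v c"
proof -
  let ?b = "bundle_chart E c d" and ?N = "total_space M E"
  have hp: "proj E (h p) = p" "h p \<in> total E" if "p \<in> points M" for p
    using h that by (auto simp: smooth_section_def smooth_map_def total_points)
  have b: "?b \<in> atlas ?N" "h x \<in> fst ?b"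
    using bundle_chart_atlas c d hp[OF x] by (auto simp: bundle_chart_def)
  define k where "k = (SOME k. k \<in> atlas M \<and> x \<in> fst k)"
  have k: "k \<in> atlas M \<and> x \<in> fst k"
    unfolding k_def by (rule someI_ex) (use chart_at[OF base_atlas x] in blast)
  let ?W = "snd k ` {p \<in> fst k. h p \<in> fst ?b}"
  have "smooth_map M ?N h" using h by (simp add: smooth_section_def)
  then have W: "open ?W" "snd k x \<in> ?W" and "smooth_on ?W (snd ?b \<circ> h \<circ> chart_inv k)"
    using b k unfolding smooth_map_def by blast+
  then have "(snd ?b \<circ> h \<circ> chart_inv k) differentiable (at (snd k x))"
    using smooth_on_differentiable by blast
  then obtain D where D: "((snd ?b \<circ> h \<circ> chart_inv k) has_derivative D) (at (snd k x))"
    by (auto simp: differentiable_def)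
  have "((snd c \<circ> chart_inv k) has_derivative (\<lambda>v. fst (D v))) (at (snd k x))"
  proof (rule has_derivative_transform_within_open[OF has_derivative_fst[OF D] W])
    fix y assume "y \<in> ?W"
    then obtain p where p: "p \<in> fst k" "y = snd k p" by auto
    then have "chart_inv k y = p" using chart_inv_apply[OF chart_inj[OF base_atlas]] k by blast
    moreover have "p \<in> points M" using chart_domain_subset[OF base_atlas] k p by blast
    ultimately show "fst ((snd ?b \<circ> h \<circ> chart_inv k) y) = (snd c \<circ> chart_inv k) y"
      using hp by (simp add: bundle_chart_def)
  qed
  then have "frechet_derivative (snd c \<circ> chart_inv k) (at (snd k x)) = (\<lambda>v. fst (D v))"
    by (rule frechet_derivative_at[symmetric])
  moreover have "frechet_derivative (snd ?b \<circ> h \<circ> chart_inv k) (at (snd k x)) = D"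
    using D by (rule frechet_derivative_at[symmetric])
  ultimately show ?thesis
    using b tangent_space_transition[OF v _ c(1) _ c(2), of k] k
    by (simp add: tangent_map_def k_def[symmetric] Let_def)
qed

lemma frame_curve_derivative:
  fixes f :: "'w::real_normed_vector \<Rightarrow> 'e"
  assumes dim: "has_dimension (UNIV :: 'w set) m" and f: "is_frame E x f"
    and \<gamma>: "(\<gamma> has_vector_derivative \<gamma>') (at t)" and d: "d \<in> trivs E" "x \<in> fst d"
  shows "((snd (bundle_chart E c d) \<circ> (\<lambda>s. f (\<gamma> s))) has_vector_derivative (0, snd d (f \<gamma>'))) (at t)"
proof -
  note fib = is_frame_proj(1)[OF f]
  have "linear (\<lambda>w. snd d (f w))"
    by (rule linearI) (use f fib triv_fibre(3,4)[OF d] in \<open>simp_all add: is_frame_def\<close>)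
  then have "bounded_linear (\<lambda>w. snd d (f w))"
    by (rule finite_dimension_linear_bounded[OF dim])
  from bounded_linear.has_vector_derivative[OF this \<gamma>]
  have "((\<lambda>s. (snd c x, snd d (f (\<gamma> s)))) has_vector_derivative (0, snd d (f \<gamma>'))) (at t)"
    by (intro has_vector_derivative_Pair) auto
  moreover have "snd (bundle_chart E c d) \<circ> (\<lambda>s. f (\<gamma> s)) = (\<lambda>s. (snd c x, snd d (f (\<gamma> s))))"
    using is_frame_proj(3)[OF f] by (auto simp: bundle_chart_def)
  ultimately show ?thesis by simp
qed

text \<open>The computation behind both vertical projections: lines w + t u serve
  \<open>vpr_E\<close>, arbitrary curves in W serve \<open>vert_id\<close>. A fixed frame keeps the
  base component constant and is linear in the fibre coordinate.\<close>

lemma frame_curve_velocity_iff: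
  fixes f :: "'w::real_normed_vector \<Rightarrow> 'e"
  assumes dim: "has_dimension (UNIV :: 'w set) m" and f: "is_frame E x f"
    and \<gamma>: "(\<gamma> has_vector_derivative \<gamma>') (at t)"
    and c: "c \<in> atlas M" "x \<in> fst c" and d: "d \<in> trivs E" "x \<in> fst d"
    and v: "v \<in> tangent_space (total_space M E) (f (\<gamma> t))"
  shows "has_velocity (total_space M E) (\<lambda>s. f (\<gamma> s)) t v \<longleftrightarrow>
    v (bundle_chart E c d) = (0, snd d (f \<gamma>'))"
proof -
  let ?b = "bundle_chart E c d"
  have b: "?b \<in> atlas (total_space M E)" "f (\<gamma> s) \<in> fst ?b" for s
    using bundle_chart_atlas c d is_frame_proj[OF f] by (auto simp: bundle_chart_def)
  note der = frame_curve_derivative[OF dim f \<gamma> d, of c]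
  show ?thesis
  proof
    assume "has_velocity (total_space M E) (\<lambda>s. f (\<gamma> s)) t v"
    from vector_derivative_unique_at[OF has_velocityD(4)[OF this b] der]
    show "v ?b = (0, snd d (f \<gamma>'))" .
  next
    assume "v ?b = (0, snd d (f \<gamma>'))"
    then show "has_velocity (total_space M E) (\<lambda>s. f (\<gamma> s)) t v"
      using has_velocity_chartI[where \<gamma> = "\<lambda>s. f (\<gamma> s)", OF total_atlas b(1) _ _ v] b(2) der by simp
  qed
qed

end

section \<open>The flow of the horizontal lift\<close>

locale lifted_vector_field = smooth_vector_bundle M E m
  for M :: "('x, 'a::real_normed_vector) manifold"
    and E :: "('x, 'e, 'b::real_normed_vector) vbundle"
    and m :: nat +
  fixes nabla :: "('x, 'a, 'e, 'a \<times> 'b) hlift"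
    and X :: "'x \<Rightarrow> ('x, 'a) tangent"
  assumes nabla: "linear_connection M E nabla" and X: "vector_field M X"
begin

section \<open>Horizontal lifts and their integral curves in E\<close>

lemma connection_total: "connection M (total_space M E) (proj E) nabla"
  using nabla by (simp add: linear_connection_def)

lemma lift_vector_field: "vector_field (total_space M E) (lift_field (proj E) nabla X)"
  using connection_total X unfolding connection_def by blast

lemma vector_field_tangent: "x \<in> points M \<Longrightarrow> X x \<in> tangent_space M x"
  using X by (simp add: vector_field_def)

lemma lift_tangent:
  assumes "u \<in> total E"
  shows "lift_field (proj E) nabla X u \<in> tangent_space (total_space M E) u"
    "tangent_map (total_space M E) M (proj E) u (lift_field (proj E) nabla X u) = X (proj E u)"
  using connection_total vector_field_tangent[OF proj_points[OF assms]] assms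
  unfolding connection_def lift_field_def total_points by blast+

text \<open>With uniqueness on \<open>M\<close>, integral curves starting in one fibre stay in
  common fibres. Only then can they be added pointwise.\<close>

lemma integral_curve_proj:
  assumes "integral_curve (total_space M E) (lift_field (proj E) nabla X) \<alpha> J"
  shows "integral_curve M X (\<lambda>t. proj E (\<alpha> t)) J"
  unfolding integral_curve_def
proof
  fix t assume "t \<in> J"
  then have v: "has_velocity (total_space M E) \<alpha> t (lift_field (proj E) nabla X (\<alpha> t))"
    using assms by (simp add: integral_curve_def)
  then have u: "\<alpha> t \<in> total E" using has_velocityD(1) by (metis total_points)
  note x = proj_points[OF u]
  obtain c d where c: "c \<in> atlas M" "proj E (\<alpha> t) \<in> fst c" and d: "d \<in> trivs E" "proj E (\<alpha> t) \<in> fst d"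
    using bundle_chart_at[OF x] by blast
  let ?b = "bundle_chart E c d"
  have b: "?b \<in> atlas (total_space M E)" "\<alpha> t \<in> fst ?b"
    using bundle_chart_atlas c d u by (auto simp: bundle_chart_def)
  show "has_velocity M (\<lambda>t. proj E (\<alpha> t)) t (X (proj E (\<alpha> t)))"
  proof (rule has_velocity_chartI[where \<gamma> = "\<lambda>t. proj E (\<alpha> t)", OF base_atlas c(1)])
    show "\<forall>\<^sub>F s in nhds t. proj E (\<alpha> s) \<in> fst c"
      using has_velocityD(3)[OF v b] by eventually_elim (simp add: bundle_chart_def)
    have "((\<lambda>s. fst ((snd ?b \<circ> \<alpha>) s)) has_vector_derivative
        fst (lift_field (proj E) nabla X (\<alpha> t) ?b)) (at t)"
      by (rule bounded_linear.has_vector_derivative[OF bounded_linear_fst has_velocityD(4)[OF v b]])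
    moreover have "(\<lambda>s. fst ((snd ?b \<circ> \<alpha>) s)) = snd c \<circ> (\<lambda>t. proj E (\<alpha> t))"
      by (auto simp: bundle_chart_def)
    ultimately show "((snd c \<circ> (\<lambda>t. proj E (\<alpha> t))) has_vector_derivative X (proj E (\<alpha> t)) c) (at t)"
      using fst_tangent_total[OF u lift_tangent(1)[OF u] c d] lift_tangent(2)[OF u] by simp
  qed (rule vector_field_tangent[OF x])
qed

lemma integral_curve_total:
  "integral_curve (total_space M E) (lift_field (proj E) nabla X) \<alpha> J \<Longrightarrow> t \<in> J \<Longrightarrow> \<alpha> t \<in> total E"
  unfolding integral_curve_def using has_velocityD(1) by (metis total_points)

lemma integral_curve_proj_eq:
  assumes "integral_curve (total_space M E) (lift_field (proj E) nabla X) \<alpha> {a<..<b}"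
    and "integral_curve (total_space M E) (lift_field (proj E) nabla X) \<beta> {a<..<b}"
    and "0 \<in> {a<..<b}" "proj E (\<alpha> 0) = proj E (\<beta> 0)" "t \<in> {a<..<b}"
  shows "proj E (\<alpha> t) = proj E (\<beta> t)"
  using integral_curve_unique[OF M X integral_curve_proj[OF assms(1)] integral_curve_proj[OF assms(2)]]
    assms by blast

text \<open>Linearity of the connection is an infinitesimal statement at time 0; applied at every
  time \<open>t\<close> after a shift, it shows that solutions may be superposed.\<close>

lemma integral_curve_combination:
  assumes \<alpha>: "integral_curve (total_space M E) (lift_field (proj E) nabla X) \<alpha> {a<..<b}"
    and \<beta>: "integral_curve (total_space M E) (lift_field (proj E) nabla X) \<beta> {a<..<b}"
    and 0: "0 \<in> {a<..<b}" "proj E (\<alpha> 0) = proj E (\<beta> 0)"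
  shows "integral_curve (total_space M E) (lift_field (proj E) nabla X)
    (\<lambda>t. vadd E (vscale E r (\<alpha> t)) (vscale E r' (\<beta> t))) {a<..<b}"
  unfolding integral_curve_def
proof
  fix t assume t: "t \<in> {a<..<b}"
  let ?N = "total_space M E" and ?J = "{a<..<b}"
  let ?\<gamma> = "\<lambda>t. vadd E (vscale E r (\<alpha> t)) (vscale E r' (\<beta> t))"
  let ?v = "X (proj E (\<alpha> t))"
  note tot = integral_curve_total[OF \<alpha>] integral_curve_total[OF \<beta>]
  note pr = integral_curve_proj_eq[OF \<alpha> \<beta> 0]
  \<comment> \<open>\<open>linear_connection\<close> asks for curves on all of R lying over each
    other. Where the shifted time leaves the interval the curve is frozen at its value at
    \<open>t\<close>, which keeps the projections equal and changes nothing near 0.\<close>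
  define ext where "ext \<delta> s = (if s + t \<in> ?J then \<delta> (s + t) else \<delta> t)" for \<delta> :: "real \<Rightarrow> 'e" and s
  have ev: "\<forall>\<^sub>F s in nhds 0. s + t \<in> ?J"
    by (rule eventually_nhds_shift[of _ t]) (use t eventually_nhds_in_open[of ?J t] in auto)
  have vel: "has_velocity ?N (ext \<delta>) 0 (nabla (ext \<delta> 0) ?v)"
    if \<delta>: "integral_curve ?N (lift_field (proj E) nabla X) \<delta> ?J" "proj E (\<delta> t) = proj E (\<alpha> t)" for \<delta>
  proof (rule has_velocity_cong_ev)
    have "has_velocity ?N \<delta> t (nabla (\<delta> t) ?v)"
      using bspec[OF \<delta>(1)[unfolded integral_curve_def] t] \<delta>(2) by (simp add: lift_field_def)
    then show "has_velocity ?N (\<lambda>s. \<delta> (s + t)) 0 (nabla (ext \<delta> 0) ?v)"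
      using t by (intro has_velocity_shift) (auto simp: ext_def)
    show "\<forall>\<^sub>F s in nhds 0. \<delta> (s + t) = ext \<delta> s"
      using ev by eventually_elim (simp add: ext_def)
  qed
  have tangent: "?v \<in> tangent_space M (proj E (ext \<alpha> 0))"
    using vector_field_tangent[OF proj_points[OF tot(1)[OF t]]] by (simp add: ext_def)
  have "\<forall>s. ext \<alpha> s \<in> total E \<and> ext \<beta> s \<in> total E \<and> proj E (ext \<alpha> s) = proj E (ext \<beta> s)"
    using tot pr t by (auto simp: ext_def)
  with tangent vel[OF \<alpha> refl] vel[OF \<beta> pr[OF t, symmetric]]
  have "has_velocity ?N (\<lambda>s. vadd E (vscale E r (ext \<alpha> s)) (vscale E r' (ext \<beta> s))) 0
      (nabla (vadd E (vscale E r (ext \<alpha> 0)) (vscale E r' (ext \<beta> 0))) ?v)"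
    using nabla unfolding linear_connection_def by blast
  moreover have "ext \<delta> 0 = \<delta> t" for \<delta> using t by (simp add: ext_def)
  ultimately have "has_velocity ?N (\<lambda>s. vadd E (vscale E r (ext \<alpha> s)) (vscale E r' (ext \<beta> s))) 0 (nabla (?\<gamma> t) ?v)"
    by simp
  then have "has_velocity ?N (\<lambda>s. ?\<gamma> (s + t)) 0 (nabla (?\<gamma> t) ?v)"
  proof (rule has_velocity_cong_ev)
    show "\<forall>\<^sub>F s in nhds 0. vadd E (vscale E r (ext \<alpha> s)) (vscale E r' (ext \<beta> s)) = ?\<gamma> (s + t)"
      using ev by eventually_elim (simp add: ext_def)
  qed
  then have "has_velocity ?N (\<lambda>s. ?\<gamma> (s + - t + t)) t (nabla (?\<gamma> t) ?v)"
    by (rule has_velocity_shift) simp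
  moreover have "proj E (?\<gamma> t) = proj E (\<alpha> t)"
  proof -
    note x = proj_points[OF tot(1)[OF t]] and f = fibre_proj[OF tot(1)[OF t]]
    have "\<beta> t \<in> fibre E (proj E (\<alpha> t))" using fibre_proj[OF tot(2)[OF t]] pr[OF t] by simp
    then have "?\<gamma> t \<in> fibre E (proj E (\<alpha> t))" using f fibre_closed[OF x] by blast
    then show ?thesis by (simp add: fibre_def)
  qed
  ultimately show "has_velocity ?N ?\<gamma> t (lift_field (proj E) nabla X (?\<gamma> t))"
    by (simp add: lift_field_def)
qed

text \<open>Integral curves through the images of a basis of \<open>W\<close> exist on a common interval, and by
  linearity of the connection this interval serves all of \<open>W\<close>.\<close>

lemma integral_curves_through_frame:
  fixes f :: "'w::real_vector \<Rightarrow> 'e"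
  assumes dim: "has_dimension (UNIV :: 'w set) m" and x: "x \<in> points M" and f: "is_frame E x f"
  shows "\<exists>e>0. \<exists>G. \<forall>w. G w 0 = f w \<and>
    integral_curve (total_space M E) (lift_field (proj E) nabla X) (G w) {-e<..<e}"
proof -
  let ?N = "total_space M E" and ?Y = "lift_field (proj E) nabla X"
  obtain B :: "'w set" where B: "finite B" "span B = UNIV"
    using dim by (auto simp: has_dimension_def)
  have "\<exists>e>0. \<exists>\<gamma>. \<gamma> 0 = f w \<and> integral_curve ?N ?Y \<gamma> {-e<..<e}" for w
    by (rule integral_curve_exists[OF total_manifold lift_vector_field])
      (use is_frame_proj(2)[OF f] in \<open>simp add: total_points\<close>)
  then obtain r where r: "\<And>w. r w > 0 \<and> (\<exists>\<gamma>. \<gamma> 0 = f w \<and> integral_curve ?N ?Y \<gamma> {-r w<..<r w})"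
    by metis
  \<comment> \<open>Inserting 0 keeps the minimum defined when the basis is empty (rank zero) and
    puts the zero vector into \<open>S\<close>.\<close>
  define e where "e = Min (r ` insert 0 B)"
  have e: "e > 0" unfolding e_def using B(1) r by (subst Min_gr_iff) auto
  define S where "S = {w. \<exists>\<gamma>. \<gamma> 0 = f w \<and> integral_curve ?N ?Y \<gamma> {-e<..<e}}"
  have base: "w \<in> S" if "w \<in> insert 0 B" for w
  proof -
    have "e \<le> r w" unfolding e_def using B(1) that by (intro Min_le) auto
    then have "{-e<..<e} \<subseteq> {-r w<..<r w}" by auto
    then show ?thesis using r[of w] integral_curve_subset unfolding S_def by blast
  qed
  have comb: "s *\<^sub>R w + s' *\<^sub>R w' \<in> S" if ww: "w \<in> S" "w' \<in> S" for s s' w w'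
  proof -
    obtain \<alpha> \<beta> where \<alpha>: "\<alpha> 0 = f w" "integral_curve ?N ?Y \<alpha> {-e<..<e}"
      and \<beta>: "\<beta> 0 = f w'" "integral_curve ?N ?Y \<beta> {-e<..<e}"
      using ww unfolding S_def by blast
    have "integral_curve ?N ?Y (\<lambda>t. vadd E (vscale E s (\<alpha> t)) (vscale E s' (\<beta> t))) {-e<..<e}"
      by (rule integral_curve_combination[OF \<alpha>(2) \<beta>(2)])
        (use e \<alpha>(1) \<beta>(1) is_frame_proj(3)[OF f] in auto)
    moreover have "vadd E (vscale E s (\<alpha> 0)) (vscale E s' (\<beta> 0)) = f (s *\<^sub>R w + s' *\<^sub>R w')"
      using f \<alpha>(1) \<beta>(1) by (simp add: is_frame_def)
    ultimately show ?thesis unfolding S_def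
      by (intro CollectI exI[of _ "\<lambda>t. vadd E (vscale E s (\<alpha> t)) (vscale E s' (\<beta> t))"]) simp
  qed
  have "subspace S"
    unfolding subspace_def
  proof (intro conjI ballI allI)
    show "0 \<in> S" using base by blast
    show "w + w' \<in> S" if "w \<in> S" "w' \<in> S" for w w' using comb[OF that, of 1 1] by simp
    show "s *\<^sub>R w \<in> S" if "w \<in> S" for s w using comb[OF that that, of s 0] by simp
  qed
  moreover have "B \<subseteq> S" using base by blast
  ultimately have "span B \<subseteq> S" by (rule span_minimal[rotated])
  then have "\<forall>w. \<exists>\<gamma>. \<gamma> 0 = f w \<and> integral_curve ?N ?Y \<gamma> {-e<..<e}"
    using B(2) by (auto simp: S_def)
  then show ?thesis using e by metis
qed

text \<open>Linearity in \<open>w\<close> compares solutions that agree at time 0; injectivity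
  compares solutions that agree at time \<open>t\<close> and runs back to 0. In a trivialization
  equal dimensions then give surjectivity onto the fibre.\<close>

lemma transported_frame:
  fixes f :: "'w::real_vector \<Rightarrow> 'e"
  assumes dim: "has_dimension (UNIV :: 'w set) m" and x: "x \<in> points M" and f: "is_frame E x f"
    and e: "e > 0"
    and G: "\<And>w. G w 0 = f w"
      "\<And>w. integral_curve (total_space M E) (lift_field (proj E) nabla X) (G w) {-e<..<e}"
    and t: "t \<in> {-e<..<e}"
  shows "(\<lambda>w. G w t) \<in> frames M E"
proof -
  let ?N = "total_space M E" and ?Y = "lift_field (proj E) nabla X"
  note uniq = integral_curve_unique[OF total_manifold lift_vector_field]
  have 0: "0 \<in> {-e<..<e}" using e by simp
  have pf: "proj E (f w) = x" for w by (rule is_frame_proj(3)[OF f])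
  have tot: "G w t \<in> total E" for w by (rule integral_curve_total[OF G(2) t])
  have pr: "proj E (G w t) = proj E (G w' t)" for w w'
    using integral_curve_proj_eq[OF G(2) G(2) 0 _ t] G(1) pf by simp
  have lin: "G (r *\<^sub>R w + r' *\<^sub>R w') t = vadd E (vscale E r (G w t)) (vscale E r' (G w' t))" for r r' w w'
  proof (rule uniq[OF G(2) integral_curve_combination[OF G(2) G(2) 0] 0 _ t])
    show "proj E (G w 0) = proj E (G w' 0)" using G(1) pf by simp
    show "G (r *\<^sub>R w + r' *\<^sub>R w') 0 = vadd E (vscale E r (G w 0)) (vscale E r' (G w' 0))"
      using f by (simp add: G(1) is_frame_def)
  qed
  have add: "G (w + w') t = vadd E (G w t) (G w' t)" for w w'
    using lin[of 1 w 1 w'] vscale_one[OF tot] by simp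
  have scale: "G (r *\<^sub>R w) t = vscale E r (G w t)" for r w
    using lin[of r w 0 w] vadd_vscale_zero[OF tot tot pr] by simp
  have inj: "w = w'" if "G w t = G w' t" for w w'
  proof -
    have "G w 0 = G w' 0" by (rule uniq[OF G(2) G(2) t that 0])
    then show ?thesis using f G(1) by (simp add: is_frame_def bij_betw_def inj_eq)
  qed
  define y where "y = proj E (G 0 t)"
  have y: "y \<in> points M" unfolding y_def by (rule proj_points[OF tot])
  have fib: "G w t \<in> fibre E y" for w
    using tot pr[of w 0] by (simp add: fibre_def y_def)
  obtain d where d: "d \<in> trivs E" "y \<in> fst d" using triv_at[OF y] by blast
  have "has_dimension (UNIV :: 'b set) m" using E by (simp add: vector_bundle_def)
  moreover have "linear (\<lambda>w. snd d (G w t))"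
    by (rule linearI) (use triv_fibre(3,4)[OF d] fib in \<open>simp_all add: add scale\<close>)
  moreover have "inj (\<lambda>w. snd d (G w t))"
    using triv_inj[OF d fib fib] inj by (auto intro!: injI)
  ultimately have bij: "bij (\<lambda>w. snd d (G w t))"
    by (rule dimension_eq_linear_inj_imp_bij[OF dim])
  have "u \<in> range (\<lambda>w. G w t)" if u: "u \<in> fibre E y" for u
  proof -
    have "snd d u \<in> range (\<lambda>w. snd d (G w t))" using bij_is_surj[OF bij] by simp
    then obtain w where "snd d u = snd d (G w t)" by blast
    then have "u = G w t" by (rule triv_inj[OF d u fib])
    then show ?thesis by blast
  qed
  then have "bij_betw (\<lambda>w. G w t) UNIV (fibre E y)"
    using fib inj by (auto simp: bij_betw_def inj_def)
  then show ?thesis using y add scale by (auto simp: frames_def is_frame_def)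
qed

text \<open>The transported frame solves the flow relation vector by vector in E, and
  \<open>induced_connection\<close> turns this into the flow relation on frames. Uniqueness passes
  through E in the same way.\<close>

lemma frame_flow:
  fixes \<Gamma> :: "('x, 'a, 'e, 'w::real_normed_vector) frame_hlift" and f :: "'w \<Rightarrow> 'e"
  assumes \<Gamma>: "induced_connection M E nabla \<Gamma>"
    and dim: "has_dimension (UNIV :: 'w set) m" and f: "f \<in> frames M E"
  shows "\<exists>e>0. \<exists>G. (\<forall>w. G w 0 = f w) \<and>
    (\<forall>w. integral_curve (total_space M E) (lift_field (proj E) nabla X) (G w) {-e<..<e}) \<and>
    (\<forall>t\<in>{-e<..<e}. (\<lambda>w. G w t) \<in> frames M E \<and>
      flow (frame_bundle M E) (lift_field (frame_proj E) \<Gamma> X) t f = (\<lambda>w. G w t))"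
proof -
  let ?N = "total_space M E" and ?Y = "lift_field (proj E) nabla X"
  obtain x where x: "x \<in> points M" "is_frame E x f" using f by (auto simp: frames_def)
  obtain e G where e: "e > 0" and G: "\<And>w. G w 0 = f w" "\<And>w. integral_curve ?N ?Y (G w) {-e<..<e}"
    using integral_curves_through_frame[OF dim x] by blast
  have flows: "flows_to (frame_bundle M E) (lift_field (frame_proj E) \<Gamma> X) t f g \<longleftrightarrow>
      (\<forall>w. flows_to ?N ?Y t (f w) (g w))" if "g \<in> frames M E" for t g
    using \<Gamma> X f that unfolding induced_connection_def by blast
  have fr: "(\<lambda>w. G w t) \<in> frames M E" if "t \<in> {-e<..<e}" for t
    by (rule transported_frame[OF dim x e G that])
  have "flow (frame_bundle M E) (lift_field (frame_proj E) \<Gamma> X) t f = (\<lambda>w. G w t)"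
    if t: "t \<in> {-e<..<e}" for t
    unfolding flow_def
  proof (rule the_equality)
    have Gt: "flows_to ?N ?Y t (f w) (G w t)" for w
      unfolding flows_to_def using G t e
      by (intro exI[of _ "G w"] exI[of _ "-e"] exI[of _ e]) simp
    then show "flows_to (frame_bundle M E) (lift_field (frame_proj E) \<Gamma> X) t f (\<lambda>w. G w t)"
      using flows[OF fr[OF t]] by simp
    fix g assume g: "flows_to (frame_bundle M E) (lift_field (frame_proj E) \<Gamma> X) t f g"
    \<comment> \<open>The equivalence in \<open>induced_connection\<close> speaks of frames, so a
      competing value must first be known to be one; integral curves take their values in the points
      of the manifold.\<close>
    then have "g \<in> points (frame_bundle M E)"
      unfolding flows_to_def integral_curve_def using has_velocityD(1) by blast
    then have "g \<in> frames M E" by (simp add: frame_bundle_def)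
    then have "flows_to ?N ?Y t (f w) (g w)" for w using flows g by blast
    then show "g = (\<lambda>w. G w t)"
      using flows_to_unique[OF total_manifold lift_vector_field _ Gt] by blast
  qed
  then show ?thesis using e G fr by blast
qed

section \<open>The covariant Darboux-Lie derivative\<close>

text \<open>The representative (f, w) is chosen, but \<open>ev\<close> turns its curve into the
  integral curve through f w = \<open>ev z\<close>, which depends on \<open>z\<close> alone.\<close>

lemma assoc_lift_related:
  fixes \<Gamma> :: "('x, 'a, 'e, 'w::real_normed_vector) frame_hlift"
  assumes \<Gamma>: "induced_connection M E nabla \<Gamma>"
    and dim: "has_dimension (UNIV :: 'w set) m" and z: "z \<in> assoc_points M E"
  shows "related_vectors ev (assoc_bundle M E) (total_space M E) z
    (assoc_lift M E \<Gamma> X z) (lift_field (proj E) nabla X (ev z))"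
proof -
  let ?A = "assoc_bundle M E :: (('w, 'e) assoc_point, 'a \<times> 'w) manifold"
  let ?N = "total_space M E" and ?Y = "lift_field (proj E) nabla X"
  let ?\<Phi> = "flow (frame_bundle M E) (lift_field (frame_proj E) \<Gamma> X)"
  obtain f w where fw: "representative z = (f, w)" by fastforce
  have f: "f \<in> frames M E" and ez: "ev z = f w" and zc: "z = assoc_class actW f w"
    using assoc_representative[OF z fw] by auto
  obtain e G where e: "e > 0" and G: "\<And>w. G w 0 = f w" "\<And>w. integral_curve ?N ?Y (G w) {-e<..<e}"
    and fl: "\<And>t. t \<in> {-e<..<e} \<Longrightarrow> (\<lambda>w. G w t) \<in> frames M E \<and> ?\<Phi> t f = (\<lambda>w. G w t)"
    using frame_flow[OF \<Gamma> dim f] by blast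
  \<comment> \<open>The transport lemmas require a curve with all values in the associated bundle.
    Outside the interval the original frame is used, which leaves the velocity at 0
    unchanged.\<close>
  define \<zeta> where "\<zeta> t = assoc_class actW (if t \<in> {-e<..<e} then \<lambda>w. G w t else f) w" for t
  have ev_e: "\<forall>\<^sub>F t in nhds (0::real). t \<in> {-e<..<e}"
    using e by (intro eventually_nhds_in_open) auto
  have pts: "\<zeta> t \<in> points ?A" for t
    using fl f by (simp add: \<zeta>_def assoc_bundle_def assoc_class_points)
  have "has_velocity ?N (G w) 0 (?Y (G w 0))"
    using G(2)[of w] e by (simp add: integral_curve_def)
  then have vel: "has_velocity ?N (\<lambda>t. ev (\<zeta> t)) 0 (?Y (ev z))"
    unfolding G(1) ez
  proof (rule has_velocity_cong_ev)
    from ev_e show "\<forall>\<^sub>F t in nhds 0. G w t = ev (\<zeta> t)"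
      by eventually_elim (simp add: \<zeta>_def ev_assoc_class)
  qed
  have \<zeta>0: "\<zeta> 0 = z" using e G(1) by (simp add: \<zeta>_def zc)
  obtain Z where Z: "has_velocity ?A \<zeta> 0 Z" "related_vectors ev ?A ?N (\<zeta> 0) Z (?Y (ev z))"
    using assoc_velocity_exists[OF dim vel pts] by blast
  have "has_velocity ?A (\<lambda>t. assoc_class actW (?\<Phi> t f) w) 0 Z"
    using Z(1)
  proof (rule has_velocity_cong_ev)
    from ev_e show "\<forall>\<^sub>F t in nhds 0. \<zeta> t = assoc_class actW (?\<Phi> t f) w"
      by eventually_elim (simp add: \<zeta>_def fl)
  qed
  then have "assoc_lift M E \<Gamma> X z = Z"
    unfolding assoc_lift_def fw using velocity_eqI[OF assoc_differentiable_atlas[OF dim]] by simp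
  then show ?thesis using Z(2) \<zeta>0 by simp
qed

end

theorem proposition5p1:
  fixes M :: "('x, 'a::real_normed_vector) manifold"
    and E :: "('x, 'e, 'b::real_normed_vector) vbundle"
    and nabla :: "('x, 'a, 'e, 'a \<times> 'b) hlift"
    and \<Gamma> :: "('x, 'a, 'e, 'w::real_normed_vector) frame_hlift"
    and h :: "'x \<Rightarrow> 'e"
    and X :: "'x \<Rightarrow> ('x, 'a) tangent"
    and m :: nat
  assumes "smooth_manifold M"
    and "vector_bundle M E m"
    and "linear_connection M E nabla"
    and "has_dimension (UNIV :: 'w set) m"
    and "induced_connection M E nabla \<Gamma>"
    and "smooth_section M E h"
    and "vector_field M X"
  shows "\<forall>x\<in>points M.
    cov_deriv M E nabla X h x = (ev \<circ> darboux_lie M E \<Gamma> X (ev_inv M E \<circ> h)) x"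
proof
  interpret lifted_vector_field M E m nabla X
    using assms(1-3,7) by unfold_locales
  note dim = assms(4) and h = assms(6)
  fix x assume x: "x \<in> points M"
  let ?A = "assoc_bundle M E :: (('w, 'e) assoc_point, 'a \<times> 'w) manifold"
  let ?N = "total_space M E" and ?Y = "lift_field (proj E) nabla X"
  let ?s = "ev_inv M E \<circ> h :: 'x \<Rightarrow> ('w, 'e) assoc_point"
  note N = total_atlas
  have h_smooth: "smooth_map M ?N h" using h by (simp add: smooth_section_def)
  have hp: "proj E (h p) = p" "h p \<in> total E" if "p \<in> points M" for p
    using h that by (auto simp: smooth_section_def smooth_map_def total_points)
  have s: "?s p \<in> assoc_points M E" "ev (?s p) = h p" if "p \<in> points M" for p
    using ev_ev_inv[OF dim hp(2)[OF that]] by auto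
  obtain f w where fw: "representative (?s x) = (f, w)" by fastforce
  have f: "f \<in> frames M E" and sc: "?s x = assoc_class actW f w" and hx: "h x = f w"
    using assoc_representative[OF s(1)[OF x] fw] s(2)[OF x] by auto
  have fr: "is_frame E x f" using framesD(1)[OF f, of w] hx hp(1)[OF x] by simp
  define V where "V = tangent_map M ?N h x (X x) - ?Y (h x)"
  define Z where "Z = tangent_map M ?A ?s x (X x) - assoc_lift M E \<Gamma> X (?s x)"
  note Y = lift_tangent[OF hp(2)[OF x]]
  have V: "V \<in> tangent_space ?N (h x)"
    unfolding V_def by (rule tangent_space_diff[OF N smooth_map_tangent[OF N h_smooth x] Y(1)])
  have rel: "related_vectors ev ?A ?N (?s x) Z V"
    unfolding V_def Z_def
  proof (rule related_vectors_diff)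
    show "related_vectors ev ?A ?N (?s x) (tangent_map M ?A ?s x (X x)) (tangent_map M ?N h x (X x))"
      by (rule assoc_tangent_map_related[OF dim M h_smooth _ x]) (use s in \<open>simp add: assoc_bundle_def\<close>)
    show "related_vectors ev ?A ?N (?s x) (assoc_lift M E \<Gamma> X (?s x)) (?Y (h x))"
      using assoc_lift_related[OF assms(5) dim s(1)[OF x]] s(2)[OF x] by simp
  qed
  obtain c d where c: "c \<in> atlas M" "x \<in> fst c" and d: "d \<in> trivs E" "x \<in> fst d"
    using bundle_chart_at[OF x] by blast
  let ?b = "bundle_chart E c d"
  \<comment> \<open>Verticality: both terms of \<open>V\<close> have the base component of
    \<open>X x\<close>, the first because \<open>h\<close> is a section, the second because the lift
    projects to \<open>X\<close>.\<close>
  have "fst (V ?b) = 0"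
    using fst_tangent_section[OF h x _ c d] vector_field_tangent[OF x]
      fst_tangent_total[OF hp(2)[OF x] Y(1), of c d] c d hp(1)[OF x] Y(2) by (simp add: V_def)
  \<comment> \<open>\<open>w'\<close> is the vertical vector \<open>V\<close> expressed in the frame
    \<open>f\<close>; both sides will evaluate to \<open>f w'\<close>.\<close>
  moreover obtain w' where w': "snd d (f w') = snd (V ?b)"
  proof -
    have "snd (V ?b) \<in> range (\<lambda>w. snd d (f w))"
      using triv_fibre(2)[OF d] fr by (auto simp: is_frame_def bij_betw_def simp flip: image_image)
    then show ?thesis using that by (metis rangeE)
  qed
  ultimately have Vb: "V ?b = (0, snd d (f w'))" by (simp add: prod_eq_iff)
  have f_inj: "u = u'" if "snd d (f u) = snd d (f u')" for u u'
    using triv_inj[OF d is_frame_proj(1)[OF fr] is_frame_proj(1)[OF fr] that] fr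
    by (simp add: is_frame_def bij_betw_def inj_eq)
  have line: "((\<lambda>t. w + t *\<^sub>R u) has_vector_derivative u) (at 0)" for u :: 'w
    by (auto intro!: derivative_eq_intros)
  have vel: "has_velocity ?N (\<lambda>t. f (w + t *\<^sub>R u)) 0 V \<longleftrightarrow> V ?b = (0, snd d (f u))" for u
    by (rule frame_curve_velocity_iff[OF dim fr line c d]) (use V hx in simp)
  have "cov_deriv M E nabla X h x = f w'"
    unfolding cov_deriv_def V_def[symmetric] vpr_E_def
  proof (rule the_equality)
    \<comment> \<open>Every vector of the fibre is some \<open>f u\<close>, so the lines used in
      \<open>vpr_E\<close> are images under \<open>f\<close> of lines in W.\<close>
    have eq: "(\<lambda>t. vadd E (h x) (vscale E t (f u))) = (\<lambda>t. f (w + t *\<^sub>R u))" for u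
      using fr hx by (simp add: is_frame_def)
    show "f w' \<in> fibre E (proj E (h x)) \<and>
        has_velocity ?N (\<lambda>t. vadd E (h x) (vscale E t (f w'))) 0 V"
      using is_frame_proj(1)[OF fr] hp(1)[OF x] vel Vb by (simp add: eq)
    fix v assume v: "v \<in> fibre E (proj E (h x)) \<and>
        has_velocity ?N (\<lambda>t. vadd E (h x) (vscale E t v)) 0 V"
    then have "v \<in> range f" using fr hp(1)[OF x] by (simp add: is_frame_def bij_betw_def)
    then obtain u where u: "v = f u" by blast
    then have "V ?b = (0, snd d (f u))" using v vel by (simp add: eq)
    then show "v = f w'" using Vb f_inj[of w' u] u by simp
  qed
  moreover have "vert_id M E (?s x) Z = assoc_class actTW f (w, w')"
    unfolding vert_id_def
  proof (rule the_equality)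
    have "has_velocity ?N (\<lambda>t. ev (assoc_class actW f (w + t *\<^sub>R w'))) 0 V"
      using vel Vb by (simp add: ev_assoc_class)
    then have "has_velocity ?A (\<lambda>t. assoc_class actW f (w + t *\<^sub>R w')) 0 Z"
      by (rule assoc_velocity[OF dim])
        (use f rel sc assoc_class_points in \<open>simp_all add: assoc_bundle_def\<close>)
    then show "\<exists>f' \<gamma> \<gamma>'. f' \<in> frames M E \<and> assoc_class actW f' (\<gamma> 0) = ?s x \<and>
        (\<gamma> has_vector_derivative \<gamma>') (at 0) \<and>
        has_velocity ?A (\<lambda>t. assoc_class actW f' (\<gamma> t)) 0 Z \<and>
        assoc_class actTW f (w, w') = assoc_class actTW f' (\<gamma> 0, \<gamma>')"
      using f sc line[of w'] by (intro exI[of _ f] exI[of _ "\<lambda>t. w + t *\<^sub>R w'"] exI[of _ w']) simp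
    \<comment> \<open>A competing frame over the same point is \<open>f \<circ> g\<close>. Comparing
      fibre components of the two velocities forces \<open>\<gamma>' = inv g w'\<close>, so its
      class is the same orbit in TW.\<close>
    fix C assume "\<exists>f' \<gamma> \<gamma>'. f' \<in> frames M E \<and> assoc_class actW f' (\<gamma> 0) = ?s x \<and>
        (\<gamma> has_vector_derivative \<gamma>') (at 0) \<and>
        has_velocity ?A (\<lambda>t. assoc_class actW f' (\<gamma> t)) 0 Z \<and>
        C = assoc_class actTW f' (\<gamma> 0, \<gamma>')"
    then obtain f' \<gamma> \<gamma>' where f': "f' \<in> frames M E" and z: "assoc_class actW f' (\<gamma> 0) = ?s x"
      and \<gamma>: "(\<gamma> has_vector_derivative \<gamma>') (at 0)"
      and Z: "has_velocity ?A (\<lambda>t. assoc_class actW f' (\<gamma> t)) 0 Z"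
      and C: "C = assoc_class actTW f' (\<gamma> 0, \<gamma>')" by blast
    have f'0: "f' (\<gamma> 0) = f w" using z sc by (metis ev_assoc_class)
    then obtain g where g: "g \<in> GL" "f' = f \<circ> g" "\<gamma> 0 = inv g w"
      using assoc_class_eq[OF f f', of w "\<gamma> 0"] by auto
    have fr': "is_frame E x f'" using is_frame_comp[OF fr g(1)] g(2) by simp
    have "has_velocity ?N (\<lambda>t. ev (assoc_class actW f' (\<gamma> t))) 0 V"
    proof (rule assoc_velocity_rev[OF dim Z])
      show "V \<in> tangent_space ?N (ev (assoc_class actW f' (\<gamma> 0)))"
        using V f'0 hx by (simp add: ev_assoc_class)
      show "related_vectors ev ?A ?N (assoc_class actW f' (\<gamma> 0)) Z V"
        unfolding z by (rule rel)
    qed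
    then have "V ?b = (0, snd d (f' \<gamma>'))"
      using frame_curve_velocity_iff[OF dim fr' \<gamma> c d, of V] V f'0 hx by (simp add: ev_assoc_class)
    then have "g \<gamma>' = w'" using Vb f_inj g(2) by simp
    then have "\<gamma>' = inv g w'" using bij_inv_apply(1)[OF GL_linear_bij(2)[OF g(1)]] by metis
    then show "C = assoc_class actTW f (w, w')"
      using assoc_class_comp[of actTW g f "(w, w')", OF actTW_comp g(1)] g C by (simp add: actTW_def)
  qed
  ultimately show "cov_deriv M E nabla X h x = (ev \<circ> darboux_lie M E \<Gamma> X ?s) x"
    by (simp add: darboux_lie_def Z_def ev_id_times_vpr_W)
qed

end
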